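(* Let $n\ge3$ and $1\le i\le n-1$. Let $x=(x_v)$ be the (classical, commuting, positive) cluster variables on the vertices of the $\mathcal A_n$-quiver, let $\mathbb A(x)=(a_{kl}(x))$ be the associated unipotent upper-triangular matrix, and let $y_1,\dots,y_{n-1}$ be the vertices of the $i$-th line. Let $x'$ be the collection of variables obtained from $x$ by performing the $2n-5$ successive cluster mutations at the vertices $$y_{n-2},\,y_{n-3},\dots,\,y_2,\,y_1,\,y_2,\dots,\,y_{n-2}$$ (just at $y_1$ if $n=3$), starting from the $\mathcal A_n$-quiver, and then interchanging the variables located at $y_1$ and $y_{n-1}$. Then this cluster transformation induces the braid-group transformation $\beta_{i,i+1}$ on the entries of $\mathbb A$: $$\mathbb A(x')=B_{i,i+1}\,\mathbb A(x)\,B_{i,i+1}^{T},$$ where $B_{i,i+1}$ is the $n\times n$ matrix that coincides with the identity except for the $2\times2$ diagonal block in rows and columns $i,i+1$, which equals $\begin{pmatrix}a_{i,i+1}(x)&-1\\1&0\end{pmatrix}$.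
   Context: $SL_n$-quiver and network. Let $I=\{(a,b,c)\in\mathbb Z_{\ge0}^3:a+b+c=n\}$, drawn as a triangular lattice with $(n,0,0)$ bottom left, $(0,n,0)$ bottom right, $(0,0,n)$ top. For each $(a,b,c)\in\mathbb Z_{\ge 0}^3$ with $a+b+c=n-1$ take half-arrows $(a+1,b,c)\to(a,b,c+1)\to(a,b+1,c)\to(a+1,b,c)$; for each $(a,b,c)\in\mathbb Z_{\ge0}^3$ with $a+b+c=n-2$ take half-arrows $(a+1,b,c+1)\to(a+1,b+1,c)\to(a,b+1,c+1)\to(a+1,b,c+1)$; let $\langle\alpha,\beta\rangle=\frac12(\#\{\alpha\to\beta\}-\#\{\beta\to\alpha\})$. The dual directed planar graph has white vertices $w_{abc}$ ($a+b+c=n-1$) and black vertices $b_{abc}$ ($a+b+c=n-2$) at the centers of the corresponding triangles, with edges $w_{abc}\to b_{a,b-1,c}$ ($b\ge1$), $w_{abc}\to b_{a,b,c-1}$ ($c\ge1$), $b_{abc}\to w_{a+1,b,c}$; source $k\to w_{0,k-1,n-k}$ (right side); $w_{k-1,0,n-k}\to$ left sink $k'$; $w_{n-k,k-1,0}\to$ bottom sink $k''$ ($1\le k\le n$). Its faces are labelled by $I$ and carry commuting variables $Z_{a,b,c}$. The weight of a directed path is the product of $Z_\alpha$ over faces $\alpha$ to the right of the path (for left sinks: faces above the path; for bottom sinks: faces on the side containing $(n,0,0)$ and $(0,0,n)$). $(\mathcal M_1)_{kl}=\sum_{P:l\leadsto k'}w(P)$, $(\mathcal M_2)_{kl}=\sum_{P:l\leadsto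 k''}w(P)$. $\mathcal A_n$-quiver. Its vertices are: $(a,b,c)\in I$ with $a,b,c\ge1$, carrying $Z_{a,b,c}$; and $n-1$ amalgamated vertices $\bar k$, $k=1,\dots,n-1$, each obtained by merging $(k,0,n-k)$ and $(n-k,k,0)$, carrying $\bar Z_k=Z_{k,0,n-k}Z_{n-k,k,0}$. The remaining boundary elements $(0,k,n-k)$ and the three corners are deleted. The signed number of arrows from $u$ to $v$ is $\langle u,v\rangle$, where an amalgamated vertex $\bar k$ is identified with the vector $(k,0,n-k)+(n-k,k,0)$. Matrix $\mathbb A$. Let $G=\mathcal M_1^T\mathcal M_2$ (upper triangular); $a_{kl}=G_{kl}/\sqrt{G_{kk}G_{ll}}$ for $k\le l$ and $a_{kl}=0$ for $k>l$. These normalized entries (normalized to have unit diagonal by dividing by Casimir elements) depend only on the variables $x$ of the $\mathcal A_n$-quiver. $i$-th line. $y_s=(s,i,n-i-s)$ for $1\le s\le n-i-1$; $y_{n-i}=\bar i$; $y_{n-i+s}=(i-s,s,n-i)$ for $1\le s\le i-1$. Mutation. $\mu_z$ at a vertex with variable $Z$: $Z\mapsto Z^{-1}$; for each arrow $Z\to Y$, $Y\mapsto Y(1+Z)$; for each arrow $X\to Z$, $X\mapsto X(1+Z^{-1})^{-1}$ (with multiplicity, factors are raised to the number of arrows); the quiver mutates by the standard quiver mutation rule.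
   Formalization: The final equation is reversed: what is proved is A(x) = B A(x') B^T (the inverse braid transformation), because with the stated conventions A(x') = B A(x) B^T is false: for n=3, i=1 and all variables 1, a_13(x') = 3 but the right side has entry 6. *)

theory Defs
  imports Complex_Main "Jordan_Normal_Form.Matrix"
begin

text \<open>Matrices of \<^theory>\<open>Jordan_Normal_Form.Matrix\<close> are indexed from 0, whereas all matrices here are
  indexed by \<open>1, \<dots>, n\<close>. The next two definitions do the shift.\<close>

definition mat_from_1 :: "nat \<Rightarrow> (nat \<Rightarrow> nat \<Rightarrow> real) \<Rightarrow> real mat" where
  "mat_from_1 n f = mat n n (\<lambda>(k, l). f (k + 1) (l + 1))"

definition entry :: "real mat \<Rightarrow> nat \<Rightarrow> nat \<Rightarrow> real" where
  "entry M k l = M $$ (k - 1, l - 1)"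


section \<open>The triangular lattice and its half-arrows\<close>

type_synonym face = "nat \<times> nat \<times> nat"

definition faces :: "nat \<Rightarrow> face set" where
  "faces n = {(a, b, c). a + b + c = n}"

fun up_arrows :: "face \<Rightarrow> (face \<times> face) set" where
  "up_arrows (a, b, c) =
     {((a+1, b, c), (a, b, c+1)), ((a, b, c+1), (a, b+1, c)), ((a, b+1, c), (a+1, b, c))}"

fun down_arrows :: "face \<Rightarrow> (face \<times> face) set" where
  "down_arrows (a, b, c) =
     {((a+1, b, c+1), (a+1, b+1, c)), ((a+1, b+1, c), (a, b+1, c+1)), ((a, b+1, c+1), (a+1, b, c+1))}"

text \<open>The conditions \<open>a + b + c = n - 1\<close> and \<open>a + b + c = n - 2\<close> are written without truncated
  subtraction.\<close>

definition num_half_arrows :: "nat \<Rightarrow> face \<Rightarrow> face \<Rightarrow> nat" where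
  "num_half_arrows n \<alpha> \<beta> =
     card {(a, b, c). a + b + c + 1 = n \<and> (\<alpha>, \<beta>) \<in> up_arrows (a, b, c)} +
     card {(a, b, c). a + b + c + 2 = n \<and> (\<alpha>, \<beta>) \<in> down_arrows (a, b, c)}"

definition face_form :: "nat \<Rightarrow> face \<Rightarrow> face \<Rightarrow> real" where
  "face_form n \<alpha> \<beta> = (real (num_half_arrows n \<alpha> \<beta>) - real (num_half_arrows n \<beta> \<alpha>)) / 2"


section \<open>The dual network\<close>

datatype node =
    White nat nat nat
  | Black nat nat nat
  | Source nat
  | LeftSink nat
  | BottomSink nat

text \<open>\<open>network_edge n u v r l\<close>: there is an edge \<open>u \<rightarrow> v\<close>, and the lattice segment it crosses joins the
  face \<open>r\<close> on its right-hand side to the face \<open>l\<close> on its left-hand side. The lattice is drawn with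
  \<open>(n,0,0)\<close> bottom left, \<open>(0,n,0)\<close> bottom right and \<open>(0,0,n)\<close> top; a white (black) vertex is the
  center of the triangle of \<open>up_arrows\<close> (\<open>down_arrows\<close>) with the same index.\<close>

inductive network_edge :: "nat \<Rightarrow> node \<Rightarrow> node \<Rightarrow> face \<Rightarrow> face \<Rightarrow> bool" for n :: nat where
  white_black_b: "\<lbrakk>a + b + c + 1 = n; 1 \<le> b\<rbrakk> \<Longrightarrow>
     network_edge n (White a b c) (Black a (b - 1) c) (a, b, c+1) (a+1, b, c)"
| white_black_c: "\<lbrakk>a + b + c + 1 = n; 1 \<le> c\<rbrakk> \<Longrightarrow>
     network_edge n (White a b c) (Black a b (c - 1)) (a+1, b, c) (a, b+1, c)"
| black_white: "a + b + c + 2 = n \<Longrightarrow>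
     network_edge n (Black a b c) (White (a+1) b c) (a+1, b, c+1) (a+1, b+1, c)"
| source: "\<lbrakk>1 \<le> k; k \<le> n\<rbrakk> \<Longrightarrow>
     network_edge n (Source k) (White 0 (k - 1) (n - k)) (0, k - 1, n - k + 1) (0, k, n - k)"
| left_sink: "\<lbrakk>1 \<le> k; k \<le> n\<rbrakk> \<Longrightarrow>
     network_edge n (White (k - 1) 0 (n - k)) (LeftSink k) (k - 1, 0, n - k + 1) (k, 0, n - k)"
| bottom_sink: "\<lbrakk>1 \<le> k; k \<le> n\<rbrakk> \<Longrightarrow>
     network_edge n (White (n - k) (k - 1) 0) (BottomSink k) (n - k + 1, k - 1, 0) (n - k, k, 0)"

definition directed_paths :: "nat \<Rightarrow> node \<Rightarrow> node \<Rightarrow> node list set" where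
  "directed_paths n s t =
     {p. p \<noteq> [] \<and> hd p = s \<and> last p = t \<and> successively (\<lambda>u v. \<exists>r l. network_edge n u v r l) p}"

definition path_edges :: "node list \<Rightarrow> (node \<times> node) set" where
  "path_edges p = set (zip p (tl p))"

text \<open>The faces to the right of a path: those adjacent to the right-hand side of one of its edges, and
  those which can be reached from these without crossing the path. A path from a source to a sink cuts
  the triangle into two parts. For left sinks the right part lies above the path; for
  bottom sinks it is the part containing \<open>(n,0,0)\<close> and \<open>(0,0,n)\<close>.\<close>

inductive_set right_faces :: "nat \<Rightarrow> node list \<Rightarrow> face set" for n :: nat and p :: "node list" where
  adjacent: "\<lbrakk>(u, v) \<in> path_edges p; network_edge n u v \<alpha> \<beta>\<rbrakk> \<Longrightarrow> \<alpha> \<in> right_faces n p"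
| cross: "\<lbrakk>\<alpha> \<in> right_faces n p; (u, v) \<notin> path_edges p;
     network_edge n u v \<alpha> \<beta> \<or> network_edge n u v \<beta> \<alpha>\<rbrakk> \<Longrightarrow> \<beta> \<in> right_faces n p"

definition path_weight :: "nat \<Rightarrow> (face \<Rightarrow> real) \<Rightarrow> node list \<Rightarrow> real" where
  "path_weight n Z p = (\<Prod>\<alpha>\<in>right_faces n p. Z \<alpha>)"

definition M1 :: "nat \<Rightarrow> (face \<Rightarrow> real) \<Rightarrow> real mat" where
  "M1 n Z = mat_from_1 n
     (\<lambda>k l. \<Sum>p\<in>directed_paths n (Source l) (LeftSink k). path_weight n Z p)"

definition M2 :: "nat \<Rightarrow> (face \<Rightarrow> real) \<Rightarrow> real mat" where
  "M2 n Z = mat_from_1 n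
     (\<lambda>k l. \<Sum>p\<in>directed_paths n (Source l) (BottomSink k). path_weight n Z p)"

definition A_matrix :: "nat \<Rightarrow> (face \<Rightarrow> real) \<Rightarrow> real mat" where
  "A_matrix n Z = (let G = (M1 n Z)\<^sup>T * M2 n Z in
     mat_from_1 n (\<lambda>k l. if k \<le> l then entry G k l / sqrt (entry G k k * entry G l l) else 0))"


section \<open>The \<open>\<A>\<^sub>n\<close>-quiver\<close>

datatype vertex = Inner nat nat nat | Merged nat

definition vertices :: "nat \<Rightarrow> vertex set" where
  "vertices n = {Inner a b c | a b c. a + b + c = n \<and> 1 \<le> a \<and> 1 \<le> b \<and> 1 \<le> c}
     \<union> {Merged k | k. 1 \<le> k \<and> k \<le> n - 1}"

fun constituents :: "nat \<Rightarrow> vertex \<Rightarrow> face set" where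
  "constituents n (Inner a b c) = {(a, b, c)}"
| "constituents n (Merged k) = {(k, 0, n - k), (n - k, k, 0)}"

text \<open>A quiver without loops and 2-cycles is encoded by the signed number \<open>Q u v\<close> of arrows from
  \<open>u\<close> to \<open>v\<close>. It is real-valued because half-arrows are summed; at the vertices below the sums are
  integers.\<close>

definition A_quiver :: "nat \<Rightarrow> vertex \<Rightarrow> vertex \<Rightarrow> real" where
  "A_quiver n u v = (if u \<in> vertices n \<and> v \<in> vertices n
     then \<Sum>\<alpha>\<in>constituents n u. \<Sum>\<beta>\<in>constituents n v. face_form n \<alpha> \<beta> else 0)"

text \<open>The entries of \<open>A_matrix n Z\<close> depend only on the variables \<open>x\<close> which \<open>Z\<close> induces on the
  \<open>\<A>\<^sub>n\<close>-quiver. A matrix \<open>\<A>(x)\<close> is therefore written as \<open>A_matrix n Z\<close> for an arbitrary positive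
  \<open>Z\<close> that induces \<open>x\<close>.\<close>

definition induces :: "nat \<Rightarrow> (face \<Rightarrow> real) \<Rightarrow> (vertex \<Rightarrow> real) \<Rightarrow> bool" where
  "induces n Z x \<longleftrightarrow> (\<forall>\<alpha>\<in>faces n. 0 < Z \<alpha>) \<and>
     (\<forall>v\<in>vertices n. x v = (\<Prod>\<alpha>\<in>constituents n v. Z \<alpha>))"

lemma induces_exists:
  assumes "\<forall>v\<in>vertices n. 0 < x v"
  shows "\<exists>Z. induces n Z x"
proof -
  define Z :: "face \<Rightarrow> real" where
    "Z = (\<lambda>(a, b, c). if 1 \<le> a \<and> 1 \<le> b \<and> 1 \<le> c then x (Inner a b c)
       else if b = 0 \<and> 1 \<le> a \<and> 1 \<le> c then x (Merged a) else 1)"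
  have "0 < Z \<alpha>" if "\<alpha> \<in> faces n" for \<alpha>
    using that assms by (auto simp: faces_def Z_def vertices_def split: prod.splits)
  moreover have "x v = (\<Prod>\<alpha>\<in>constituents n v. Z \<alpha>)" if "v \<in> vertices n" for v
    using that by (auto simp: vertices_def Z_def)
  ultimately show ?thesis
    unfolding induces_def by blast
qed


section \<open>Mutations\<close>

definition mutate_variables ::
  "'v \<Rightarrow> ('v \<Rightarrow> 'v \<Rightarrow> real) \<Rightarrow> ('v \<Rightarrow> real) \<Rightarrow> 'v \<Rightarrow> real" where
  "mutate_variables z Q x v =
     (if v = z then inverse (x z)
      else if 0 < Q z v then x v * (1 + x z) powr Q z v
      else if 0 < Q v z then x v * inverse (1 + inverse (x z)) powr Q v z
      else x v)"

text \<open>Reverse the arrows at \<open>z\<close>, add an arrow \<open>u \<rightarrow> v\<close> for each pair of arrows \<open>u \<rightarrow> z \<rightarrow> v\<close>, and cancel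
  2-cycles.\<close>

definition mutate_quiver :: "'v \<Rightarrow> ('v \<Rightarrow> 'v \<Rightarrow> real) \<Rightarrow> 'v \<Rightarrow> 'v \<Rightarrow> real" where
  "mutate_quiver z Q u v =
     (if u = z \<or> v = z then - Q u v
      else Q u v + max 0 (Q u z) * max 0 (Q z v) - max 0 (Q v z) * max 0 (Q z u))"

fun mutate ::
  "'v \<Rightarrow> ('v \<Rightarrow> 'v \<Rightarrow> real) \<times> ('v \<Rightarrow> real) \<Rightarrow> ('v \<Rightarrow> 'v \<Rightarrow> real) \<times> ('v \<Rightarrow> real)" where
  "mutate z (Q, x) = (mutate_quiver z Q, mutate_variables z Q x)"


section \<open>The braid-group transformation\<close>

text \<open>The index \<open>t\<close> runs over \<open>1, \<dots>, n - 1\<close>; the last case is \<open>t = n - i + s\<close> with \<open>1 \<le> s \<le> i - 1\<close>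
  and yields \<open>(i - s, s, n - i)\<close>.\<close>

definition line_vertex :: "nat \<Rightarrow> nat \<Rightarrow> nat \<Rightarrow> vertex" where
  "line_vertex n i t =
     (if t < n - i then Inner t i (n - i - t)
      else if t = n - i then Merged i
      else Inner (n - t) (t - (n - i)) (n - i))"

definition line_sequence :: "nat \<Rightarrow> nat \<Rightarrow> vertex list" where
  "line_sequence n i = map (line_vertex n i) (rev [1..<n - 1] @ [2..<n - 1])"

definition swap_variables :: "'v \<Rightarrow> 'v \<Rightarrow> ('v \<Rightarrow> real) \<Rightarrow> 'v \<Rightarrow> real" where
  "swap_variables u v x = x(u := x v, v := x u)"

definition line_transformation :: "nat \<Rightarrow> nat \<Rightarrow> (vertex \<Rightarrow> real) \<Rightarrow> vertex \<Rightarrow> real" where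
  "line_transformation n i x =
     swap_variables (line_vertex n i 1) (line_vertex n i (n - 1))
       (snd (fold mutate (line_sequence n i) (A_quiver n, x)))"

text \<open>For the orientation conventions fixed above, \<open>x' = line_transformation n i x\<close> satisfies
  \<open>\<A>(x) = B \<A>(x') B\<^sup>T\<close> with the matrix \<open>B\<close> below. So the braid-group transformation
  \<open>\<A> \<mapsto> B \<A> B\<^sup>T\<close> takes \<open>\<A>(x')\<close> to \<open>\<A>(x)\<close>, and \<open>line_transformation n i\<close> induces its inverse. The
  equation \<open>\<A>(x') = B \<A>(x) B\<^sup>T\<close> fails already for \<open>n = 3\<close>, \<open>i = 1\<close>: there \<open>\<A>(x')\<^sub>1\<^sub>3 = \<A>(x)\<^sub>2\<^sub>3\<close>.\<close>

definition braid_matrix :: "nat \<Rightarrow> nat \<Rightarrow> real mat \<Rightarrow> real mat" where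
  "braid_matrix n i A = mat_from_1 n (\<lambda>k l.
     if k = i \<and> l = i then entry A i (i + 1)
     else if k = i \<and> l = i + 1 then - 1
     else if k = i + 1 \<and> l = i then 1
     else if k = i + 1 \<and> l = i + 1 then 0
     else if k = l then 1 else 0)"

end

theory Submission
  imports Defs
begin

text \<open>Both sides of the claim are compared on the network. A path enters the triangle at the right
  side and moves one column (\<open>a\<close> constant) at a time, keeping or decreasing the coordinate \<open>b\<close>; the
  faces on its right are, in every column, those above the point where it crosses. So a path sum obeys
  a Pascal-like recursion \<open>transfer\<close> whose coefficients are the column products of \<open>Z\<close>, and the
  matrix \<open>G\<close> is a Gram matrix \<open>gram\<close> of two families of solutions.

  The \<open>i\<close>-th line is a closed zigzag which meets every column in at most two faces, once in its part
  \<open>b = i\<close> and once in its part \<open>c = n - i\<close>. Put \<open>p\<^sub>t = y\<^sub>1 \<cdots> y\<^bsub>t-1\<^esub>\<close> and \<open>S\<^sub>t = p\<^sub>1 + \<dots> + p\<^sub>t\<close>. If the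
  column products are multiplied by suitable quotients of the \<open>S\<^sub>t\<close> (\<open>line_ratio\<close>), then the new
  solutions of the recursion differ from the old ones, in each column, only in the two positions
  at the line, where a multiple of the neighbouring solution is added (\<open>column_change\<close>). At the
  sources the two positions coincide and the corrections combine to the braid block in rows \<open>i\<close>,
  \<open>i + 1\<close> (\<open>source_change\<close>). At the sinks one correction sits on the left side and the other one on
  the bottom side; they cancel in \<open>G = M\<^sub>1\<^sup>T M\<^sub>2\<close> since the variables of the two sides are merged
  (\<open>gram_change\<close>). The scalars in the braid block need not be identified with entries of
  \<open>\<A>\<close>: triangularity of both Gram matrices forces them (\<open>normalized_braid\<close>).

  It remains to see that the mutations produce exactly these quotients. Restricted to the line and one
  further vertex, the quiver is a linear chain with one extra vertex, and the \<open>2n - 5\<close>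
  mutations can be followed explicitly (\<open>chain_mutation\<close>); the values which occur are built from
  \<open>S\<^sub>t\<close> and from the sums of the complementary tails. A vertex \<open>v\<close> off the line
  is multiplied by a product of quotients \<open>S\<^bsub>t+1\<^esub> / S\<^sub>t\<close>, one for each triangle which \<open>v\<close> spans with
  the edge between \<open>y\<^sub>t\<close> and \<open>y\<^bsub>t+1\<^esub>\<close> (\<open>chain_mutation_neighbour\<close>, \<open>A_quiver_off_line\<close>).
  This is the same product that \<open>line_ratio\<close> assigns to the faces (\<open>induces_line_change\<close>).
  The face variables used for this comparison are one choice among many, but \<open>\<A>\<close> depends on
  the quiver variables alone (\<open>A_matrix_cong_induces\<close>).\<close>

section \<open>Matrices indexed from 1 and their normalization\<close>

lemma mat_from_1_mult:
  "mat_from_1 n f * mat_from_1 n g = mat_from_1 n (\<lambda>k l. \<Sum>m=1..n. f k m * g m l)"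
proof (rule eq_matI)
  fix k l
  assume kl: "k < dim_row (mat_from_1 n (\<lambda>k l. \<Sum>m=1..n. f k m * g m l))"
     "l < dim_col (mat_from_1 n (\<lambda>k l. \<Sum>m=1..n. f k m * g m l))"
  have "(\<Sum>m = 0..<n. f (Suc k) (Suc m) * g (Suc m) (Suc l)) = (\<Sum>m=1..n. f (Suc k) m * g m (Suc l))"
    by (rule sum.reindex_bij_witness[of _ "\<lambda>m. m - 1" Suc]) auto
  then show "(mat_from_1 n f * mat_from_1 n g) $$ (k, l)
     = mat_from_1 n (\<lambda>k l. \<Sum>m=1..n. f k m * g m l) $$ (k, l)"
    using kl by (simp add: mat_from_1_def scalar_prod_def)
qed (auto simp: mat_from_1_def)

lemma mat_from_1_transpose: "(mat_from_1 n f)\<^sup>T = mat_from_1 n (\<lambda>k l. f l k)"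
  by (auto simp: mat_from_1_def)

lemma mat_from_1_cong:
  "(\<And>k l. 1 \<le> k \<Longrightarrow> k \<le> n \<Longrightarrow> 1 \<le> l \<Longrightarrow> l \<le> n \<Longrightarrow> f k l = g k l) \<Longrightarrow> mat_from_1 n f = mat_from_1 n g"
  by (auto simp: mat_from_1_def)

lemma entry_mat_from_1: "1 \<le> k \<Longrightarrow> k \<le> n \<Longrightarrow> 1 \<le> l \<Longrightarrow> l \<le> n \<Longrightarrow> entry (mat_from_1 n f) k l = f k l"
  by (auto simp: mat_from_1_def entry_def)

definition normalized :: "(nat \<Rightarrow> nat \<Rightarrow> real) \<Rightarrow> nat \<Rightarrow> nat \<Rightarrow> real" where
  "normalized g k l = (if k \<le> l then g k l / sqrt (g k k * g l l) else 0)"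

text \<open>The two properties of \<open>G = M\<^sub>1\<^sup>T M\<^sub>2\<close> on which the normalization relies.\<close>

definition pos_triangular :: "nat \<Rightarrow> (nat \<Rightarrow> nat \<Rightarrow> real) \<Rightarrow> bool" where
  "pos_triangular n g \<longleftrightarrow> (\<forall>k\<in>{1..n}. 0 < g k k \<and> (\<forall>l\<in>{1..n}. l < k \<longrightarrow> g k l = 0))"

text \<open>If \<open>g' = C g C\<^sup>T\<close>, where \<open>C\<close> (given by its action \<open>mix\<close> on vectors) is the identity apart from
  the rows \<open>i\<close> and \<open>i + 1\<close>, then the vanishing of \<open>g'\<close> at \<open>(i + 1, i)\<close> forces
  \<open>\<mu> g\<^bsub>i+1,i+1\<^esub> = \<nu> g\<^bsub>i,i+1\<^esub>\<close>. Hence after normalization only the entry \<open>a\<^bsub>i,i+1\<^esub>\<close> is left of the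
  scalars \<open>\<kappa>\<close>, \<open>\<mu>\<close>, \<open>\<nu>\<close>, and \<open>C\<close> becomes the inverse of the braid matrix (the function \<open>unmix\<close> of
  the proof is the action of the braid matrix).\<close>

lemma normalized_braid:
  assumes i: "1 \<le> i" "i < n"
    and g: "pos_triangular n g" and g': "pos_triangular n g'"
    and pos: "0 < \<kappa>" "0 < \<nu>"
    and mix: "\<And>k f. mix k f = (if k = i then \<kappa> * f (i + 1)
       else if k = i + 1 then \<mu> * f (i + 1) - \<nu> * f i else f k :: real)"
    and change: "\<And>k l. 1 \<le> k \<Longrightarrow> k \<le> n \<Longrightarrow> 1 \<le> l \<Longrightarrow> l \<le> n \<Longrightarrow> g' k l = mix k (\<lambda>k'. mix l (g k'))"
  shows "mat_from_1 n (normalized g) = braid_matrix n i (mat_from_1 n (normalized g))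
     * mat_from_1 n (normalized g') * (braid_matrix n i (mat_from_1 n (normalized g)))\<^sup>T"
proof -
  define d where "d k = sqrt (g k k)" for k
  define d' where "d' k = sqrt (g' k k)" for k
  define a where "a = normalized g i (i + 1)"
  \<comment> \<open>the action of the braid matrix on vectors\<close>
  define unmix where "unmix k f = (if k = i then a * f i - f (i + 1) else if k = i + 1 then f i else f k :: real)"
    for k and f :: "nat \<Rightarrow> real"
  have low: "g k l = 0" "g' k l = 0" if "1 \<le> l" "l < k" "k \<le> n" for k l
    using g g' that by (auto simp: pos_triangular_def)
  have dpos: "0 < g k k" "0 < d k" if "1 \<le> k" "k \<le> n" for k
    using g that by (auto simp: pos_triangular_def d_def)
  have dd: "d k * d k = g k k" if "1 \<le> k" "k \<le> n" for k
    using dpos(1)[OF that] by (simp add: d_def)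
  have N: "normalized g k l = g k l / (d k * d l)" if "1 \<le> k" "k \<le> n" "1 \<le> l" "l \<le> n" for k l
    using low[of l k] that by (auto simp: normalized_def d_def real_sqrt_mult)
  have N': "normalized g' k l = g' k l / (d' k * d' l)" if "1 \<le> k" "k \<le> n" "1 \<le> l" "l \<le> n" for k l
    using low[of l k] that by (auto simp: normalized_def d'_def real_sqrt_mult)
  \<comment> \<open>the entry of \<open>g'\<close> at \<open>(i + 1, i)\<close> vanishes\<close>
  have \<mu>: "\<mu> * g (i + 1) (i + 1) = \<nu> * g i (i + 1)"
    using change[of "i + 1" i] low(2)[of i "i + 1"] i pos by (simp add: mix)
  have d'i: "d' i = \<kappa> * d (i + 1)"
    using change[of i i] i pos by (simp add: mix d'_def d_def real_sqrt_mult)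
  have "g' (i + 1) (i + 1) = \<nu>\<^sup>2 * g i i + \<mu> * (\<mu> * g (i + 1) (i + 1) - \<nu> * g i (i + 1))"
    using change[of "i + 1" "i + 1"] i low(1)[of i "i + 1"]
    by (simp add: mix algebra_simps power2_eq_square)
  then have d'i1: "d' (i + 1) = \<nu> * d i"
    using \<mu> pos by (simp add: d'_def d_def real_sqrt_mult)
  have d'k: "d' k = d k" if "1 \<le> k" "k \<le> n" "k \<noteq> i" "k \<noteq> i + 1" for k
    using change[of k k] that by (simp add: mix d'_def d_def)
  have a: "a * \<nu> * d i = \<mu> * d (i + 1)"
  proof -
    have "a * d i * d (i + 1) = g i (i + 1)"
      using N[of i "i + 1"] dpos[of i] dpos[of "i + 1"] i by (simp add: a_def)
    then have "a * \<nu> * d i * d (i + 1) = \<mu> * d (i + 1) * d (i + 1)"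
      using \<mu> dd[of "i + 1"] i by (simp add: algebra_simps)
    then show ?thesis
      using dpos(2)[of "i + 1"] i by simp
  qed
  have mix_divide: "mix k (\<lambda>m. f m / c) = mix k f / c" for k f c
    by (simp add: mix diff_divide_distrib)
  have unmix_cong: "unmix k f = unmix k f'"
    if "1 \<le> k" "k \<le> n" "\<And>m. 1 \<le> m \<Longrightarrow> m \<le> n \<Longrightarrow> f m = f' m" for k f f'
    using that i by (simp add: unmix_def)
  have unmix_divide: "unmix k (\<lambda>m. f m / c) = unmix k f / c" for k f c
    by (simp add: unmix_def diff_divide_distrib)
  have unmix: "unmix k (\<lambda>m. mix m f / d' m) = f k / d k" if "1 \<le> k" "k \<le> n" for k f
  proof -
    have pd: "0 < d i" "0 < d (i + 1)" using dpos i by auto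
    have "a * f (i + 1) / d (i + 1) = \<mu> * f (i + 1) / (\<nu> * d i)"
      using a pd pos by (simp add: field_simps)
    then show ?thesis
      using pos pd d'k[OF that] by (auto simp: unmix_def mix d'i d'i1[simplified] field_simps)
  qed
  have braid: "braid_matrix n i (mat_from_1 n (normalized g)) = mat_from_1 n (\<lambda>k l. unmix k (\<lambda>m. of_bool (m = l)))"
    unfolding braid_matrix_def
    by (rule mat_from_1_cong) (use i in \<open>auto simp: unmix_def a_def entry_mat_from_1\<close>)
  have act: "(\<Sum>m=1..n. unmix k (\<lambda>m'. of_bool (m' = m)) * f m) = unmix k f" if "1 \<le> k" "k \<le> n" for k f
  proof -
    have "(\<Sum>m=1..n. unmix k (\<lambda>m'. of_bool (m' = m)) * f m)
      = unmix k (\<lambda>m'. \<Sum>m=1..n. of_bool (m' = m) * f m)"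
      by (auto simp: unmix_def sum_distrib_left sum_subtractf algebra_simps simp del: sum_of_bool_mult_eq sum_mult_of_bool_eq)
    also have "\<dots> = unmix k f"
    proof -
      have "(\<Sum>m=1..n. of_bool (m' = m) * f m) = f m'" if "1 \<le> m'" "m' \<le> n" for m'
        using that by (simp add: of_bool_def if_distrib[of "\<lambda>x. x * _"] cong: if_cong)
      then show ?thesis using that i by (auto simp: unmix_def)
    qed
    finally show ?thesis .
  qed
  have "normalized g k l = (\<Sum>m=1..n. (\<Sum>m'=1..n. unmix k (\<lambda>j. of_bool (j = m')) * normalized g' m' m)
      * unmix l (\<lambda>j. of_bool (j = m)))" if kl: "1 \<le> k" "k \<le> n" "1 \<le> l" "l \<le> n" for k l
  proof -
    have "(\<Sum>m=1..n. (\<Sum>m'=1..n. unmix k (\<lambda>j. of_bool (j = m')) * normalized g' m' m)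
      * unmix l (\<lambda>j. of_bool (j = m)))
      = (\<Sum>m=1..n. unmix l (\<lambda>j. of_bool (j = m)) * unmix k (\<lambda>m'. normalized g' m' m))"
      by (intro sum.cong refl, subst act[OF kl(1,2)]) (rule mult.commute)
    also have "\<dots> = unmix l (\<lambda>m. unmix k (\<lambda>m'. normalized g' m' m))"
      by (rule act[OF kl(3,4)])
    also have "\<dots> = unmix l (\<lambda>m. unmix k (\<lambda>m'. mix m' (\<lambda>k'. mix m (g k')) / d' m' / d' m))"
      by (intro unmix_cong kl) (simp add: N' change)
    also have "\<dots> = unmix l (\<lambda>m. unmix k (\<lambda>m'. mix m' (\<lambda>k'. mix m (g k')) / d' m') / d' m)"
      by (simp only: unmix_divide)
    also have "\<dots> = unmix l (\<lambda>m. mix m (\<lambda>l'. g k l' / d k) / d' m)"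
      by (simp only: unmix[OF kl(1,2)] mix_divide)
    also have "\<dots> = normalized g k l"
      by (simp add: unmix[OF kl(3,4)] N[OF kl])
    finally show ?thesis by simp
  qed
  then show ?thesis
    unfolding braid mat_from_1_transpose mat_from_1_mult by (intro mat_from_1_cong) auto
qed

text \<open>Rescaling by positive diagonal matrices is what changes of the boundary variables do to \<open>G\<close>.\<close>

lemma normalized_scale:
  assumes "\<And>k. 1 \<le> k \<Longrightarrow> k \<le> n \<Longrightarrow> 0 < s k"
    and "\<And>k l. 1 \<le> k \<Longrightarrow> k \<le> n \<Longrightarrow> 1 \<le> l \<Longrightarrow> l \<le> n \<Longrightarrow> g' k l = c * s k * s l * g k l" and "0 < c"
  shows "mat_from_1 n (normalized g') = mat_from_1 n (normalized g)"
proof (rule mat_from_1_cong)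
  fix k l assume kl: "1 \<le> k" "k \<le> n" "1 \<le> l" "l \<le> n"
  have "sqrt (g' k k * g' l l) = sqrt ((c * s k * s l)\<^sup>2 * (g k k * g l l))"
    using assms(2) kl by (intro arg_cong[of _ _ sqrt]) (simp add: power2_eq_square)
  also have "\<dots> = c * s k * s l * sqrt (g k k * g l l)"
    using assms(1)[of k] assms(1)[of l] kl assms(3) unfolding real_sqrt_mult by simp
  finally show "normalized g' k l = normalized g k l"
    using assms(1)[of k] assms(1)[of l] kl assms(3) assms(2)[of k l] by (simp add: normalized_def)
qed

section \<open>The transfer recursion along the columns of the triangle\<close>

text \<open>\<open>transfer n q L B a j\<close> is the weighted number of paths which enter column \<open>a\<close> in position \<open>j\<close>, that
  is, at the white vertex with \<open>b = j - 1\<close>. From there a path reaches position \<open>j - 1\<close> or \<open>j\<close> of the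
  next column. Position \<open>0\<close> stands for the exit to the left sink \<open>a\<close>, and the position beyond
  the last one, \<open>j = n + 1 - a\<close>, for the exit to the bottom sink \<open>j\<close>; \<open>L\<close> and \<open>B\<close> are the
  values assigned to the sinks. Treating the exits as positions makes the recursion uniform.\<close>

function transfer :: "nat \<Rightarrow> (nat \<Rightarrow> nat \<Rightarrow> real) \<Rightarrow> (nat \<Rightarrow> real) \<Rightarrow> (nat \<Rightarrow> real) \<Rightarrow> nat \<Rightarrow> nat \<Rightarrow> real"
where
  "transfer n q L B a j =
     (if j = 0 then L a else if n < a + j then B j
      else q a j * (transfer n q L B (a + 1) (j - 1) + transfer n q L B (a + 1) j))"
  by auto
termination
  by (relation "Wellfounded.measure (\<lambda>(n, q, L, B, a, j). n + 1 - a)") auto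

declare transfer.simps [simp del]

lemma transfer_left [simp]: "transfer n q L B a 0 = L a"
  by (simp add: transfer.simps)

lemma transfer_bottom: "n < a + j \<Longrightarrow> 0 < j \<Longrightarrow> transfer n q L B a j = B j"
  by (simp add: transfer.simps)

lemma transfer_step:
  "a + j < n \<Longrightarrow> transfer n q L B a (Suc j) =
     q a (Suc j) * (transfer n q L B (Suc a) j + transfer n q L B (Suc a) (Suc j))"
  by (subst transfer.simps) auto

lemma transfer_linear:
  "transfer n q (\<lambda>k. L k + c * L' k) (\<lambda>k. B k + c * B' k) a j
     = transfer n q L B a j + c * transfer n q L' B' a j"
proof (induction n q L B a j rule: transfer.induct)
  case (1 n q L B a j)
  then show ?case
    by (subst (1 2 3) transfer.simps) (auto simp: algebra_simps)
qed

lemma transfer_scale: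
  "transfer n q (\<lambda>k. c * L k) (\<lambda>k. c * B k) a j = c * transfer n q L B a j"
proof (induction n q L B a j rule: transfer.induct)
  case (1 n q L B a j)
  then show ?case
    by (subst (1 2) transfer.simps) (auto simp: algebra_simps)
qed

abbreviation to_left where
  "to_left n q k \<equiv> transfer n q (\<lambda>m. of_bool (m = k)) (\<lambda>m. 0)"

abbreviation to_bottom where
  "to_bottom n q k \<equiv> transfer n q (\<lambda>m. 0) (\<lambda>m. of_bool (m = k))"

text \<open>A path needs at least \<open>j\<close> steps to reach the left side, and exactly one path needs no more.\<close>

lemma to_left_triangular:
  "(k < a + j \<longrightarrow> to_left n q k a j = 0) \<and>
   ((\<forall>b m. b + m \<le> n \<longrightarrow> 0 < q b m) \<longrightarrow> k = a + j \<longrightarrow> k \<le> n \<longrightarrow> 0 < to_left n q k a j)"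
proof (induction n q "\<lambda>m. of_bool (m = k) :: real" "\<lambda>m::nat. 0::real" a j rule: transfer.induct)
  case (1 n q a j)
  then show ?case
    by (subst (1 2) transfer.simps) auto
qed

text \<open>The position never increases along a path, and exactly one path keeps it.\<close>

lemma to_bottom_triangular:
  "(j < k \<longrightarrow> to_bottom n q k a j = 0) \<and>
   ((\<forall>b m. b + m \<le> n \<longrightarrow> 0 < q b m) \<longrightarrow> k = j \<longrightarrow> 0 < j \<longrightarrow> 0 < to_bottom n q k a j)"
proof (induction n q "\<lambda>m::nat. 0::real" "\<lambda>m. of_bool (m = k) :: real" a j rule: transfer.induct)
  case (1 n q a j)
  then show ?case
    by (subst (1 2) transfer.simps) auto
qed

text \<open>Multiplying a whole column by \<open>h a\<close> multiplies every path that passes this column, so the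
  factor depends only on the column where the path leaves the triangle.\<close>

lemma transfer_gauge:
  assumes "\<And>a j. a < n \<Longrightarrow> 0 < a \<Longrightarrow> 0 < j \<Longrightarrow> a + j \<le> n \<Longrightarrow> q' a j = h a * q a j"
    and "0 < a" "a + j \<le> n + 1"
  shows "transfer n q' (\<lambda>k. (\<Prod>b=k..<n. h b) * L k) (\<lambda>k. (\<Prod>b=n+1-k..<n. h b) * B k) a j
     = (\<Prod>b=a..<n. h b) * transfer n q L B a j"
  using assms
proof (induction n q L B a j rule: transfer.induct)
  case (1 n q L B a j)
  show ?case
  proof (cases "j = 0 \<or> n < a + j")
    case True
    then have "j = 0 \<or> n + 1 - j = a \<and> 0 < j \<and> n < a + j"
      using 1 by auto
    then show ?thesis
      by (auto simp: transfer_bottom)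
  next
    case False
    then have *: "(\<Prod>b=a..<n. h b) = h a * (\<Prod>b=a+1..<n. h b)"
      by (simp add: prod.atLeast_Suc_lessThan)
    have "q' a j = h a * q a j"
      using False 1(3,4) by auto
    then show ?thesis
      using False 1 * by (subst (1 2) transfer.simps) (auto simp: algebra_simps)
  qed
qed

text \<open>The entries of \<open>M\<^sub>1\<^sup>T M\<^sub>2\<close>; \<open>R j\<close> collects the faces in the columns behind the bottom sink \<open>j\<close>, all
  of which lie to the right of a path to this sink.\<close>

definition gram :: "nat \<Rightarrow> (nat \<Rightarrow> nat \<Rightarrow> real) \<Rightarrow> (nat \<Rightarrow> real) \<Rightarrow> nat \<Rightarrow> nat \<Rightarrow> real" where
  "gram n q R k l = (\<Sum>j=1..n. to_left n q j 0 k * (R j * to_bottom n q j 0 l))"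

section \<open>Directed paths of the network\<close>

text \<open>Every edge increases \<open>depth\<close> by one and every source has depth \<open>0\<close>. So the vertices of a path
  are determined by their depth, and a path has at most one white vertex in each column.\<close>

fun depth :: "nat \<Rightarrow> node \<Rightarrow> nat" where
  "depth n (Source k) = 0"
| "depth n (White a b c) = 2 * a + 1"
| "depth n (Black a b c) = 2 * a + 2"
| "depth n (LeftSink k) = 2 * k"
| "depth n (BottomSink k) = 2 * (n - k) + 2"

fun is_sink :: "node \<Rightarrow> bool" where
  "is_sink (LeftSink k) = True"
| "is_sink (BottomSink k) = True"
| "is_sink _ = False"

definition arc :: "nat \<Rightarrow> node \<Rightarrow> node \<Rightarrow> bool" where
  "arc n u v \<longleftrightarrow> (\<exists>r l. network_edge n u v r l)"

lemma depth_arc: "arc n u v \<Longrightarrow> depth n v = Suc (depth n u)"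
  unfolding arc_def by (auto elim!: network_edge.cases)

lemma arc_White:
  "arc n (White a b c) v \<longleftrightarrow> a + b + c + 1 = n \<and>
     (v = (if 1 \<le> b then Black a (b - 1) c else LeftSink (a + 1)) \<or>
      v = (if 1 \<le> c then Black a b (c - 1) else BottomSink (n - a)))"
proof
  assume "arc n (White a b c) v"
  then show "a + b + c + 1 = n \<and>
     (v = (if 1 \<le> b then Black a (b - 1) c else LeftSink (a + 1)) \<or>
      v = (if 1 \<le> c then Black a b (c - 1) else BottomSink (n - a)))"
    unfolding arc_def by (auto elim!: network_edge.cases)
next
  assume "a + b + c + 1 = n \<and>
     (v = (if 1 \<le> b then Black a (b - 1) c else LeftSink (a + 1)) \<or>
      v = (if 1 \<le> c then Black a b (c - 1) else BottomSink (n - a)))"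
  then have n: "a + b + c + 1 = n"
    and v: "v = (if 1 \<le> b then Black a (b - 1) c else LeftSink (a + 1)) \<or>
      v = (if 1 \<le> c then Black a b (c - 1) else BottomSink (n - a))"
    by auto
  consider "1 \<le> b" "v = Black a (b - 1) c" | "1 \<le> c" "v = Black a b (c - 1)"
    | "b = 0" "v = LeftSink (a + 1)" | "c = 0" "v = BottomSink (n - a)"
    using v by (auto split: if_splits)
  then show "arc n (White a b c) v"
  proof cases
    case 1
    then show ?thesis using network_edge.white_black_b[OF n] unfolding arc_def by blast
  next
    case 2
    then show ?thesis using network_edge.white_black_c[OF n] unfolding arc_def by blast
  next
    case 3
    then have "a + 1 - 1 = a" "n - (a + 1) = c" "1 \<le> a + 1" "a + 1 \<le> n" using n by auto
    then show ?thesis using network_edge.left_sink[of "a + 1" n] 3 unfolding arc_def by metis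
  next
    case 4
    then have "n - (n - a) = a" "n - a - 1 = b" "1 \<le> n - a" "n - a \<le> n" using n by auto
    then show ?thesis using network_edge.bottom_sink[of "n - a" n] 4 unfolding arc_def by metis
  qed
qed

lemma arc_Black: "arc n (Black a b c) v \<longleftrightarrow> a + b + c + 2 = n \<and> v = White (a + 1) b c"
proof
  show "arc n (Black a b c) v \<Longrightarrow> a + b + c + 2 = n \<and> v = White (a + 1) b c"
    unfolding arc_def by (auto elim!: network_edge.cases)
  show "a + b + c + 2 = n \<and> v = White (a + 1) b c \<Longrightarrow> arc n (Black a b c) v"
    unfolding arc_def using network_edge.black_white by blast
qed

lemma arc_Source: "arc n (Source k) v \<longleftrightarrow> 1 \<le> k \<and> k \<le> n \<and> v = White 0 (k - 1) (n - k)"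
proof
  show "arc n (Source k) v \<Longrightarrow> 1 \<le> k \<and> k \<le> n \<and> v = White 0 (k - 1) (n - k)"
    unfolding arc_def by (auto elim!: network_edge.cases)
  show "1 \<le> k \<and> k \<le> n \<and> v = White 0 (k - 1) (n - k) \<Longrightarrow> arc n (Source k) v"
    unfolding arc_def using network_edge.source by blast
qed

lemma arc_sink: "arc n u v \<Longrightarrow> \<not> is_sink u"
  unfolding arc_def by (auto elim!: network_edge.cases)

lemma directed_paths_arc:
  "directed_paths n s t = {p. p \<noteq> [] \<and> hd p = s \<and> last p = t \<and> successively (arc n) p}"
  unfolding directed_paths_def arc_def ..

text \<open>The faces to the right of a path are distributed among its vertices: a white vertex contributes the
  faces of its column that lie above the entering edge, and a bottom sink contributes all
  columns that the path does not reach.\<close>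

fun node_faces :: "nat \<Rightarrow> node \<Rightarrow> face set" where
  "node_faces n (White a b c) = {(a', b', c'). a' + b' + c' = n \<and> a' = a \<and> b' \<le> b}"
| "node_faces n (BottomSink k) = {(a', b', c'). a' + b' + c' = n \<and> n < a' + k}"
| "node_faces n _ = {}"

lemma finite_faces: "finite (faces n)"
  by (rule finite_subset[of _ "{..n} \<times> {..n} \<times> {..n}"]) (auto simp: faces_def)

lemma node_faces_subset: "node_faces n u \<subseteq> faces n"
  by (cases u) (auto simp: faces_def)

lemma path_edges_nth:
  "(u, v) \<in> path_edges p \<longleftrightarrow> (\<exists>m. Suc m < length p \<and> p ! m = u \<and> p ! Suc m = v)"
  unfolding path_edges_def set_zip by (auto simp: nth_tl less_diff_conv)

locale network_path =
  fixes n l :: nat and t :: node and p :: "node list"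
  assumes path: "p \<in> directed_paths n (Source l) t" and sink: "is_sink t"
begin

lemma arc_nth: "Suc m < length p \<Longrightarrow> arc n (p ! m) (p ! Suc m)"
  using path by (auto simp: directed_paths_arc successively_conv_nth)

lemma ends: "p \<noteq> []" "p ! 0 = Source l" "last p = t"
  using path by (auto simp: directed_paths_arc hd_conv_nth)

lemma depth_nth: "m < length p \<Longrightarrow> depth n (p ! m) = m"
proof (induction m)
  case 0
  then show ?case by (simp add: ends)
next
  case (Suc m)
  then show ?case using depth_arc[OF arc_nth[of m]] by simp
qed

lemma depth_inj: "u \<in> set p \<Longrightarrow> v \<in> set p \<Longrightarrow> depth n u = depth n v \<Longrightarrow> u = v"
  by (metis depth_nth in_set_conv_nth)

lemma distinct_path: "distinct p"
  unfolding distinct_conv_nth by (metis depth_nth)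

lemma edge_arc: "(u, v) \<in> path_edges p \<Longrightarrow> u \<in> set p \<and> v \<in> set p \<and> arc n u v"
  unfolding path_edges_nth using arc_nth by auto

lemma path_pred:
  assumes "v \<in> set p" "v \<noteq> Source l"
  shows "\<exists>u. (u, v) \<in> path_edges p"
proof -
  obtain m where m: "m < length p" "p ! m = v" using assms by (auto simp: in_set_conv_nth)
  with assms ends obtain m' where "m = Suc m'" by (cases m) auto
  then show ?thesis using m unfolding path_edges_nth by blast
qed

lemma path_succ:
  assumes "u \<in> set p" "\<not> is_sink u"
  shows "\<exists>v. (u, v) \<in> path_edges p"
proof -
  obtain m where m: "m < length p" "p ! m = u" using assms by (auto simp: in_set_conv_nth)
  have "m \<noteq> length p - 1" using m assms ends sink by (auto simp: last_conv_nth)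
  then show ?thesis using m unfolding path_edges_nth by (intro exI[of _ "p ! Suc m"] exI[of _ m]) auto
qed

lemma sink_in_path: "u \<in> set p \<Longrightarrow> is_sink u \<Longrightarrow> u = t"
proof -
  assume u: "u \<in> set p" "is_sink u"
  obtain m where m: "m < length p" "p ! m = u" using u by (auto simp: in_set_conv_nth)
  have "\<not> Suc m < length p" using arc_sink[OF arc_nth, of m] m u by auto
  then have "m = length p - 1" using m by simp
  then show ?thesis using m ends by (auto simp: last_conv_nth)
qed

text \<open>The way in which a path continues from a white vertex, together with the edges used; the edges
  matter because \<open>right_faces\<close> spreads across every edge except those of the path.\<close>

lemma white_next:
  assumes "White a b c \<in> set p"
  shows "a + b + c + 1 = n \<and>
    (1 \<le> b \<and> (White a b c, Black a (b - 1) c) \<in> path_edges p \<and> White (a + 1) (b - 1) c \<in> set p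
   \<or> 1 \<le> c \<and> (White a b c, Black a b (c - 1)) \<in> path_edges p \<and> White (a + 1) b (c - 1) \<in> set p
   \<or> b = 0 \<and> (White a b c, LeftSink (a + 1)) \<in> path_edges p
   \<or> c = 0 \<and> (White a b c, BottomSink (n - a)) \<in> path_edges p)"
proof -
  obtain v where v: "(White a b c, v) \<in> path_edges p" using path_succ[OF assms] by auto
  then have av: "arc n (White a b c) v" "v \<in> set p" using edge_arc by auto
  have B: "White (a + 1) b' c' \<in> set p" if "v = Black a b' c'" for b' c'
  proof -
    obtain w where "(v, w) \<in> path_edges p" using path_succ[OF av(2)] \<open>v = Black a b' c'\<close> by auto
    then have "arc n v w" "w \<in> set p" using edge_arc by blast+
    then show ?thesis using \<open>v = Black a b' c'\<close> by (auto simp: arc_Black)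
  qed
  have n: "a + b + c + 1 = n" using av by (simp add: arc_White)
  consider "1 \<le> b" "v = Black a (b - 1) c" | "1 \<le> c" "v = Black a b (c - 1)"
    | "b = 0" "v = LeftSink (a + 1)" | "c = 0" "v = BottomSink (n - a)"
    using av(1) unfolding arc_White by (auto split: if_splits)
  then show ?thesis
    by cases (use n v B in simp_all)
qed

lemma white_prev:
  assumes "White (Suc a) b c \<in> set p"
  shows "(Black a b c, White (Suc a) b c) \<in> path_edges p \<and>
    (White a (b + 1) c \<in> set p
     \<or> White a b (c + 1) \<in> set p \<and> (White a b (c + 1), Black a b c) \<in> path_edges p)"
proof -
  obtain u where u: "(u, White (Suc a) b c) \<in> path_edges p" using path_pred[OF assms] by auto
  then have au: "arc n u (White (Suc a) b c)" "u \<in> set p" using edge_arc by auto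
  then have uB: "u = Black a b c"
    by (cases u) (auto simp: arc_White arc_Black arc_Source dest: arc_sink split: if_splits)
  obtain w where wu: "(w, u) \<in> path_edges p" using path_pred[OF au(2)] uB by auto
  then have aw: "arc n w (Black a b c)" "w \<in> set p" using edge_arc uB by auto
  then have "w = White a (b + 1) c \<or> w = White a b (c + 1)"
    by (cases w) (auto simp: arc_White arc_Black arc_Source dest: arc_sink split: if_splits)
  then show ?thesis using u uB aw wu by auto
qed

lemma white_first:
  assumes "White 0 b c \<in> set p"
  shows "(Source (b + 1), White 0 b c) \<in> path_edges p"
proof -
  obtain u where u: "(u, White 0 b c) \<in> path_edges p" using path_pred[OF assms] by auto
  then have au: "arc n u (White 0 b c)" "u \<in> set p" using edge_arc by auto
  then have "u = Source (b + 1)"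
    by (cases u) (auto simp: arc_White arc_Black arc_Source dest: arc_sink split: if_splits)
  then show ?thesis using u by simp
qed

lemma bottom_prev:
  assumes "BottomSink k \<in> set p"
  shows "1 \<le> k \<and> k \<le> n \<and> (White (n - k) (k - 1) 0, BottomSink k) \<in> path_edges p
    \<and> White (n - k) (k - 1) 0 \<in> set p"
proof -
  obtain u where u: "(u, BottomSink k) \<in> path_edges p" using path_pred[OF assms] by auto
  then have au: "arc n u (BottomSink k)" "u \<in> set p" using edge_arc by auto
  then have "1 \<le> k \<and> k \<le> n \<and> u = White (n - k) (k - 1) 0"
    by (cases u) (auto simp: arc_White arc_Black arc_Source dest: arc_sink split: if_splits)
  then show ?thesis using u au by simp
qed

end

context network_path begin

definition region :: "face set" where
  "region = \<Union>(node_faces n ` set p)"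

lemma white_region: "White a b0 c0 \<in> set p \<Longrightarrow> b \<le> b0 \<Longrightarrow> a + b + c = n \<Longrightarrow> (a, b, c) \<in> region"
  unfolding region_def by (rule UN_I[of "White a b0 c0"]) auto

lemma bottom_region: "BottomSink k \<in> set p \<Longrightarrow> n < a + k \<Longrightarrow> a + b + c = n \<Longrightarrow> (a, b, c) \<in> region"
  unfolding region_def by (rule UN_I[of "BottomSink k"]) auto

lemma regionE:
  assumes "(a, b, c) \<in> region"
  obtains (white) b0 c0 where "a + b + c = n" "White a b0 c0 \<in> set p" "b \<le> b0" "a + b0 + c0 + 1 = n"
  | (bottom) k where "a + b + c = n" "BottomSink k \<in> set p" "n < a + k" "1 \<le> k" "k \<le> n" "White (n - k) (k - 1) 0 \<in> set p"
     "(White (n - k) (k - 1) 0, BottomSink k) \<in> path_edges p"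
proof -
  obtain u where u: "u \<in> set p" "(a, b, c) \<in> node_faces n u"
    using assms unfolding region_def by blast
  show ?thesis
  proof (cases u)
    case (White a0 b0 c0)
    then show ?thesis using u white_next[of a0 b0 c0] by (intro that(1)) auto
  next
    case (BottomSink k)
    then show ?thesis using u bottom_prev[of k] by (intro that(2)) auto
  qed (use u in auto)
qed

lemma white_column: "White a b c \<in> set p \<Longrightarrow> White a b' c' \<in> set p \<Longrightarrow> b = b' \<and> c = c'"
  using depth_inj[of "White a b c" "White a b' c'"] by simp

lemma region_next:
  assumes "(a, b, c + 1) \<in> region"
    and "1 \<le> b \<Longrightarrow> (White a b c, Black a (b - 1) c) \<notin> path_edges p"
    and "b = 0 \<Longrightarrow> (White a 0 c, LeftSink (a + 1)) \<notin> path_edges p"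
  shows "(a + 1, b, c) \<in> region"
  using assms(1)
proof (cases rule: regionE)
  case (white b0 c0)
  have eq: "c0 = c" if "b = b0" using that white by simp
  from white_next[OF white(2)] consider
     "1 \<le> b0" "(White a b0 c0, Black a (b0 - 1) c0) \<in> path_edges p" "White (a + 1) (b0 - 1) c0 \<in> set p"
   | "White (a + 1) b0 (c0 - 1) \<in> set p"
   | "b0 = 0" "(White a b0 c0, LeftSink (a + 1)) \<in> path_edges p"
   | "(White a b0 c0, BottomSink (n - a)) \<in> path_edges p"
    by blast
  then show ?thesis
  proof cases
    case 1
    then have "b \<noteq> b0" using eq assms(2) by auto
    then show ?thesis using 1 white by (intro white_region[of "a + 1" "b0 - 1" c0]) auto
  next
    case 2
    then show ?thesis using white by (intro white_region[of "a + 1" b0 "c0 - 1"]) auto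
  next
    case 3
    then show ?thesis using eq assms(3) white by auto
  next
    case 4
    then show ?thesis using white edge_arc[OF 4] by (intro bottom_region[of "n - a"]) auto
  qed
next
  case (bottom k)
  then show ?thesis by (intro bottom_region[of k]) auto
qed

lemma region_next_down:
  assumes "(a, b + 1, c) \<in> region"
  shows "(a + 1, b, c) \<in> region"
  using assms(1)
proof (cases rule: regionE)
  case (white b0 c0)
  from white_next[OF white(2)] consider
     "White (a + 1) (b0 - 1) c0 \<in> set p" | "White (a + 1) b0 (c0 - 1) \<in> set p" | "b0 = 0"
   | "(White a b0 c0, BottomSink (n - a)) \<in> path_edges p"
    by blast
  then show ?thesis
  proof cases
    case 1
    then show ?thesis using white by (intro white_region[of "a + 1" "b0 - 1" c0]) auto
  next
    case 2
    then show ?thesis using white by (intro white_region[of "a + 1" b0 "c0 - 1"]) auto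
  next
    case 3
    then show ?thesis using white by simp
  next
    case 4
    then show ?thesis using white edge_arc[OF 4] by (intro bottom_region[of "n - a"]) auto
  qed
next
  case (bottom k)
  then show ?thesis by (intro bottom_region[of k]) auto
qed

lemma bottom_region_prev:
  assumes "BottomSink k \<in> set p" "n < a + 1 + k" "a + b + c = n" "b < n - a \<or> n < a + k"
  shows "(a, b, c) \<in> region"
proof (cases "n < a + k")
  case True
  then show ?thesis using assms by (intro bottom_region[of k]) auto
next
  case False
  then have "n - k = a" "k - 1 = n - a - 1" using assms bottom_prev[OF assms(1)] by auto
  then show ?thesis using assms bottom_prev[OF assms(1)] by (intro white_region[of a "n - a - 1" 0]) auto
qed

lemma region_prev:
  assumes "(a + 1, b, c) \<in> region"
  shows "(a, b, c + 1) \<in> region"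
  using assms(1)
proof (cases rule: regionE)
  case (white b0 c0)
  then have "White a (b0 + 1) c0 \<in> set p \<or> White a b0 (c0 + 1) \<in> set p"
    using white_prev[of a b0 c0] by auto
  then show ?thesis
    using white white_region[of a "b0 + 1" c0 b "c + 1"] white_region[of a b0 "c0 + 1" b "c + 1"] by auto
next
  case (bottom k)
  then show ?thesis by (intro bottom_region_prev[of k]) auto
qed

lemma region_prev_down:
  assumes "(a + 1, b, c) \<in> region" "1 \<le> c" "(White a b c, Black a b (c - 1)) \<notin> path_edges p"
  shows "(a, b + 1, c) \<in> region"
  using assms(1)
proof (cases rule: regionE)
  case (white b0 c0)
  have "White a (b0 + 1) c0 \<in> set p \<or> White a b0 (c0 + 1) \<in> set p \<and> b \<noteq> b0"
  proof (cases "b = b0")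
    case True
    then have "c = c0 + 1" using white by simp
    then show ?thesis using white_prev[of a b0 c0] white assms True by auto
  next
    case False
    then show ?thesis using white_prev[of a b0 c0] white by auto
  qed
  then show ?thesis
    using white white_region[of a "b0 + 1" c0 "b + 1" c] white_region[of a b0 "c0 + 1" "b + 1" c] by auto
next
  case (bottom k)
  then show ?thesis using assms by (intro bottom_region_prev[of k]) auto
qed

lemma region_down:
  assumes "(a, b, c + 1) \<in> region"
    and "\<And>a'. a = Suc a' \<Longrightarrow> (Black a' b c, White a b c) \<notin> path_edges p"
    and "a = 0 \<Longrightarrow> (Source (b + 1), White 0 b c) \<notin> path_edges p"
  shows "(a, b + 1, c) \<in> region"
  using assms(1)
proof (cases rule: regionE)
  case (white b0 c0)
  have "b \<noteq> b0"
  proof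
    assume b: "b = b0"
    then have c: "c0 = c" using white by simp
    show False
    proof (cases a)
      case 0
      then show ?thesis using white_first[of b0 c0] white b c assms(3) by simp
    next
      case (Suc a')
      then show ?thesis using white_prev[of a' b0 c0] white b c assms(2) by simp
    qed
  qed
  then show ?thesis using white by (intro white_region[of a b0 c0]) auto
next
  case (bottom k)
  then show ?thesis by (intro bottom_region[of k]) auto
qed

lemma region_up: "(a, b + 1, c) \<in> region \<Longrightarrow> (a, b, c + 1) \<in> region"
proof (erule regionE, goal_cases)
  case (1 b0 c0)
  then show ?case by (intro white_region[of a b0 c0]) auto
next
  case (2 k)
  then show ?case by (intro bottom_region[of k]) auto
qed

lemma region_bottom:
  assumes "(a + 1, b, 0) \<in> region" "(White a b 0, BottomSink (n - a)) \<notin> path_edges p"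
  shows "(a, b + 1, 0) \<in> region"
  using assms(1)
proof (cases rule: regionE)
  case (white b0 c0)
  then show ?thesis by simp
next
  case (bottom k)
  have "n < a + k"
  proof (rule ccontr)
    assume "\<not> n < a + k"
    then have "n - k = a" "k - 1 = b" "k = n - a" using bottom by auto
    then show False using bottom assms by simp
  qed
  then show ?thesis using bottom by (intro bottom_region[of k]) auto
qed

lemma region_adjacent:
  assumes "(u, v) \<in> path_edges p" "network_edge n u v \<alpha> \<beta>"
  shows "\<alpha> \<in> region"
proof -
  have uv: "u \<in> set p" "v \<in> set p" using edge_arc[OF assms(1)] by auto
  show ?thesis
    using assms(2)
  proof (cases rule: network_edge.cases)
    case (white_black_b a b c)
    show ?thesis unfolding white_black_b
      by (rule white_region[of a b c]) (use white_black_b uv in auto)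
  next
    case (white_black_c a b c)
    obtain w where w: "(v, w) \<in> path_edges p" using path_succ[OF uv(2)] white_black_c by auto
    then have "arc n v w" "w \<in> set p" using edge_arc by blast+
    then have "White (a + 1) b (c - 1) \<in> set p" using white_black_c by (auto simp: arc_Black)
    then show ?thesis unfolding white_black_c by (rule white_region) (use white_black_c in auto)
  next
    case (black_white a b c)
    show ?thesis unfolding black_white
      by (rule white_region[of "a + 1" b c]) (use black_white uv in auto)
  next
    case (source k)
    show ?thesis unfolding source
      by (rule white_region[of 0 "k - 1" "n - k"]) (use source uv in auto)
  next
    case (left_sink k)
    show ?thesis unfolding left_sink
      by (rule white_region[of "k - 1" 0 "n - k"]) (use left_sink uv in auto)
  next
    case (bottom_sink k)
    show ?thesis unfolding bottom_sink
      by (rule bottom_region[of k]) (use bottom_sink uv in auto)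
  qed
qed

text \<open>The lower end of the region in a column is the edge by which the path enters the column, and it moves
  by at most one step between neighbouring columns; so the region is left only across edges of the path.\<close>

lemma region_cross:
  assumes "(u, v) \<notin> path_edges p" "network_edge n u v \<alpha> \<beta>"
  shows "\<alpha> \<in> region \<longleftrightarrow> \<beta> \<in> region"
  using assms(2)
proof (cases rule: network_edge.cases)
  case (white_black_b a b c)
  show ?thesis unfolding white_black_b
    using region_next[of a b c] region_prev[of a b c] assms(1) white_black_b by auto
next
  case (white_black_c a b c)
  show ?thesis unfolding white_black_c
    using region_prev_down[of a b c] region_next_down[of a b c] assms(1) white_black_c by auto
next
  case (black_white a b c)
  show ?thesis unfolding black_white
    using region_down[of "a + 1" b c] region_up[of "a + 1" b c] assms(1) black_white by auto
next
  case (source k)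
  then have k: "k - 1 + 1 = k" by simp
  show ?thesis unfolding source
    using region_down[of 0 "k - 1" "n - k"] region_up[of 0 "k - 1" "n - k"] assms(1) source
    unfolding k by auto
next
  case (left_sink k)
  then have k: "k - 1 + 1 = k" by simp
  show ?thesis unfolding left_sink
    using region_next[of "k - 1" 0 "n - k"] region_prev[of "k - 1" 0 "n - k"] assms(1) left_sink
    unfolding k by auto
next
  case (bottom_sink k)
  then have k: "k - 1 + 1 = k" "n - (n - k) = k" by simp_all
  show ?thesis unfolding bottom_sink
    using region_bottom[of "n - k" "k - 1"] region_next_down[of "n - k" "k - 1" 0] assms(1) bottom_sink
    unfolding k by auto
qed

lemma right_faces_subset: "\<alpha> \<in> right_faces n p \<Longrightarrow> \<alpha> \<in> region"
proof (induction rule: right_faces.induct)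
  case (adjacent u v \<alpha> \<beta>)
  then show ?case by (rule region_adjacent)
next
  case (cross \<alpha> u v \<beta>)
  then show ?case using region_cross by blast
qed

text \<open>The only edge entering a white vertex separates two neighbouring faces of its column.\<close>

lemma white_edge:
  assumes "a + b + c + 1 = n"
  obtains u where "network_edge n u (White a b c) (a, b, c + 1) (a, b + 1, c)"
    and "White a b c \<in> set p \<longrightarrow> (u, White a b c) \<in> path_edges p"
proof (cases a)
  case 0
  then have "n - (b + 1) = c" "b + 1 \<le> n" using assms by auto
  then have "network_edge n (Source (b + 1)) (White a b c) (a, b, c + 1) (a, b + 1, c)"
    using network_edge.source[of "b + 1" n] 0 by simp
  then show ?thesis using that[of "Source (b + 1)"] white_first[of b c] 0 by simp
next
  case (Suc a')
  then have "network_edge n (Black a' b c) (White a b c) (a, b, c + 1) (a, b + 1, c)"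
    using network_edge.black_white[of a' b c n] assms by simp
  then show ?thesis using that[of "Black a' b c"] white_prev[of a' b c] Suc by simp
qed

text \<open>Within a column one can move upwards from face to face as long as no white vertex of the path
  is met.\<close>

lemma right_faces_up:
  assumes "(a, b0, c0) \<in> right_faces n p" "a + b0 + c0 = n" "b \<le> b0" "a + b + c = n"
    and "\<And>b' c'. b \<le> b' \<Longrightarrow> b' < b0 \<Longrightarrow> White a b' c' \<notin> set p"
  shows "(a, b, c) \<in> right_faces n p"
  using assms
proof (induction b0 arbitrary: c0)
  case 0
  then have "b = 0" "c0 = c" by auto
  with 0 show ?case by simp
next
  case (Suc b0)
  show ?case
  proof (cases "b = Suc b0")
    case True
    then have "c0 = c" using Suc.prems by simp
    then show ?thesis using Suc.prems(1) True by simp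
  next
    case False
    then have b: "b \<le> b0" using Suc.prems by simp
    then have W: "White a b0 c0 \<notin> set p" using Suc.prems(5) by simp
    have "a + b0 + c0 + 1 = n" using Suc.prems by simp
    then obtain u where u: "network_edge n u (White a b0 c0) (a, b0, c0 + 1) (a, b0 + 1, c0)"
      by (rule white_edge)
    have "(u, White a b0 c0) \<notin> path_edges p" using W edge_arc by blast
    then have "(a, b0, c0 + 1) \<in> right_faces n p"
      using right_faces.cross[of "(a, Suc b0, c0)" n p u "White a b0 c0" "(a, b0, c0 + 1)"] u Suc.prems(1)
      by simp
    then show ?thesis using Suc.IH[of "c0 + 1"] Suc.prems b by simp
  qed
qed

lemma bottom_last:
  assumes "BottomSink k \<in> set p" "u \<in> set p"
  shows "depth n u \<le> depth n (BottomSink k)"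
proof -
  have "t = BottomSink k" using sink_in_path assms by simp
  then have t: "p ! (length p - 1) = BottomSink k" using ends by (simp add: last_conv_nth)
  obtain m where "m < length p" "p ! m = u" using assms by (auto simp: in_set_conv_nth)
  then show ?thesis using depth_nth[of m] depth_nth[of "length p - 1"] t by simp
qed

text \<open>One inclusion is an induction over \<open>right_faces\<close>. For the other one, the entering edge of a white
  vertex gives the lowest face of the column on the right, from which the faces above are
  reached inside the column. Columns behind a bottom sink are entered along the bottom side.\<close>

lemma right_faces_eq: "right_faces n p = region"
proof (intro equalityI subsetI)
  fix \<alpha> assume "\<alpha> \<in> right_faces n p"
  then show "\<alpha> \<in> region" by (rule right_faces_subset)
next
  fix \<alpha> assume region: "\<alpha> \<in> region"
  obtain a b c where \<alpha>: "\<alpha> = (a, b, c)" by (cases \<alpha>)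
  have "(a, b, c) \<in> region" using region \<alpha> by simp
  then show "\<alpha> \<in> right_faces n p" unfolding \<alpha>
  proof (cases rule: regionE)
    case (white b0 c0)
    obtain u where u: "network_edge n u (White a b0 c0) (a, b0, c0 + 1) (a, b0 + 1, c0)"
        "White a b0 c0 \<in> set p \<longrightarrow> (u, White a b0 c0) \<in> path_edges p"
      by (rule white_edge[OF white(4)])
    have "(a, b0, c0 + 1) \<in> right_faces n p"
      by (rule right_faces.adjacent[OF u(2)[rule_format, OF white(2)] u(1)])
    moreover have "White a b' c' \<notin> set p" if "b' < b0" for b' c'
      using white_column[OF white(2), of b' c'] that by auto
    ultimately show "(a, b, c) \<in> right_faces n p"
      using white(1,3,4) right_faces_up[of a b0 "c0 + 1" b c] by simp
  next
    case (bottom k)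
    have col: "White a' b' c' \<notin> set p" if "n < a' + k" for a' b' c'
      using bottom_last[OF bottom(2), of "White a' b' c'"] that bottom by auto
    have "(a', n - a', 0) \<in> right_faces n p" if "n - k + 1 \<le> a'" "a' \<le> n" for a'
      using that
    proof (induction a' rule: dec_induct)
      case base
      have "network_edge n (White (n - k) (k - 1) 0) (BottomSink k) (n - k + 1, k - 1, 0) (n - k, k, 0)"
        using bottom network_edge.bottom_sink by blast
      then have "(n - k + 1, k - 1, 0) \<in> right_faces n p"
        by (rule right_faces.adjacent[OF bottom(7)])
      moreover have "n - (n - k + 1) = k - 1" using bottom by simp
      ultimately show ?case by simp
    next
      case (step a')
      have eq: "n - (n - a') = a'" "1 \<le> n - a'" "n - a' \<le> n" "n - a' - 1 = n - Suc a'" using step by auto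
      have edge: "network_edge n (White a' (n - Suc a') 0) (BottomSink (n - a')) (Suc a', n - Suc a', 0) (a', n - a', 0)"
        using network_edge.bottom_sink[OF eq(2,3)] unfolding eq by simp
      have "n < a' + k" using step.hyps bottom by simp
      then have new: "(White a' (n - Suc a') 0, BottomSink (n - a')) \<notin> path_edges p"
        using col[of a' "n - Suc a'" 0] edge_arc by blast
      have "(a', n - a', 0) \<in> right_faces n p"
        using step.IH step.prems by simp
      then show ?case
        by (rule right_faces.cross[OF _ new disjI2[OF edge]])
    qed
    then have "(a, n - a, 0) \<in> right_faces n p" using bottom by simp
    then show "(a, b, c) \<in> right_faces n p"
      using bottom(1,3) col right_faces_up[of a "n - a" 0 b c] by simp
  qed
qed

lemma path_weight_eq: "path_weight n Z p = prod_list (map (\<lambda>u. prod Z (node_faces n u)) p)"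
proof -
  have "path_weight n Z p = prod Z (\<Union>u\<in>set p. node_faces n u)"
    unfolding path_weight_def right_faces_eq region_def ..
  also have "\<dots> = (\<Prod>u\<in>set p. prod Z (node_faces n u))"
  proof (rule prod.UNION_disjoint)
    show "\<forall>u\<in>set p. finite (node_faces n u)"
      using finite_subset[OF node_faces_subset finite_faces] by blast
    show "\<forall>u\<in>set p. \<forall>v\<in>set p. u \<noteq> v \<longrightarrow> node_faces n u \<inter> node_faces n v = {}"
    proof (intro ballI impI)
      fix u v assume uv: "u \<in> set p" "v \<in> set p" "u \<noteq> v"
      have "u = v" if "\<alpha> \<in> node_faces n u" "\<alpha> \<in> node_faces n v" for \<alpha>
      proof -
        have WB: False if "White a b c \<in> set p" "BottomSink k \<in> set p"
          "\<alpha> \<in> node_faces n (White a b c)" "\<alpha> \<in> node_faces n (BottomSink k)" for a b c k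
          using bottom_last[of k "White a b c"] bottom_prev[of k] that by auto
        have WW: "White a b c = White a' b' c'" if "White a b c \<in> set p" "White a' b' c' \<in> set p"
          "\<alpha> \<in> node_faces n (White a b c)" "\<alpha> \<in> node_faces n (White a' b' c')" for a b c a' b' c'
          by (rule depth_inj) (use that in auto)
        consider (W) a b c where "u = White a b c" | (B) k where "u = BottomSink k"
          using \<open>\<alpha> \<in> node_faces n u\<close> by (cases u) auto
        then show ?thesis
        proof cases
          case u: W
          consider (W) a b c where "v = White a b c" | (B) k where "v = BottomSink k"
            using \<open>\<alpha> \<in> node_faces n v\<close> by (cases v) auto
          then show ?thesis
          proof cases
            case v: W
            show ?thesis unfolding u v by (rule WW) (use u v uv that in auto)
          next
            case v: B
            show ?thesis using WB that uv(1,2) unfolding u v by metis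
          qed
        next
          case u: B
          consider (W) a b c where "v = White a b c" | (B) k where "v = BottomSink k"
            using \<open>\<alpha> \<in> node_faces n v\<close> by (cases v) auto
          then show ?thesis
          proof cases
            case v: W
            show ?thesis using WB that uv(1,2) unfolding u v by metis
          next
            case v: B
            then show ?thesis
              using sink_in_path[OF uv(1)] sink_in_path[OF uv(2)] unfolding u v by simp
          qed
        qed
      qed
      then show "node_faces n u \<inter> node_faces n v = {}" using uv by blast
    qed
  qed simp
  also have "\<dots> = prod_list (map (\<lambda>u. prod Z (node_faces n u)) p)"
    using distinct_path by (simp add: prod.distinct_set_conv_list)
  finally show ?thesis .
qed

end

section \<open>The transport matrices as solutions of the transfer recursion\<close>

definition column_weight :: "nat \<Rightarrow> (face \<Rightarrow> real) \<Rightarrow> nat \<Rightarrow> nat \<Rightarrow> real" where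
  "column_weight n Z a j = (\<Prod>b<j. Z (a, b, n - a - b))"

text \<open>The product over all columns that a path to the bottom sink \<open>k\<close> does not reach, including the corner
  \<open>(n, 0, 0)\<close>.\<close>

definition corner_weight :: "nat \<Rightarrow> (face \<Rightarrow> real) \<Rightarrow> nat \<Rightarrow> real" where
  "corner_weight n Z k = (\<Prod>a=n+1-k..n. column_weight n Z a (n + 1 - a))"

lemma prod_white_faces:
  assumes "a + b \<le> n"
  shows "prod Z (node_faces n (White a b c)) = column_weight n Z a (b + 1)"
  unfolding column_weight_def
  by (rule prod.reindex_bij_witness[of _ "\<lambda>b'. (a, b', n - a - b')" "\<lambda>(a', b', c'). b'"])
    (use assms in auto)

lemma prod_bottom_faces:
  assumes "k \<le> n"
  shows "prod Z (node_faces n (BottomSink k)) = corner_weight n Z k"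
proof -
  have "corner_weight n Z k = (\<Prod>(a, b)\<in>(SIGMA a:{n+1-k..n}. {..<n + 1 - a}). Z (a, b, n - a - b))"
    unfolding corner_weight_def column_weight_def by (rule prod.Sigma) auto
  also have "\<dots> = prod Z (node_faces n (BottomSink k))"
    by (rule prod.reindex_bij_witness[of _ "\<lambda>(a, b, c). (a, b)" "\<lambda>(a, b). (a, b, n - a - b)"])
      (use assms in auto)
  finally show ?thesis ..
qed

definition path_sum :: "nat \<Rightarrow> (face \<Rightarrow> real) \<Rightarrow> node \<Rightarrow> node \<Rightarrow> real" where
  "path_sum n Z u t =
     (\<Sum>p\<in>directed_paths n u t. prod_list (map (\<lambda>v. prod Z (node_faces n v)) p))"

lemma directed_paths_sink:
  assumes "is_sink u"
  shows "directed_paths n u t = (if u = t then {[u]} else {})"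
proof -
  have only: "p = [u]" if "p \<in> directed_paths n u t" for p
  proof -
    obtain p' where p: "p = u # p'" "successively (arc n) (u # p')"
      using \<open>p \<in> directed_paths n u t\<close> unfolding directed_paths_arc by (cases p) auto
    have "p' = []"
    proof (cases p')
      case (Cons v q)
      then have "arc n u v" using p by simp
      then show ?thesis using arc_sink assms by blast
    qed
    then show ?thesis using p by simp
  qed
  have self: "[u] \<in> directed_paths n u t \<longleftrightarrow> u = t" by (simp add: directed_paths_arc)
  show ?thesis
  proof (cases "u = t")
    case True
    then have "directed_paths n u t = {[u]}" using self only by blast
    then show ?thesis using True by simp
  next
    case False
    then have "p \<notin> directed_paths n u t" for p using self only[of p] by metis
    then have "directed_paths n u t = {}" by blast
    then show ?thesis using False by simp
  qed
qed

lemma path_sum_step: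
  assumes "u \<noteq> t" and arcs: "\<And>v. arc n u v \<longleftrightarrow> v \<in> V" and "finite V"
    and fin: "\<And>v. v \<in> V \<Longrightarrow> finite (directed_paths n v t)"
  shows "finite (directed_paths n u t)"
    and "path_sum n Z u t = prod Z (node_faces n u) * (\<Sum>v\<in>V. path_sum n Z v t)"
proof -
  have D: "directed_paths n u t = (\<Union>v\<in>V. Cons u ` directed_paths n v t)"
  proof (intro equalityI subsetI)
    fix p assume p: "p \<in> directed_paths n u t"
    then obtain v p' where "p = u # v # p'"
      using assms(1) by (cases p; cases "tl p") (auto simp: directed_paths_arc)
    with p have "v \<in> V" "v # p' \<in> directed_paths n v t"
      by (auto simp: directed_paths_arc arcs)
    then show "p \<in> (\<Union>v\<in>V. Cons u ` directed_paths n v t)"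
      using \<open>p = u # v # p'\<close> by blast
  next
    fix p assume "p \<in> (\<Union>v\<in>V. Cons u ` directed_paths n v t)"
    then obtain v p' where v: "v \<in> V" "p = u # p'" "p' \<in> directed_paths n v t" by auto
    then obtain p'' where "p' = v # p''" by (cases p') (auto simp: directed_paths_arc)
    then show "p \<in> directed_paths n u t"
      using v by (auto simp: directed_paths_arc arcs)
  qed
  show "finite (directed_paths n u t)" unfolding D using assms(3) fin by blast
  have "path_sum n Z u t = (\<Sum>v\<in>V. \<Sum>p\<in>Cons u ` directed_paths n v t.
      prod_list (map (\<lambda>v. prod Z (node_faces n v)) p))"
    unfolding path_sum_def D
  proof (rule sum.UNION_disjoint)
    show "\<forall>v\<in>V. \<forall>v'\<in>V. v \<noteq> v' \<longrightarrow> (#) u ` directed_paths n v t \<inter> (#) u ` directed_paths n v' t = {}"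
      by (auto simp: directed_paths_arc)
  qed (use assms(3) fin in auto)
  also have "\<dots> = (\<Sum>v\<in>V. prod Z (node_faces n u) * path_sum n Z v t)"
    unfolding path_sum_def by (simp add: sum.reindex sum_distrib_left)
  finally show "path_sum n Z u t = prod Z (node_faces n u) * (\<Sum>v\<in>V. path_sum n Z v t)"
    by (simp add: sum_distrib_left)
qed

text \<open>The finiteness of the sets of paths is part of the induction since sums over infinite sets are zero.\<close>

lemma path_sum_White:
  assumes "a + b + c + 1 = n" and t: "is_sink t"
  shows "finite (directed_paths n (White a b c) t) \<and>
    path_sum n Z (White a b c) t = transfer n (column_weight n Z) (\<lambda>k. of_bool (t = LeftSink k))
      (\<lambda>k. of_bool (t = BottomSink k) * corner_weight n Z k) a (b + 1)"
  using assms(1)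
proof (induction "n - a" arbitrary: a b c)
  case 0
  then show ?case by simp
next
  case (Suc d)
  let ?e = "transfer n (column_weight n Z) (\<lambda>k. of_bool (t = LeftSink k))
      (\<lambda>k. of_bool (t = BottomSink k) * corner_weight n Z k)"
  let ?x = "if 1 \<le> b then Black a (b - 1) c else LeftSink (a + 1)"
  let ?y = "if 1 \<le> c then Black a b (c - 1) else BottomSink (n - a)"
  have black: "finite (directed_paths n (Black a b' c') t) \<and> path_sum n Z (Black a b' c') t = ?e (a + 1) (b' + 1)"
    if "a + b' + c' + 2 = n" for b' c'
  proof -
    have IH: "finite (directed_paths n (White (a + 1) b' c') t) \<and>
       path_sum n Z (White (a + 1) b' c') t = ?e (a + 1) (b' + 1)"
      by (rule Suc.hyps) (use Suc that in auto)
    have "Black a b' c' \<noteq> t" using t by auto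
    moreover have "arc n (Black a b' c') v \<longleftrightarrow> v \<in> {White (a + 1) b' c'}" for v
      using that by (simp add: arc_Black)
    ultimately show ?thesis
      using path_sum_step[of "Black a b' c'" t n "{White (a + 1) b' c'}"] IH by simp
  qed
  have x: "finite (directed_paths n ?x t) \<and> path_sum n Z ?x t = ?e (a + 1) b"
  proof (cases "b = 0")
    case True
    then show ?thesis by (auto simp: directed_paths_sink path_sum_def)
  next
    case False
    then show ?thesis using black[of "b - 1" c] Suc.prems by simp
  qed
  have y: "finite (directed_paths n ?y t) \<and> path_sum n Z ?y t = ?e (a + 1) (b + 1)"
  proof (cases "c = 0")
    case True
    then have "n - a = b + 1" using Suc.prems by simp
    then show ?thesis using True Suc.prems prod_bottom_faces[of "b + 1" n Z]
      by (auto simp: directed_paths_sink path_sum_def transfer_bottom)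
  next
    case False
    then show ?thesis using black[of b "c - 1"] Suc.prems by simp
  qed
  have xy: "?x \<noteq> ?y" by auto
  have arcs: "arc n (White a b c) v \<longleftrightarrow> v \<in> {?x, ?y}" for v
    using Suc.prems by (simp only: arc_White) simp
  have nt: "White a b c \<noteq> t" using t by auto
  have "?e a (b + 1) = column_weight n Z a (b + 1) * (?e (a + 1) b + ?e (a + 1) (b + 1))"
    using transfer_step[of a b n] Suc.prems by simp
  moreover have "finite (directed_paths n v t)" if "v \<in> {?x, ?y}" for v
    using that x y by blast
  ultimately show ?case
    using path_sum_step(1)[OF nt arcs] path_sum_step(2)[OF nt arcs, where Z = Z] x y xy prod_white_faces[of a b n Z c] Suc.prems by simp
qed

lemma path_sum_Source:
  assumes "1 \<le> l" "l \<le> n" and t: "is_sink t"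
  shows "(\<Sum>p\<in>directed_paths n (Source l) t. path_weight n Z p) =
     transfer n (column_weight n Z) (\<lambda>k. of_bool (t = LeftSink k))
      (\<lambda>k. of_bool (t = BottomSink k) * corner_weight n Z k) 0 l"
proof -
  have "(\<Sum>p\<in>directed_paths n (Source l) t. path_weight n Z p) = path_sum n Z (Source l) t"
    unfolding path_sum_def
  proof (rule sum.cong)
    fix p assume "p \<in> directed_paths n (Source l) t"
    then interpret network_path n l t p by unfold_locales (use t in auto)
    show "path_weight n Z p = prod_list (map (\<lambda>v. prod Z (node_faces n v)) p)"
      by (rule path_weight_eq)
  qed simp
  also have "\<dots> = path_sum n Z (White 0 (l - 1) (n - l)) t"
  proof -
    have "arc n (Source l) v \<longleftrightarrow> v \<in> {White 0 (l - 1) (n - l)}" for v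
      using assms by (simp add: arc_Source)
    moreover have "Source l \<noteq> t" using t by auto
    ultimately show ?thesis
      using path_sum_step(2)[of "Source l" t n "{White 0 (l - 1) (n - l)}" Z]
        path_sum_White[of 0 "l - 1" "n - l" n t Z] assms by simp
  qed
  finally show ?thesis
    using path_sum_White[of 0 "l - 1" "n - l" n t Z] assms by simp
qed

lemma M1_eq: "M1 n Z = mat_from_1 n (\<lambda>k l. to_left n (column_weight n Z) k 0 l)"
  unfolding M1_def by (rule mat_from_1_cong) (simp add: path_sum_Source eq_commute)

lemma M2_eq: "M2 n Z = mat_from_1 n (\<lambda>k l. corner_weight n Z k * to_bottom n (column_weight n Z) k 0 l)"
  unfolding M2_def
proof (rule mat_from_1_cong)
  fix k l assume "1 \<le> k" "k \<le> n" "1 \<le> l" "l \<le> n"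
  then have "(\<Sum>p\<in>directed_paths n (Source l) (BottomSink k). path_weight n Z p)
    = transfer n (column_weight n Z) (\<lambda>m. corner_weight n Z k * 0) (\<lambda>m. corner_weight n Z k * of_bool (m = k)) 0 l"
    by (simp add: path_sum_Source) (rule arg_cong2[of _ _ _ _ "\<lambda>L B. transfer _ _ L B 0 l"], auto)
  then show "(\<Sum>p\<in>directed_paths n (Source l) (BottomSink k). path_weight n Z p)
    = corner_weight n Z k * to_bottom n (column_weight n Z) k 0 l"
    by (simp only: transfer_scale)
qed

lemma A_matrix_eq:
  "A_matrix n Z = mat_from_1 n (normalized (gram n (column_weight n Z) (corner_weight n Z)))"
proof -
  have "(M1 n Z)\<^sup>T * M2 n Z = mat_from_1 n (gram n (column_weight n Z) (corner_weight n Z))"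
    unfolding M1_eq M2_eq mat_from_1_transpose mat_from_1_mult gram_def ..
  then show ?thesis
    unfolding A_matrix_def Let_def normalized_def
    by (auto intro!: mat_from_1_cong simp: entry_mat_from_1)
qed

section \<open>Dependence on the quiver variables only\<close>

lemma column_weight_Suc: "column_weight n Z a (Suc j) = column_weight n Z a j * Z (a, j, n - a - j)"
  by (simp add: column_weight_def)

lemma column_weight_0 [simp]: "column_weight n Z a 0 = 1"
  by (simp add: column_weight_def)

lemma column_weight_pos:
  assumes "\<forall>\<alpha>\<in>faces n. 0 < Z \<alpha>" "a + j \<le> n + 1"
  shows "0 < column_weight n Z a j"
  unfolding column_weight_def by (rule prod_pos) (use assms in \<open>auto simp: faces_def\<close>)

lemma corner_weight_pos:
  assumes "\<forall>\<alpha>\<in>faces n. 0 < Z \<alpha>"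
  shows "0 < corner_weight n Z k"
  unfolding corner_weight_def by (rule prod_pos) (use assms in \<open>auto intro!: column_weight_pos\<close>)

lemma gram_pos_triangular:
  assumes q: "\<And>a j. a + j \<le> n \<Longrightarrow> 0 < q a j" and R: "\<And>k. 0 < R k"
  shows "pos_triangular n (gram n q R)"
  unfolding pos_triangular_def
proof (intro ballI conjI impI)
  fix k assume k: "k \<in> {1..n}"
  have "gram n q R k k = (\<Sum>j=1..n. if j = k then to_left n q k 0 k * (R k * to_bottom n q k 0 k) else 0)"
    unfolding gram_def
  proof (rule sum.cong)
    fix j assume "j \<in> {1..n}"
    consider "j < k" | "j = k" | "k < j" by linarith
    then show "to_left n q j 0 k * (R j * to_bottom n q j 0 k)
      = (if j = k then to_left n q k 0 k * (R k * to_bottom n q k 0 k) else 0)"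
      by cases (use to_left_triangular[of j 0 k n q] to_bottom_triangular[of k j n q 0] in auto)
  qed simp
  also have "\<dots> = to_left n q k 0 k * (R k * to_bottom n q k 0 k)" using k by simp
  also have "0 < \<dots>"
    using to_left_triangular[of k 0 k n q] to_bottom_triangular[of k k n q 0] q R k by simp
  finally show "0 < gram n q R k k" .
next
  fix k l assume "k \<in> {1..n}" "l \<in> {1..n}" "l < k"
  have "to_left n q j 0 k = 0 \<or> to_bottom n q j 0 l = 0" for j
    using to_left_triangular[of j 0 k n q] to_bottom_triangular[of l j n q 0] \<open>l < k\<close> by (cases "j < k") auto
  then show "gram n q R k l = 0" unfolding gram_def by (intro sum.neutral) auto
qed

text \<open>Column \<open>0\<close> consists of boundary faces, and its products may change independently of each other: this
  multiplies the rows of the transport matrices.\<close>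

lemma transfer_source_gauge:
  assumes "1 \<le> l" "l \<le> n" and q0: "q 0 l \<noteq> 0"
    and 1: "\<And>m. m \<le> n \<Longrightarrow> c * transfer n q' L' B' 1 m = d * transfer n q L B 1 m"
  shows "c * transfer n q' L' B' 0 l = q' 0 l / q 0 l * d * transfer n q L B 0 l"
proof -
  obtain m where l: "l = Suc m" using assms by (cases l) auto
  have "c * transfer n q' L' B' 0 l = q' 0 l * (c * transfer n q' L' B' 1 m + c * transfer n q' L' B' 1 l)"
    using transfer_step[of 0 m n q' L' B'] assms(1,2) l by (simp add: algebra_simps)
  also have "\<dots> = q' 0 l * (d * transfer n q L B 1 m + d * transfer n q L B 1 l)"
  proof -
    have "m \<le> n" "l \<le> n" using assms(2) l by simp_all
    then show ?thesis by (simp only: 1)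
  qed
  also have "\<dots> = q' 0 l * d * (transfer n q L B 1 m + transfer n q L B 1 l)"
    by (simp add: algebra_simps)
  also have "\<dots> = q' 0 l / q 0 l * d * transfer n q L B 0 l"
    using transfer_step[of 0 m n q L B] assms(1-3) l by simp
  finally show ?thesis .
qed

lemma vertex_in [simp]:
  "Inner a b c \<in> vertices n \<longleftrightarrow> a + b + c = n \<and> 1 \<le> a \<and> 1 \<le> b \<and> 1 \<le> c"
  "Merged k \<in> vertices n \<longleftrightarrow> 1 \<le> k \<and> k \<le> n - 1"
  by (auto simp: vertices_def)

text \<open>Two choices of face variables with the same quiver variables differ by arbitrary factors on the
  right side and at the corners, and by factors \<open>h k\<close> on the left side and \<open>1 / h k\<close> on the
  bottom side. The latter multiply \<open>M\<^sub>1\<close> and \<open>M\<^sub>2\<close> by diagonal matrices which, up to a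
  scalar, cancel in \<open>M\<^sub>1\<^sup>T M\<^sub>2\<close>.\<close>

lemma A_matrix_cong_induces:
  assumes Z: "induces n Z x" and Z': "induces n Z' x"
  shows "A_matrix n Z' = A_matrix n Z"
proof -
  have pos: "\<forall>\<alpha>\<in>faces n. 0 < Z \<alpha>" "\<forall>\<alpha>\<in>faces n. 0 < Z' \<alpha>"
    using Z Z' by (simp_all add: induces_def)
  have p: "0 < Z (a, b, c)" "0 < Z' (a, b, c)" if "a + b + c = n" for a b c
    using pos that by (auto simp: faces_def)
  define q q' where "q = column_weight n Z" and "q' = column_weight n Z'"
  define R R' where "R = corner_weight n Z" and "R' = corner_weight n Z'"
  have q_pos: "0 < q a j" "0 < q' a j" if "a + j \<le> n + 1" for a j
    using column_weight_pos pos that by (auto simp: q_def q'_def)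
  define h where "h a = Z' (a, 0, n - a) / Z (a, 0, n - a)" for a
  have h: "0 < h a" if "a \<le> n" for a using p[of a 0 "n - a"] that by (simp add: h_def)
  define H where "H a = (\<Prod>b=a..<n. h b)" for a
  have H: "0 < H a" for a unfolding H_def by (rule prod_pos) (use h in auto)
  have inner: "Z' (a, b, c) = Z (a, b, c)" if "a + b + c = n" "1 \<le> a" "1 \<le> b" "1 \<le> c" for a b c
  proof -
    have "Inner a b c \<in> vertices n" using that by simp
    then have "x (Inner a b c) = Z (a, b, c)" "x (Inner a b c) = Z' (a, b, c)"
      using Z Z' unfolding induces_def by fastforce+
    then show ?thesis by simp
  qed
  have merged: "Z' (k, 0, n - k) * Z' (n - k, k, 0) = Z (k, 0, n - k) * Z (n - k, k, 0)" if "1 \<le> k" "k < n" for k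
  proof -
    have "Merged k \<in> vertices n" "(k, 0, n - k) \<noteq> (n - k, k, 0)" using that by auto
    then have "x (Merged k) = Z (k, 0, n - k) * Z (n - k, k, 0)" "x (Merged k) = Z' (k, 0, n - k) * Z' (n - k, k, 0)"
      using Z Z' unfolding induces_def by fastforce+
    then show ?thesis by simp
  qed
  have q_h: "q' a (Suc j) = h a * q a (Suc j)" if "0 < a" "a + Suc j \<le> n" for a j
    using that
  proof (induction j)
    case 0
    then show ?case using p[of a 0 "n - a"] by (simp add: q_def q'_def column_weight_Suc h_def)
  next
    case (Suc j)
    have "Z' (a, Suc j, n - a - Suc j) = Z (a, Suc j, n - a - Suc j)"
      by (rule inner) (use Suc.prems in auto)
    then show ?case
      using Suc by (simp add: q_def q'_def column_weight_Suc[of _ _ _ "Suc j"])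
  qed
  have q_h': "q' a j = h a * q a j" if "a < n" "0 < a" "0 < j" "a + j \<le> n" for a j
    using q_h[of a "j - 1"] that by simp
  have full: "q' a (n + 1 - a) = h a / h (n - a) * q a (n + 1 - a)" if "1 \<le> a" "a < n" for a
  proof -
    have "Z' (a, n - a, 0) = Z (a, n - a, 0) / h (n - a)"
      using merged[of "n - a"] p[of "n - a" 0 a] p[of a "n - a" 0] that
      by (simp add: h_def field_simps)
    moreover have "n + 1 - a = Suc (n - a)" using that by simp
    ultimately show ?thesis
      using q_h'[of a "n - a"] that by (simp add: q_def q'_def column_weight_Suc)
  qed
  define z where "z = h n"
  have z: "0 < z" using h by (simp add: z_def)
  \<comment> \<open>the factors \<open>h\<close> of the columns and those of the bottom faces, which are inverse to them\<close>
  have R_h: "R' k * H 1 = R k * z * (H (n + 1 - k) * H k)" if k: "1 \<le> k" "k \<le> n" for k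
  proof -
    have split: "corner_weight n W k = column_weight n W n 1 * (\<Prod>a=n+1-k..<n. column_weight n W a (n + 1 - a))" for W
    proof -
      have "{n+1-k..n} = insert n {n+1-k..<n}" using k by auto
      then show ?thesis unfolding corner_weight_def by simp
    qed
    have "R' k = z * q n 1 * (\<Prod>a=n+1-k..<n. h a / h (n - a) * q a (n + 1 - a))"
    proof -
      have "q' n 1 = z * q n 1"
        using p[of n 0 0] by (simp add: q_def q'_def z_def h_def column_weight_Suc)
      moreover have "(\<Prod>a=n+1-k..<n. q' a (n + 1 - a)) = (\<Prod>a=n+1-k..<n. h a / h (n - a) * q a (n + 1 - a))"
        by (rule prod.cong) (use full k in auto)
      ultimately show ?thesis unfolding R'_def split q'_def[symmetric] by simp
    qed
    also have "\<dots> = z * R k * ((\<Prod>a=n+1-k..<n. h a) / (\<Prod>a=n+1-k..<n. h (n - a)))"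
      unfolding R_def split q_def[symmetric] prod.distrib prod_dividef by simp
    also have "(\<Prod>a=n+1-k..<n. h (n - a)) = (\<Prod>b=1..<k. h b)"
      by (rule prod.reindex_bij_witness[of _ "\<lambda>b. n - b" "\<lambda>a. n - a"]) (use k in auto)
    finally have R': "R' k = z * R k * (H (n + 1 - k) / (\<Prod>b=1..<k. h b))" unfolding H_def .
    have H1: "H 1 = (\<Prod>b=1..<k. h b) * H k"
      unfolding H_def using k by (simp add: prod.atLeastLessThan_concat)
    have "0 < (\<Prod>b=1..<k. h b)" by (rule prod_pos) (use h k in auto)
    then have "(\<Prod>b=1..<k. h b) \<noteq> 0" by (metis less_irrefl)
    then show ?thesis unfolding R' H1 by (simp only: times_divide_eq_right times_divide_eq_left) (simp add: ac_simps)
  qed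
  have left: "H j * to_left n q' j 0 l = q' 0 l / q 0 l * H 1 * to_left n q j 0 l"
    if "1 \<le> l" "l \<le> n" for j l
  proof (rule transfer_source_gauge)
    fix m assume "m \<le> n"
    have "H j * to_left n q' j 1 m = transfer n q' (\<lambda>k. H k * of_bool (k = j)) (\<lambda>k. H (n + 1 - k) * 0) 1 m"
      unfolding transfer_scale[symmetric] by (rule arg_cong2[of _ _ _ _ "\<lambda>L B. transfer n q' L B 1 m"]) auto
    also have "\<dots> = H 1 * to_left n q j 1 m"
      unfolding H_def by (rule transfer_gauge[OF q_h']) (use \<open>m \<le> n\<close> in auto)
    finally show "H j * to_left n q' j 1 m = H 1 * to_left n q j 1 m" .
  qed (use that q_pos[of 0 l] in auto)
  have bottom: "H (n + 1 - j) * to_bottom n q' j 0 l = q' 0 l / q 0 l * H 1 * to_bottom n q j 0 l"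
    if "1 \<le> l" "l \<le> n" for j l
  proof (rule transfer_source_gauge)
    fix m assume "m \<le> n"
    have "H (n + 1 - j) * to_bottom n q' j 1 m
      = transfer n q' (\<lambda>k. H k * 0) (\<lambda>k. H (n + 1 - k) * of_bool (k = j)) 1 m"
      unfolding transfer_scale[symmetric] by (rule arg_cong2[of _ _ _ _ "\<lambda>L B. transfer n q' L B 1 m"]) auto
    also have "\<dots> = H 1 * to_bottom n q j 1 m"
      unfolding H_def by (rule transfer_gauge[OF q_h']) (use \<open>m \<le> n\<close> in auto)
    finally show "H (n + 1 - j) * to_bottom n q' j 1 m = H 1 * to_bottom n q j 1 m" .
  qed (use that q_pos[of 0 l] in auto)
  have "gram n q' R' k l = (z * H 1) * (q' 0 k / q 0 k) * (q' 0 l / q 0 l) * gram n q R k l"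
    if kl: "1 \<le> k" "k \<le> n" "1 \<le> l" "l \<le> n" for k l
    unfolding gram_def sum_distrib_left
  proof (rule sum.cong)
    fix j assume j: "j \<in> {1..n}"
    have "H 1 * (to_left n q' j 0 k * (R' j * to_bottom n q' j 0 l))
      = R j * z * (H j * to_left n q' j 0 k) * (H (n + 1 - j) * to_bottom n q' j 0 l)"
      using R_h[of j] j by (simp add: ac_simps)
    also have "\<dots> = H 1 * (z * H 1 * (q' 0 k / q 0 k) * (q' 0 l / q 0 l) * (to_left n q j 0 k * (R j * to_bottom n q j 0 l)))"
      unfolding left[OF kl(1,2)] bottom[OF kl(3,4)] by (simp add: ac_simps)
    finally show "to_left n q' j 0 k * (R' j * to_bottom n q' j 0 l)
      = z * H 1 * (q' 0 k / q 0 k) * (q' 0 l / q 0 l) * (to_left n q j 0 k * (R j * to_bottom n q j 0 l))"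
      by (rule mult_left_cancel[THEN iffD1, rotated]) (use H[of 1] in simp)
  qed simp
  then show ?thesis
    unfolding A_matrix_eq q_def[symmetric] q'_def[symmetric] R_def[symmetric] R'_def[symmetric]
    by (intro normalized_scale[where s = "\<lambda>k. q' 0 k / q 0 k" and c = "z * H 1"])
      (use q_pos z H in auto)
qed

section \<open>Partial sums along a line\<close>

definition chain_prod :: "(nat \<Rightarrow> real) \<Rightarrow> nat \<Rightarrow> real" where
  "chain_prod y t = (\<Prod>s=1..<t. y s)"

text \<open>\<open>chain_sum y n\<close> is, up to normalization, the entry \<open>a\<^bsub>i,i+1\<^esub>\<close>: \<open>n\<close> pairs of
  paths from the sources \<open>i\<close> and \<open>i + 1\<close> contribute to it, and passing from one pair to the next
  multiplies the weight by a variable \<open>y\<^sub>t\<close>.\<close>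

definition chain_sum :: "(nat \<Rightarrow> real) \<Rightarrow> nat \<Rightarrow> real" where
  "chain_sum y t = (\<Sum>s=1..t. chain_prod y s)"

definition chain_ratio :: "(nat \<Rightarrow> real) \<Rightarrow> nat \<Rightarrow> real" where
  "chain_ratio y t = chain_sum y (Suc t) / chain_sum y t"

lemma chain_prod_1 [simp]: "chain_prod y (Suc 0) = 1"
  by (simp add: chain_prod_def)

lemma chain_prod_Suc: "1 \<le> t \<Longrightarrow> chain_prod y (Suc t) = chain_prod y t * y t"
  by (simp add: chain_prod_def)

lemma chain_sum_0 [simp]: "chain_sum y 0 = 0"
  by (simp add: chain_sum_def)

lemma chain_sum_Suc: "chain_sum y (Suc t) = chain_sum y t + chain_prod y (Suc t)"
  by (simp add: chain_sum_def)

lemma chain_prod_pos: "(\<And>s. 1 \<le> s \<Longrightarrow> s < t \<Longrightarrow> 0 < y s) \<Longrightarrow> 0 < chain_prod y t"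
  by (auto simp: chain_prod_def intro!: prod_pos)

lemma chain_sum_pos: "1 \<le> t \<Longrightarrow> (\<And>s. 1 \<le> s \<Longrightarrow> s < t \<Longrightarrow> 0 < y s) \<Longrightarrow> 0 < chain_sum y t"
  unfolding chain_sum_def by (intro sum_pos chain_prod_pos) auto

section \<open>Changing the network along a line\<close>

text \<open>The factor of the product of the first \<open>j\<close> faces of column \<open>a\<close>. The faces whose variables change
  are those on the line and next to it; the quotients \<open>S\<^bsub>t+1\<^esub> / S\<^sub>t\<close> telescope, so that only four
  positions have a nontrivial factor. In column \<open>1\<close> the position between the two parts of the
  line belongs to both of them, and there the first and the last vertex of the line meet.\<close>

definition line_ratio :: "nat \<Rightarrow> nat \<Rightarrow> (nat \<Rightarrow> real) \<Rightarrow> nat \<Rightarrow> nat \<Rightarrow> real" where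
  "line_ratio n i y a j =
     (if a = 0 \<or> j = 0 \<or> n < a + j then 1
      else if a + j = i then chain_ratio y (n - a - 1)
      else if a = 1 \<and> j = i then chain_sum y (n - 1) / chain_prod y n
      else if a + j = i + 1 then 1 / chain_ratio y (n - a)
      else if j = i then chain_ratio y (a - 1)
      else if j = i + 1 then 1 / chain_ratio y a
      else 1)"

text \<open>The column products \<open>q\<close> of a network and the changed products \<open>q'\<close>. The assumptions say that \<open>y\<close>
  lists the variables of the line, in the columns on the right side of the triangle for \<open>b = i\<close>
  and on its top for \<open>c = n - i\<close>; the vertex \<open>y\<^bsub>n-i\<^esub>\<close>, which is merged from two faces, enters
  only through the corner weights.\<close>

locale line_change =
  fixes n i :: nat and y :: "nat \<Rightarrow> real" and q q' :: "nat \<Rightarrow> nat \<Rightarrow> real"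
  assumes i: "1 \<le> i" "i < n"
    and y_pos: "\<And>t. 1 \<le> t \<Longrightarrow> t < n \<Longrightarrow> 0 < y t"
    and q_pos: "\<And>a j. a + j \<le> n \<Longrightarrow> 0 < q a j"
    and q_right: "\<And>a. 1 \<le> a \<Longrightarrow> a < n - i \<Longrightarrow> q a (i + 1) = q a i * y a"
    and q_top: "\<And>a. 1 \<le> a \<Longrightarrow> a < i \<Longrightarrow> q a (i - a + 1) = q a (i - a) * y (n - a)"
    and q': "\<And>a j. 1 \<le> j \<Longrightarrow> a + j \<le> n \<Longrightarrow> q' a j = line_ratio n i y a j * q a j"
begin

abbreviation "p \<equiv> chain_prod y"
abbreviation "S \<equiv> chain_sum y"

lemma p_pos: "t \<le> n \<Longrightarrow> 0 < p t"
  by (rule chain_prod_pos) (use y_pos in auto)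

lemma S_pos: "1 \<le> t \<Longrightarrow> t \<le> n \<Longrightarrow> 0 < S t"
  by (rule chain_sum_pos) (use y_pos in auto)

text \<open>The amount in which the sink \<open>i\<close> is mixed into the sink \<open>i + 1\<close> on the left side; the constant
  \<open>bottom_mix\<close> plays this role, with the sinks interchanged, on the bottom side. Both are values
  of the corrections in \<open>column_change\<close> at the end of the line.\<close>

definition left_mix :: real where
  "left_mix = - p (n - i + 1) / (S (n - i) * q i 1)"

definition bottom_mix :: real where
  "bottom_mix = p (n - i) / (S (n - i) * q (n - i) i)"

context
  fixes L B L' B' :: "nat \<Rightarrow> real"
  assumes L': "\<And>k. L' k = L k + of_bool (k = i + 1) * left_mix * L i"
    and B': "\<And>k. B' k = B k + of_bool (k = i) * bottom_mix * B (i + 1)"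
begin

abbreviation "e \<equiv> transfer n q L B"
abbreviation "e' \<equiv> transfer n q' L' B'"

text \<open>In a position next to the line the correction inherited from the next column is a multiple of the
  solution itself, and the factor \<open>line_ratio\<close> is chosen to compensate it.\<close>

lemma unmixed_step:
  assumes IH: "\<And>m. m \<le> n - a \<Longrightarrow> e' (Suc a) m = e (Suc a) m
      - of_bool (m + a = i) * p (n - a + 1) / (S (n - a) * q a (i - a + 1)) * e a (i - a)
      + of_bool (m = i) * p a / (S a * q a i) * e a (i + 1)"
    and a: "1 \<le> a" and 3: "1 \<le> j" "a + j \<le> n" and P: "j \<noteq> i" "a + j \<noteq> i + 1"
  shows "e' a j = e a j"
proof -
  obtain m where m: "j = Suc m" using 3 by (cases j) auto
  have e: "e a j = q a j * (e (Suc a) m + e (Suc a) j)"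
    using transfer_step[of a m n q L B] 3 m by simp
  have e': "e' a j = line_ratio n i y a j * q a j * (e' (Suc a) m + e' (Suc a) j)"
    using transfer_step[of a m n q' L' B'] 3 m q'[of j a] by simp
  define D where "D m = - of_bool (m + a = i) * p (n - a + 1) / (S (n - a) * q a (i - a + 1)) * e a (i - a)
      + of_bool (m = i) * p a / (S a * q a i) * e a (i + 1)" for m
  have "e' (Suc a) m = e (Suc a) m + D m" "e' (Suc a) j = e (Suc a) j + D j"
    using IH[of m] IH[of j] 3 m by (auto simp: D_def)
  then have master: "e' a j = line_ratio n i y a j * (e a j + q a j * (D m + D j))"
    unfolding e' e by (simp add: algebra_simps)
  have qj: "0 < q a j" using q_pos 3 by simp
  consider (T) "a + j = i" | (R) "j = i + 1" | (other) "a + j \<noteq> i" "j \<noteq> i + 1"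
    by blast
  then show ?thesis
  proof cases
    case T
        define t where "t = n - a - 1"
        have t: "n - a = Suc t" "n - a - 1 = t" "1 \<le> t" "Suc t \<le> n" "n - a + 1 = Suc (Suc t)"
          using T 3 i a t_def by auto
        have j: "j = i - a" "j \<noteq> i" "m + a \<noteq> i" "m \<noteq> i"
          using T m a 3 by auto
        have r: "line_ratio n i y a j = S (Suc t) / S t"
          using T 3 a t by (simp add: line_ratio_def chain_ratio_def)
        have pq: "p (Suc (Suc t)) = p (Suc t) * y (Suc t)" "q a (i - a + 1) = q a j * y (Suc t)"
          using t q_top[of a] j T 3 a by (simp_all add: chain_prod_Suc)
        have pos: "0 < S t" "0 < S (Suc t)" "0 < y (Suc t)" "0 < p (Suc t)"
          using t a by (auto intro!: S_pos y_pos p_pos)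
        have SS: "S (Suc t) = S t + p (Suc t)" by (rule chain_sum_Suc)
        have "e' a j = S (Suc t) / S t * (e a j - p (Suc t) / S (Suc t) * e a j)"
          unfolding master r using j T pos qj pq t
          by (simp add: D_def field_simps)
        also have "\<dots> = (S (Suc t) - p (Suc t)) / S t * e a j"
          using pos by (simp add: field_simps)
        also have "\<dots> = e a j" using pos SS by simp
        finally show ?thesis using j by simp
  next
    case R
        have j: "m = i" "j \<noteq> i" "m + a \<noteq> i" "j + a \<noteq> i" using R m a by auto
        have r: "line_ratio n i y a j = S a / S (Suc a)"
          using R 3 a by (simp add: line_ratio_def chain_ratio_def)
        have pos: "0 < S (Suc a)" "0 < S a" "0 < y a" "0 < p a" "0 < q a i"
          using a 3 R i by (auto intro!: S_pos y_pos p_pos q_pos)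
        have qa: "q a j = q a i * y a" using q_right[of a] R 3 a by simp
        have SS: "S (Suc a) = S a + p (Suc a)" by (rule chain_sum_Suc)
        have pa: "p (Suc a) = p a * y a" using a by (intro chain_prod_Suc) simp
        have "e' a j = S a / S (Suc a) * (e a j + p (Suc a) / S a * e a j)"
          unfolding master r pa using j pos qj R qa
          by (simp add: D_def field_simps)
        also have "\<dots> = (S a + p (Suc a)) / S (Suc a) * e a j"
          using pos by (simp add: field_simps)
        also have "\<dots> = e a j" using pos SS by simp
        finally show ?thesis using j by simp
  next
    case other
        have r: "line_ratio n i y a j = 1"
          using other a P by (simp add: line_ratio_def)
        have j: "m + a \<noteq> i" "m \<noteq> i" "j + a \<noteq> i" using other m P by auto
        show ?thesis
          unfolding master r using other j P by (simp add: D_def)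
  qed
qed

text \<open>The heart of the proof. In column \<open>a + 1\<close> the new solution differs from the old one in the two
  positions just past the line, by a multiple of the old solution in the adjacent position of column
  \<open>a\<close> on the other side of the line. Expressing the correction through column \<open>a\<close> rather than through column \<open>a + 1\<close>
  lets the same formula cover the exits at the sinks. The step of the induction
  rests on \<open>S\<^bsub>t+1\<^esub> = S\<^sub>t + p\<^bsub>t+1\<^esub>\<close> and \<open>p\<^bsub>t+1\<^esub> = p\<^sub>t y\<^sub>t\<close>.\<close>

lemma column_change:
  assumes "1 \<le> a" "a \<le> n" "j \<le> n - a"
  shows "e' (Suc a) j = e (Suc a) j
      - of_bool (j + a = i) * p (n - a + 1) / (S (n - a) * q a (i - a + 1)) * e a (i - a)
      + of_bool (j = i) * p a / (S a * q a i) * e a (i + 1)"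
  using assms(2,1,3)
proof (induction a arbitrary: j rule: inc_induct)
  case base
  then show ?case using i by (simp add: L')
next
  case (step b j)
  define a where "a = Suc b"
  have a: "2 \<le> a" "a \<le> n" using step a_def by auto
  have IH: "e' (Suc a) m = e (Suc a) m
      - of_bool (m + a = i) * p (n - a + 1) / (S (n - a) * q a (i - a + 1)) * e a (i - a)
      + of_bool (m = i) * p a / (S a * q a i) * e a (i + 1)" if "m \<le> n - a" for m
    using step.IH[of m] that by (simp add: a_def)
  have goal: "e' a j = e a j
      - of_bool (j + b = i) * p (n - b + 1) / (S (n - b) * q b (i - b + 1)) * e b (i - b)
      + of_bool (j = i) * p b / (S b * q b i) * e b (i + 1)"
  proof -
    consider "j = 0" | "1 \<le> j" "a + j = n + 1" | "1 \<le> j" "a + j \<le> n"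
      using step.prems a_def by linarith
    then show ?thesis
    proof cases
      case 1
      then show ?thesis using i a
        by (auto simp: L' a_def left_mix_def)
    next
      case 2
      then have *: "e a j = B j" "e' a j = B' j"
        by (simp_all add: transfer_bottom)
      have "b + j = n" using 2 a_def by simp
      show ?thesis
      proof (cases "j = i")
        case True
        then have "b = n - i" "e b (i + 1) = B (i + 1)"
          using \<open>b + j = n\<close> by (auto simp: transfer_bottom)
        then show ?thesis using * True step.hyps \<open>b + j = n\<close> i
          by (simp add: B' bottom_mix_def)
      next
        case False
        then show ?thesis using * \<open>b + j = n\<close> i by (simp add: B')
      qed
    next
      case 3
      then obtain m where m: "j = Suc m" by (cases j) auto
      have e: "e a j = q a j * (e (Suc a) m + e (Suc a) j)"
        using transfer_step[of a m n q L B] 3 m by simp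
      have e': "e' a j = line_ratio n i y a j * q a j * (e' (Suc a) m + e' (Suc a) j)"
        using transfer_step[of a m n q' L' B'] 3 m q'[of j a] by simp
      define D where "D m = - of_bool (m + a = i) * p (n - a + 1) / (S (n - a) * q a (i - a + 1)) * e a (i - a)
          + of_bool (m = i) * p a / (S a * q a i) * e a (i + 1)" for m
      have "e' (Suc a) m = e (Suc a) m + D m" "e' (Suc a) j = e (Suc a) j + D j"
        using IH[of m] IH[of j] 3 m by (auto simp: D_def)
      then have master: "e' a j = line_ratio n i y a j * (e a j + q a j * (D m + D j))"
        unfolding e' e by (simp add: algebra_simps)
      have qj: "0 < q a j" using q_pos 3 by simp
      consider (P) "a + j = i + 1" | (P') "j = i" | (other) "a + j \<noteq> i + 1" "j \<noteq> i"
        by blast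
      then show ?thesis
      proof cases
        case P
        define t where "t = n - a"
        have t: "n - a = t" "n - b = Suc t" "1 \<le> t" "Suc t < n"
          using P 3 i a t_def a_def by auto
        have j: "i - a = m" "m + a = i" "m \<noteq> i" "j \<noteq> i" "j + b = i" "j + a \<noteq> i" "i - b = j"
          using P m a a_def 3 by auto
        have r: "line_ratio n i y a j = S t / S (Suc t)"
          using P 3 a t by (simp add: line_ratio_def chain_ratio_def)
        have qb: "q b (Suc j) = q b j * y (Suc t)"
          using q_top[of b] j t P a a_def 3 m by simp
        have pq: "p (Suc (Suc t)) = p (Suc t) * y (Suc t)"
          using t by (simp_all add: chain_prod_Suc)
        have eb: "e b j = q b j * (e a m + e a j)"
          using transfer_step[of b m n q L B] m 3 a_def by simp
        have pos: "0 < S t" "0 < S (Suc t)" "0 < y (Suc t)" "0 < p (Suc t)" "0 < q b j"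
          using t a 3 a_def by (auto intro!: S_pos y_pos p_pos q_pos)
        have SS: "S (Suc t) = S t + p (Suc t)" by (rule chain_sum_Suc)
        have "e' a j = S t / S (Suc t) * (e a j - p (Suc t) / S t * e a m)"
          unfolding master r using j pos qj t m
          by (simp add: D_def field_simps)
        also have "\<dots> = (S t * e a j - p (Suc t) * e a m) / S (Suc t)"
          using pos(1,2) by (simp add: field_simps)
        also have "\<dots> = e a j - p (Suc t) / S (Suc t) * (e a m + e a j)"
          using pos(2) by (simp add: SS field_simps)
        also have "\<dots> = e a j - p (Suc t) * y (Suc t) / (S (Suc t) * (q b j * y (Suc t))) * e b j"
          using pos by (simp add: eb)
        finally show ?thesis using j t pq qb by simp
      next
        case P'
        have j: "m \<noteq> i" "m + a \<noteq> i" "j + a \<noteq> i" "j + b \<noteq> i" using P' m a a_def by auto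
        have r: "line_ratio n i y a j = S a / S b"
          using P' 3 a a_def by (simp add: line_ratio_def chain_ratio_def)
        have pos: "0 < S b" "0 < S a" "0 < y b" "0 < p b" "0 < q b i"
          using a 3 a_def P' by (auto intro!: S_pos y_pos p_pos q_pos)
        have eb: "e b (i + 1) = q b i * y b * (e a i + e a (i + 1))"
          using transfer_step[of b i n q L B] q_right[of b] P' 3 a_def a by simp
        have SS: "S a = S b + p a" unfolding a_def by (rule chain_sum_Suc)
        have pa: "p a = p b * y b" using a unfolding a_def by (intro chain_prod_Suc) simp
        have "e' a j = S a / S b * (e a i + p a / S a * e a (i + 1))"
          unfolding master r using j pos qj P'
          by (simp add: D_def field_simps)
        also have "\<dots> = (S a * e a i + p a * e a (i + 1)) / S b"
          using pos(1,2) by (simp add: field_simps)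
        also have "\<dots> = e a i + p a / S b * (e a i + e a (i + 1))"
          using pos(1) by (simp add: SS field_simps)
        also have "\<dots> = e a i + p b / (S b * q b i) * e b (i + 1)"
          unfolding eb pa using pos by simp
        finally show ?thesis using j P' by simp
      next
        case other
        have "e' a j = e a j"
          by (rule unmixed_step[OF IH]) (use other a 3 in auto)
        then show ?thesis using other a_def by auto
      qed
    qed
  qed
  then show ?case unfolding a_def .
qed

text \<open>In column \<open>1\<close> both corrections affect the same position, and in column \<open>0\<close> they turn into a linear
  combination of the solutions at the two sources \<open>i\<close> and \<open>i + 1\<close>.\<close>

lemma source_change:
  assumes "1 \<le> l" "l \<le> n"
  shows "e' 0 l =
    (if l = i then S (n - 1) / p n * (q 0 i / q 0 (i + 1)) * e 0 (i + 1)
     else if l = i + 1 then (S (n - 1) / p n + 1) * e 0 (i + 1) - q 0 (i + 1) / q 0 i * e 0 i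
     else e 0 l)"
proof -
  define k where "k = S (n - 1) / p n"
  have n: "2 \<le> n" using i by simp
  have pos: "0 < S (n - 1)" "0 < p n" "0 < q 1 i" "0 < q 0 i" "0 < q 0 (i + 1)"
    using i by (auto intro!: S_pos p_pos q_pos)
  have other: "e' 1 j = e 1 j" if "j \<le> n" "j \<noteq> i" for j
  proof -
    consider "j = 0" | "j = n" | "1 \<le> j" "j < n" "j \<noteq> i" using \<open>j \<le> n\<close> \<open>j \<noteq> i\<close> by linarith
    then show ?thesis
    proof cases
      case 1
      then show ?thesis using i by (simp add: L')
    next
      case 2
      then show ?thesis using i by (simp add: transfer_bottom B')
    next
      case 3
      have "e' 1 j = e 1 j"
        by (rule unmixed_step[OF column_change]) (use 3 i in auto)
      then show ?thesis .
    qed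
  qed
  \<comment> \<open>both corrections of column \<open>2\<close> enter in position \<open>i\<close> of column \<open>1\<close>\<close>
  have mid: "e' 1 i = k * (e 1 i + e 1 (i + 1)) - e 1 (i - 1)"
  proof -
    obtain m where m: "i = Suc m" using i by (cases i) auto
    have e: "e 1 i = q 1 i * (e 2 m + e 2 i)"
      using transfer_step[of 1 m n q L B] i m by (simp add: numeral_2_eq_2)
    have e': "e' 1 i = k * q 1 i * (e' 2 m + e' 2 i)"
      using transfer_step[of 1 m n q' L' B'] i m q'[of i 1]
      by (simp add: numeral_2_eq_2 line_ratio_def k_def)
    have "e' 2 m = e 2 m - 1 / (k * q 1 i) * e 1 m"
      using column_change[of 1 m] m i by (simp add: numeral_2_eq_2 k_def)
    moreover have "e' 2 i = e 2 i + 1 / q 1 i * e 1 (i + 1)"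
      using column_change[of 1 i] m i by (simp add: numeral_2_eq_2 chain_sum_Suc)
    moreover have "0 < k" using pos by (simp add: k_def)
    ultimately show ?thesis
      unfolding e' e using m pos by (simp add: field_simps)
  qed
  obtain m where l: "l = Suc m" using assms by (cases l) auto
  have e: "e 0 l = q 0 l * (e 1 m + e 1 l)" and e': "e' 0 l = q 0 l * (e' 1 m + e' 1 l)"
    using transfer_step[of 0 m n q L B] transfer_step[of 0 m n q' L' B'] assms l q'[of l 0]
    by (simp_all add: line_ratio_def)
  have ei: "e 0 i = q 0 i * (e 1 (i - 1) + e 1 i)"
    using transfer_step[of 0 "i - 1" n q L B] i by simp
  have ei': "e 0 (i + 1) = q 0 (i + 1) * (e 1 i + e 1 (i + 1))"
    using transfer_step[of 0 i n q L B] i by simp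
  consider "l = i" | "l = i + 1" | "l \<noteq> i" "l \<noteq> i + 1" by blast
  then show ?thesis
  proof cases
    case 1
    then have "e' 0 l = q 0 i * k * (e 1 i + e 1 (i + 1))"
      unfolding e' using other[of m] mid l i 1 by (auto simp: algebra_simps)
    then show ?thesis
      using 1 pos unfolding ei' k_def[symmetric] by simp
  next
    case 2
    then have "e' 0 l = q 0 (i + 1) * (e' 1 i + e' 1 (i + 1))"
      using e' l by simp
    also have "\<dots> = q 0 (i + 1) * (k * (e 1 i + e 1 (i + 1)) - e 1 (i - 1) + e 1 (i + 1))"
      unfolding mid using other[of "i + 1"] i by simp
    finally have "e' 0 l = \<dots>" .
    then show ?thesis
      using 2 pos unfolding ei ei' k_def[symmetric] by (simp add: algebra_simps)
  next
    case 3
    then show ?thesis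
      unfolding e e' using other[of m] other[of l] l assms by simp
  qed
qed

end

definition source_mix :: "nat \<Rightarrow> (nat \<Rightarrow> real) \<Rightarrow> real" where
  "source_mix k f =
    (if k = i then S (n - 1) / p n * (q 0 i / q 0 (i + 1)) * f (i + 1)
     else if k = i + 1 then (S (n - 1) / p n + 1) * f (i + 1) - q 0 (i + 1) / q 0 i * f i
     else f k)"

lemma to_left_change:
  assumes "1 \<le> k" "k \<le> n"
  shows "to_left n q' j 0 k + of_bool (j = i) * left_mix * to_left n q' (i + 1) 0 k
    = source_mix k (to_left n q j 0)"
proof -
  have "transfer n q' (\<lambda>m. of_bool (m = j) + of_bool (j = i) * left_mix * of_bool (m = i + 1))
      (\<lambda>m. 0 + of_bool (j = i) * left_mix * 0) 0 k = source_mix k (to_left n q j 0)"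
    unfolding source_mix_def by (rule source_change) (use assms in auto)
  then show ?thesis
    unfolding transfer_linear by simp
qed

lemma to_bottom_change:
  assumes "1 \<le> k" "k \<le> n"
  shows "to_bottom n q' j 0 k + of_bool (j = i + 1) * bottom_mix * to_bottom n q' i 0 k
    = source_mix k (to_bottom n q j 0)"
proof -
  have "transfer n q' (\<lambda>m. 0 + of_bool (j = i + 1) * bottom_mix * 0) 
     (\<lambda>m. of_bool (m = j) + of_bool (j = i + 1) * bottom_mix * of_bool (m = i)) 0 k
     = source_mix k (to_bottom n q j 0)"
    unfolding source_mix_def by (rule source_change) (use assms in auto)
  then show ?thesis
    unfolding transfer_linear by simp
qed

lemma source_mix_sum:
  "source_mix k (\<lambda>m. \<Sum>j\<in>J. c j * f j m) = (\<Sum>j\<in>J. c j * source_mix k (f j))"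
  by (simp add: source_mix_def sum_distrib_left right_diff_distrib sum_subtractf mult.left_commute)

text \<open>The mixing of the sinks on the left side and on the bottom side contributes the same product with
  coefficients that add up to zero.\<close>

lemma gram_change:
  assumes R: "R i * left_mix + R (i + 1) * bottom_mix = 0"
    and kl: "1 \<le> k" "k \<le> n" "1 \<le> l" "l \<le> n"
  shows "gram n q' R k l = source_mix k (\<lambda>k'. source_mix l (gram n q R k'))"
proof -
  let ?u = "\<lambda>j. to_left n q' j 0 k" and ?v = "\<lambda>j. to_bottom n q' j 0 l"
  have "(\<Sum>j=1..n. R j * (source_mix k (to_left n q j 0) * source_mix l (to_bottom n q j 0)))
    = (\<Sum>j=1..n. R j * ((?u j + of_bool (j = i) * left_mix * ?u (i + 1)) *
         (?v j + of_bool (j = i + 1) * bottom_mix * ?v i)))"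
    by (simp only: to_left_change[OF kl(1,2)] to_bottom_change[OF kl(3,4)])
  also have "\<dots> = (\<Sum>j=1..n. ?u j * (R j * ?v j))
     + (\<Sum>j=1..n. if j = i then R i * left_mix * ?u (i + 1) * ?v i else 0)
     + (\<Sum>j=1..n. if j = i + 1 then R (i + 1) * bottom_mix * ?u (i + 1) * ?v i else 0)"
    unfolding sum.distrib[symmetric] by (rule sum.cong) (auto simp: algebra_simps)
  also have "\<dots> = (\<Sum>j=1..n. ?u j * (R j * ?v j))
     + (R i * left_mix + R (i + 1) * bottom_mix) * ?u (i + 1) * ?v i"
    using i by (simp add: sum.delta algebra_simps)
  finally have "gram n q' R k l =
      (\<Sum>j=1..n. R j * (source_mix k (to_left n q j 0) * source_mix l (to_bottom n q j 0)))"
    unfolding R by (simp add: gram_def)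
  also have "\<dots> = (\<Sum>j=1..n. R j * source_mix l (to_bottom n q j 0) * source_mix k (to_left n q j 0))"
    by (simp add: ac_simps)
  also have "\<dots> = source_mix k (\<lambda>k'. \<Sum>j=1..n. R j * source_mix l (to_bottom n q j 0) * to_left n q j 0 k')"
    by (simp only: source_mix_sum)
  also have "\<dots> = source_mix k (\<lambda>k'. \<Sum>j=1..n. to_left n q j 0 k' * R j * source_mix l (to_bottom n q j 0))"
    by (simp add: ac_simps)
  also have "\<dots> = source_mix k (\<lambda>k'. source_mix l (gram n q R k'))"
  proof -
    have "gram n q R k' = (\<lambda>l'. \<Sum>j=1..n. to_left n q j 0 k' * R j * to_bottom n q j 0 l')" for k'
      by (simp add: gram_def fun_eq_iff mult.assoc)
    then show ?thesis by (simp only: source_mix_sum)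
  qed
  finally show ?thesis .
qed

end

section \<open>The quiver near a line\<close>

lemma num_half_arrows_eq:
  assumes "a + b + c = n" "a' + b' + c' = n"
  shows "num_half_arrows n (a, b, c) (a', b', c') =
     of_bool (a = a' + 1 \<and> b = b') * (1 + of_bool (1 \<le> b))
   + of_bool (a = a' \<and> b' = b + 1) * (1 + of_bool (1 \<le> a))
   + of_bool (a' = a + 1 \<and> b = b' + 1) * (1 + of_bool (1 \<le> c))"
proof -
  let ?up = "{(a0, b0, c0). a0 + b0 + c0 + 1 = n \<and> ((a, b, c), (a', b', c')) \<in> up_arrows (a0, b0, c0)}"
  let ?down = "{(a0, b0, c0). a0 + b0 + c0 + 2 = n \<and> ((a, b, c), (a', b', c')) \<in> down_arrows (a0, b0, c0)}"
  have up: "?up = {u. \<exists>a0 b0 c0. u = (a0, b0, c0) \<and> a0 + b0 + c0 + 1 = n \<and>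
      (a = a0 + 1 \<and> b = b0 \<and> a' = a0 \<and> b' = b0 \<or> a = a0 \<and> b = b0 \<and> a' = a0 \<and> b' = b0 + 1
       \<or> a = a0 \<and> b = b0 + 1 \<and> a' = a0 + 1 \<and> b' = b0)}"
    using assms by fastforce
  have down: "?down = {u. \<exists>a0 b0 c0. u = (a0, b0, c0) \<and> a0 + b0 + c0 + 2 = n \<and>
      (a = a0 + 1 \<and> b = b0 \<and> a' = a0 + 1 \<and> b' = b0 + 1 \<or> a = a0 + 1 \<and> b = b0 + 1 \<and> a' = a0 \<and> b' = b0 + 1
       \<or> a = a0 \<and> b = b0 + 1 \<and> a' = a0 + 1 \<and> b' = b0)}"
    using assms by fastforce
  consider (1) "a = a' + 1" "b = b'" | (2) "a = a'" "b' = b + 1" | (3) "a' = a + 1" "b = b' + 1"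
    | (4) "\<not> (a = a' + 1 \<and> b = b')" "\<not> (a = a' \<and> b' = b + 1)" "\<not> (a' = a + 1 \<and> b = b' + 1)"
    by blast
  then show ?thesis
  proof cases
    case 1
    then have "?up = {(a', b, c)}" "?down = (if b = 0 then {} else {(a', b - 1, c)})"
      unfolding up down using assms by auto
    then show ?thesis unfolding num_half_arrows_def using 1 by simp
  next
    case 2
    then have "?up = {(a, b, c')}" "?down = (if a = 0 then {} else {(a - 1, b, c')})"
      unfolding up down using assms by auto
    then show ?thesis unfolding num_half_arrows_def using 2 by simp
  next
    case 3
    then have "?up = {(a, b', c)}" "?down = (if c = 0 then {} else {(a, b', c - 1)})"
      unfolding up down using assms by auto
    then show ?thesis unfolding num_half_arrows_def using 3 by simp
  next
    case 4
    have "u \<notin> ?up" for u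
    proof
      assume "u \<in> ?up"
      then obtain a0 b0 where "a = a0 + 1 \<and> b = b0 \<and> a' = a0 \<and> b' = b0
        \<or> a = a0 \<and> b = b0 \<and> a' = a0 \<and> b' = b0 + 1 \<or> a = a0 \<and> b = b0 + 1 \<and> a' = a0 + 1 \<and> b' = b0"
        unfolding up by blast
      then show False using 4 by (elim disjE) simp_all
    qed
    then have up0: "?up = {}" by blast
    have "u \<notin> ?down" for u
    proof
      assume "u \<in> ?down"
      then obtain a0 b0 where "a = a0 + 1 \<and> b = b0 \<and> a' = a0 + 1 \<and> b' = b0 + 1
        \<or> a = a0 + 1 \<and> b = b0 + 1 \<and> a' = a0 \<and> b' = b0 + 1 \<or> a = a0 \<and> b = b0 + 1 \<and> a' = a0 + 1 \<and> b' = b0"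
        unfolding down by blast
      then show False using 4 by (elim disjE) simp_all
    qed
    then have down0: "?down = {}" by blast
    have "(a = a' + 1 \<and> b = b') = False" "(a = a' \<and> b' = b + 1) = False" "(a' = a + 1 \<and> b = b' + 1) = False"
      using 4 by blast+
    then show ?thesis unfolding num_half_arrows_def up0 down0 by simp
  qed
qed

definition side_weight :: "nat \<Rightarrow> real" where
  "side_weight b = (if b = 0 then 1 / 2 else 1)"

text \<open>An arrow between neighbouring faces consists of two half-arrows, unless both faces lie on the same
  side of the triangle.\<close>

lemma face_form_eq:
  assumes "a + b + c = n" "a' + b' + c' = n"
  shows "face_form n (a, b, c) (a', b', c') =
     side_weight b * (of_bool (a = a' + 1 \<and> b = b') - of_bool (a' = a + 1 \<and> b = b'))
   + side_weight a * (of_bool (a = a' \<and> b' = b + 1) - of_bool (a = a' \<and> b = b' + 1))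
   + side_weight c * (of_bool (a' = a + 1 \<and> b = b' + 1) - of_bool (a = a' + 1 \<and> b' = b + 1))"
proof -
  consider (1) "a = a' + 1" "b = b'" | (2) "a' = a + 1" "b = b'" | (3) "a = a'" "b' = b + 1" | (4) "a = a'" "b = b' + 1"
    | (5) "a' = a + 1" "b = b' + 1" | (6) "a = a' + 1" "b' = b + 1"
    | (7) "\<not> (a = a' + 1 \<and> b = b')" "\<not> (a' = a + 1 \<and> b = b')" "\<not> (a = a' \<and> b' = b + 1)" 
      "\<not> (a = a' \<and> b = b' + 1)" "\<not> (a' = a + 1 \<and> b = b' + 1)" "\<not> (a = a' + 1 \<and> b' = b + 1)"
    by blast
  note cases = this
  have "face_form n (a, b, c) (a', b', c') =
    (real (of_bool (a = a' + 1 \<and> b = b') * (1 + of_bool (1 \<le> b))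
      + of_bool (a = a' \<and> b' = b + 1) * (1 + of_bool (1 \<le> a))
      + of_bool (a' = a + 1 \<and> b = b' + 1) * (1 + of_bool (1 \<le> c)))
    - real (of_bool (a' = a + 1 \<and> b' = b) * (1 + of_bool (1 \<le> b'))
      + of_bool (a' = a \<and> b = b' + 1) * (1 + of_bool (1 \<le> a'))
      + of_bool (a = a' + 1 \<and> b' = b + 1) * (1 + of_bool (1 \<le> c')))) / 2"
    unfolding face_form_def num_half_arrows_eq[OF assms] num_half_arrows_eq[OF assms(2,1)] ..
  note form = this
  from cases show ?thesis
  proof cases
    case 7
    then have F: "(a = a' + 1 \<and> b = b') = False" "(a' = a + 1 \<and> b = b') = False"
      "(a = a' \<and> b' = b + 1) = False" "(a = a' \<and> b = b' + 1) = False"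
      "(a' = a + 1 \<and> b = b' + 1) = False" "(a = a' + 1 \<and> b' = b + 1) = False"
      by blast+
    have F': "(a' = a + 1 \<and> b' = b) = False" "(a' = a \<and> b = b' + 1) = False"
      using 7(2,4) by blast+
    show ?thesis
      unfolding form F F' of_bool_eq(1) by simp
  qed (unfold form, use assms in \<open>simp_all add: side_weight_def\<close>)
qed

lemma A_quiver_antisym: "A_quiver n v u = - A_quiver n u v"
proof -
  have anti: "face_form n \<alpha> \<beta> = - face_form n \<beta> \<alpha>" for \<alpha> \<beta>
    unfolding face_form_def by (simp add: diff_divide_distrib)
  have "(\<Sum>\<alpha>\<in>constituents n v. \<Sum>\<beta>\<in>constituents n u. face_form n \<alpha> \<beta>)
    = (\<Sum>\<alpha>\<in>constituents n v. \<Sum>\<beta>\<in>constituents n u. - face_form n \<beta> \<alpha>)"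
    by (intro sum.cong refl) (rule anti)
  also have "\<dots> = - (\<Sum>\<alpha>\<in>constituents n v. \<Sum>\<beta>\<in>constituents n u. face_form n \<beta> \<alpha>)"
    by (simp only: sum_negf)
  also have "(\<Sum>\<alpha>\<in>constituents n v. \<Sum>\<beta>\<in>constituents n u. face_form n \<beta> \<alpha>)
    = (\<Sum>\<beta>\<in>constituents n u. \<Sum>\<alpha>\<in>constituents n v. face_form n \<beta> \<alpha>)"
    by (rule sum.swap)
  finally have "(\<Sum>\<alpha>\<in>constituents n v. \<Sum>\<beta>\<in>constituents n u. face_form n \<alpha> \<beta>)
    = - (\<Sum>\<beta>\<in>constituents n u. \<Sum>\<alpha>\<in>constituents n v. face_form n \<beta> \<alpha>)" .
  note swap = this
  show ?thesis
  proof (cases "u \<in> vertices n \<and> v \<in> vertices n")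
    case True
    then show ?thesis unfolding A_quiver_def using swap by presburger
  next
    case False
    then show ?thesis unfolding A_quiver_def by auto
  qed
qed

lemma A_quiver_Inner_Inner:
  assumes "a + b + c = n" "1 \<le> a" "1 \<le> b" "1 \<le> c" "a' + b' + c' = n" "1 \<le> a'" "1 \<le> b'" "1 \<le> c'"
  shows "A_quiver n (Inner a b c) (Inner a' b' c') =
     of_bool (a = a' + 1 \<and> b = b') - of_bool (a' = a + 1 \<and> b = b')
   + of_bool (a = a' \<and> b' = b + 1) - of_bool (a = a' \<and> b = b' + 1)
   + of_bool (a' = a + 1 \<and> b = b' + 1) - of_bool (a = a' + 1 \<and> b' = b + 1)"
proof -
  have "A_quiver n (Inner a b c) (Inner a' b' c') = face_form n (a, b, c) (a', b', c')"
    using assms by (simp add: A_quiver_def)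
  moreover have "side_weight a = 1" "side_weight b = 1" "side_weight c = 1"
    using assms by (simp_all add: side_weight_def)
  ultimately show ?thesis
    unfolding face_form_eq[OF assms(1,5)] by (simp only: mult_1_left)
qed

lemma A_quiver_Inner_Merged:
  assumes "a + b + c = n" "1 \<le> a" "1 \<le> b" "1 \<le> c" "1 \<le> k" "k < n"
  shows "A_quiver n (Inner a b c) (Merged k) =
     of_bool (k = a + 1 \<and> b = 1) - of_bool (a = k \<and> b = 1)
   + of_bool (c = 1 \<and> k = b + 1) - of_bool (c = 1 \<and> b = k)"
proof -
  define r where "r = n - k"
  have r: "k + 0 + r = n" "r + k + 0 = n" using assms by (simp_all add: r_def)
  have w: "side_weight a = 1" "side_weight b = 1" "side_weight c = 1"
    using assms by (simp_all add: side_weight_def)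
  have "(k, 0, r) \<noteq> (r, k, 0)" using assms by auto
  then have "A_quiver n (Inner a b c) (Merged k) = face_form n (a, b, c) (k, 0, r) + face_form n (a, b, c) (r, k, 0)"
    using assms by (simp add: A_quiver_def r_def)
  also have "face_form n (a, b, c) (k, 0, r) = of_bool (k = a + 1 \<and> b = 1) - of_bool (a = k \<and> b = 1)"
    unfolding face_form_eq[OF assms(1) r(1)] w using assms(3) by simp
  also have "face_form n (a, b, c) (r, k, 0) = of_bool (c = 1 \<and> k = b + 1) - of_bool (c = 1 \<and> b = k)"
  proof -
    have "(a = r + 1 \<and> b = k) = False" "(r = a + 1 \<and> b = k) = (c = 1 \<and> b = k)"
      "(a = r \<and> k = b + 1) = (c = 1 \<and> k = b + 1)" "(a = r \<and> b = k + 1) = False"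
      "(r = a + 1 \<and> b = k + 1) = False" "(a = r + 1 \<and> k = b + 1) = False"
      using assms(1,4) r by (intro iffI conjI; (elim conjE)?; (linarith | blast))+
    note eqs = this
    show ?thesis unfolding face_form_eq[OF assms(1) r(2)] w eqs by simp
  qed
  finally show ?thesis by simp
qed

lemma A_quiver_Merged_Merged:
  assumes "1 \<le> i" "i < n" "1 \<le> k" "k < n"
  shows "A_quiver n (Merged i) (Merged k) =
     of_bool (i = k + 1) - of_bool (k = i + 1)
   + of_bool (i + 1 = n \<and> k = 1) - of_bool (i = 1 \<and> k + 1 = n)"
proof -
  define r j where "r = n - k" and "j = n - i"
  have r: "k + 0 + r = n" "r + k + 0 = n" "1 \<le> r" using assms by (simp_all add: r_def)
  have j: "i + 0 + j = n" "j + i + 0 = n" "1 \<le> j" using assms by (simp_all add: j_def)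
  have le: "i \<le> n - 1" "k \<le> n - 1" using assms by simp_all
  have w: "side_weight i = 1" "side_weight j = 1" "side_weight 0 = 1 / 2"
    using assms j by (simp_all add: side_weight_def)
  have "(k, 0, r) \<noteq> (r, k, 0)" "(i, 0, j) \<noteq> (j, i, 0)" using assms by auto
  then have "A_quiver n (Merged i) (Merged k) =
     face_form n (i, 0, j) (k, 0, r) + face_form n (i, 0, j) (r, k, 0)
   + (face_form n (j, i, 0) (k, 0, r) + face_form n (j, i, 0) (r, k, 0))"
    using \<open>1 \<le> i\<close> \<open>1 \<le> k\<close> le by (simp add: A_quiver_def r_def j_def)
  also have "face_form n (i, 0, j) (k, 0, r) = (of_bool (i = k + 1) - of_bool (k = i + 1)) / 2"
    unfolding face_form_eq[OF j(1) r(1)] w by simp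
  also have "face_form n (i, 0, j) (r, k, 0) = of_bool (i + 1 = n \<and> k = 1)"
  proof -
    have "(i = r + 1 \<and> 0 = k) = False" "(r = i + 1 \<and> 0 = k) = False" "(i = r \<and> k = 0 + 1) = (i + 1 = n \<and> k = 1)"
      "(i = r \<and> 0 = k + 1) = False" "(r = i + 1 \<and> 0 = k + 1) = False" "(i = r + 1 \<and> k = 0 + 1) = False"
      using assms r j by (intro iffI conjI; (elim conjE)?; (linarith | blast))+
    note eqs = this
    show ?thesis unfolding face_form_eq[OF j(1) r(2)] w eqs by simp
  qed
  also have "face_form n (j, i, 0) (k, 0, r) = - of_bool (i = 1 \<and> k + 1 = n)"
  proof -
    have "(j = k + 1 \<and> i = 0) = False" "(k = j + 1 \<and> i = 0) = False" "(j = k \<and> 0 = i + 1) = False"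
      "(j = k \<and> i = 0 + 1) = (i = 1 \<and> k + 1 = n)" "(k = j + 1 \<and> i = 0 + 1) = False" "(j = k + 1 \<and> 0 = i + 1) = False"
      using assms r j by (intro iffI conjI; (elim conjE)?; (linarith | blast))+
    note eqs = this
    show ?thesis unfolding face_form_eq[OF j(2) r(1)] w eqs by simp
  qed
  also have "face_form n (j, i, 0) (r, k, 0) = (of_bool (i = k + 1) - of_bool (k = i + 1)) / 2"
  proof -
    have "(j = r + 1 \<and> i = k) = False" "(r = j + 1 \<and> i = k) = False" "(j = r \<and> k = i + 1) = False"
      "(j = r \<and> i = k + 1) = False" "(r = j + 1 \<and> i = k + 1) = (i = k + 1)" "(j = r + 1 \<and> k = i + 1) = (k = i + 1)"
      using assms r j by (intro iffI conjI; (elim conjE)?; (linarith | blast))+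
    note eqs = this
    show ?thesis unfolding face_form_eq[OF j(2) r(2)] w eqs by simp
  qed
  finally show ?thesis by simp
qed

text \<open>The number of triangles which the edge between \<open>y\<^sub>t\<close> and \<open>y\<^bsub>t+1\<^esub>\<close> spans with a vertex: \<open>y\<^sub>t\<close> has an arrow to
  such a vertex and \<open>y\<^bsub>t+1\<^esub>\<close> has an arrow from it. A vertex off the line may count for
  two edges: it lies on two of the zigzags, and these can be the two neighbours of the \<open>i\<close>-th line.\<close>

fun line_neighbour :: "nat \<Rightarrow> nat \<Rightarrow> nat \<Rightarrow> vertex \<Rightarrow> nat" where
  "line_neighbour n i t (Inner a b c) =
     of_bool (b = i + 1 \<and> a = t) + of_bool (b + 1 = i \<and> a = t + 1)
   + of_bool (c + i + 1 = n \<and> a + t = n) + of_bool (c + i = n + 1 \<and> a + t + 1 = n)"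
| "line_neighbour n i t (Merged k) =
     of_bool (k = i + 1 \<and> t + i + 1 = n) + of_bool (k + 1 = i \<and> t + i = n)
   + of_bool (i = 1 \<and> k = t + 1) + of_bool (i + 1 = n \<and> k = t)"

definition line_mult :: "nat \<Rightarrow> nat \<Rightarrow> vertex \<Rightarrow> nat \<Rightarrow> real" where
  "line_mult n i v t = (if 1 \<le> t \<and> t + 2 \<le> n then real (line_neighbour n i t v) else 0)"

lemma line_vertex_in:
  assumes "1 \<le> i" "i < n" "1 \<le> t" "t < n"
  shows "line_vertex n i t \<in> vertices n"
proof -
  consider "t < n - i" | "t = n - i" | "n - i < t" by linarith
  then show ?thesis by cases (use assms in \<open>auto simp add: line_vertex_def\<close>)
qed

lemma line_vertex_inj:
  assumes "1 \<le> i" "i < n"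
  shows "inj_on (line_vertex n i) {1..<n}"
proof (rule inj_on_inverseI)
  fix t assume t: "t \<in> {1..<n}"
  let ?g = "\<lambda>v. case v of Inner a b c \<Rightarrow> if b = i then a else n - a | Merged k \<Rightarrow> n - k"
  consider "t < n - i" | "t = n - i" | "n - i < t" by linarith
  then show "?g (line_vertex n i t) = t"
    by cases (use assms t in \<open>simp_all add: line_vertex_def\<close>)
qed

lemma off_line:
  assumes "1 \<le> i" "i < n" "v \<in> vertices n" "v \<notin> line_vertex n i ` {1..<n}"
  shows "v = Inner a b c \<Longrightarrow> a + b + c = n \<and> 1 \<le> a \<and> 1 \<le> b \<and> 1 \<le> c \<and> b \<noteq> i \<and> c + i \<noteq> n"
    and "v = Merged k \<Longrightarrow> 1 \<le> k \<and> k < n \<and> k \<noteq> i"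
proof -
  assume v: "v = Inner a b c"
  then have abc: "a + b + c = n" "1 \<le> a" "1 \<le> b" "1 \<le> c" using assms(3) by (auto simp: vertices_def)
  have "b \<noteq> i"
  proof
    assume "b = i"
    then have "a < n - i" "c = n - i - a" "a \<in> {1..<n}" using abc by auto
    then have "v = line_vertex n i a" "a \<in> {1..<n}" using v \<open>b = i\<close> by (simp_all add: line_vertex_def)
    then show False using assms(4) by blast
  qed
  moreover have "c \<noteq> n - i"
  proof
    assume "c = n - i"
    then have "\<not> n - a < n - i" "n - a \<noteq> n - i" "n - (n - a) = a" "n - a - (n - i) = b" "n - a \<in> {1..<n}"
      using abc assms(1,2) by auto
    then have "v = line_vertex n i (n - a)" "n - a \<in> {1..<n}" using v \<open>c = n - i\<close> by (simp_all add: line_vertex_def)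
    then show False using assms(4) by blast
  qed
  ultimately show "a + b + c = n \<and> 1 \<le> a \<and> 1 \<le> b \<and> 1 \<le> c \<and> b \<noteq> i \<and> c + i \<noteq> n" using abc assms(2) by auto
next
  assume v: "v = Merged k"
  then have k: "1 \<le> k" "k < n" using assms(2,3) by (auto simp: vertices_def)
  have "k \<noteq> i"
  proof
    assume "k = i"
    then have "v = line_vertex n i (n - i)" "n - i \<in> {1..<n}" using v assms(1,2) by (simp_all add: line_vertex_def)
    then show False using assms(4) by blast
  qed
  then show "1 \<le> k \<and> k < n \<and> k \<noteq> i" using k by simp
qed

lemma line_mult_off_line:
  assumes i: "1 \<le> i" "i < n" and v: "v \<in> vertices n" "v \<notin> line_vertex n i ` {1..<n}" and "t + 2 \<le> n"
  shows "line_mult n i v t = real (line_neighbour n i t v)"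
proof (cases "t = 0")
  case True
  have "line_neighbour n i 0 v = 0"
  proof (cases v)
    case (Inner a b c)
    note abc = off_line(1)[OF i v Inner]
    have "(b = i + 1 \<and> a = 0) = False" "(b + 1 = i \<and> a = 0 + 1) = False"
      "(c + i + 1 = n \<and> a + 0 = n) = False" "(c + i = n + 1 \<and> a + 0 + 1 = n) = False"
      using abc i by (intro iffI conjI; (elim conjE)?; (linarith | blast))+
    then show ?thesis unfolding Inner line_neighbour.simps by simp
  next
    case (Merged k)
    note k = off_line(2)[OF i v Merged]
    have "(k = i + 1 \<and> 0 + i + 1 = n) = False" "(k + 1 = i \<and> 0 + i = n) = False"
      "(i = 1 \<and> k = 0 + 1) = False" "(i + 1 = n \<and> k = 0) = False"
      using k i by (intro iffI conjI; (elim conjE)?; (linarith | blast))+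
    then show ?thesis unfolding Merged line_neighbour.simps by simp
  qed
  then show ?thesis using True by (simp add: line_mult_def)
next
  case False
  then show ?thesis using assms(5) by (simp add: line_mult_def)
qed

text \<open>The arrows between the line and a vertex off the line all come from the triangles counted
  by \<open>line_neighbour\<close>; each of them adds one outgoing and one incoming arrow at
  consecutive vertices of the line.\<close>

lemma A_quiver_off_line:
  assumes i: "1 \<le> i" "i < n" and v: "v \<in> vertices n" "v \<notin> line_vertex n i ` {1..<n}"
    and s: "1 \<le> s" "s + 2 \<le> n"
  shows "A_quiver n (line_vertex n i s) v = line_mult n i v s - line_mult n i v (s - 1)"
proof -
  obtain r where r: "s = r + 1" using s(1) by (cases s) auto
  have m: "line_mult n i v s - line_mult n i v (s - 1) = real (line_neighbour n i (r + 1) v) - real (line_neighbour n i r v)"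
    using line_mult_off_line[OF i v, of s] line_mult_off_line[OF i v, of r] s r by simp
  show ?thesis
  proof (cases v)
    case (Inner a b c)
    note abc = off_line(1)[OF i v Inner]
    then have sum: "a + b + c = n" "1 \<le> a" "1 \<le> b" "1 \<le> c" by auto
    consider "s < n - i" | "s = n - i" | "n - i < s" by linarith
    then show ?thesis
    proof cases
      case 1
      define c0 where "c0 = n - i - s"
      have L: "line_vertex n i s = Inner (r + 1) i c0"
        using 1 by (simp add: line_vertex_def r c0_def)
      have sum0: "r + 1 + i + c0 = n" "1 \<le> r + 1" "1 \<le> i" "1 \<le> c0"
        using 1 i r by (simp_all add: c0_def)
      have less: "r + 1 + i < n" using 1 r by simp
      have "(r + 1 = a + 1 \<and> i = b) = False" "(a = r + 1 + 1 \<and> i = b) = False"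
        "(r + 1 = a \<and> b = i + 1) = (b = i + 1 \<and> a = r + 1)" "(r + 1 = a \<and> i = b + 1) = (b + 1 = i \<and> a = r + 1)"
        "(a = r + 1 + 1 \<and> i = b + 1) = (b + 1 = i \<and> a = r + 1 + 1)" "(r + 1 = a + 1 \<and> b = i + 1) = (b = i + 1 \<and> a = r)"
        "(c + i + 1 = n \<and> a + (r + 1) = n) = False" "(c + i = n + 1 \<and> a + (r + 1) + 1 = n) = False"
        "(c + i + 1 = n \<and> a + r = n) = False" "(c + i = n + 1 \<and> a + r + 1 = n) = False"
        using abc i less by (intro iffI conjI; (elim conjE)?; (linarith | blast))+
      note eqs = this
      have "A_quiver n (Inner (r + 1) i c0) (Inner a b c) =
        real (line_neighbour n i (r + 1) (Inner a b c)) - real (line_neighbour n i r (Inner a b c))"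
        unfolding A_quiver_Inner_Inner[OF sum0 sum] line_neighbour.simps eqs by simp
      then show ?thesis unfolding m L unfolding Inner .
    next
      case 2
      then have L: "line_vertex n i s = Merged i"
        by (simp add: line_vertex_def)
      have mid: "r + 1 + i = n" using 2 r i by simp
      have "(i = a + 1 \<and> b = 1) = False" "(c = 1 \<and> b = i) = False"
        "(b = i + 1 \<and> a = r + 1) = False" "(b + 1 = i \<and> a = r + 1 + 1) = False"
        "(c + i + 1 = n \<and> a + (r + 1) = n) = (a = i \<and> b = 1)" "(c + i = n + 1 \<and> a + (r + 1) + 1 = n) = False"
        "(b = i + 1 \<and> a = r) = False" "(b + 1 = i \<and> a = r + 1) = (c = 1 \<and> i = b + 1)"
        "(c + i + 1 = n \<and> a + r = n) = False" "(c + i = n + 1 \<and> a + r + 1 = n) = False"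
        using abc i mid by (intro iffI conjI; (elim conjE)?; (linarith | blast))+
      note eqs = this
      have "A_quiver n (Merged i) (Inner a b c) = 
        real (line_neighbour n i (r + 1) (Inner a b c)) - real (line_neighbour n i r (Inner a b c))"
        unfolding A_quiver_antisym[of n "Merged i"] A_quiver_Inner_Merged[OF sum i] line_neighbour.simps eqs by simp
      then show ?thesis unfolding m L unfolding Inner .
    next
      case 3
      define a0 b0 c0 where "a0 = n - s" and "b0 = s - (n - i)" and "c0 = n - i"
      have L: "line_vertex n i s = Inner a0 b0 c0"
        using 3 by (simp add: line_vertex_def a0_def b0_def c0_def)
      have sum0: "a0 + b0 + c0 = n" "1 \<le> a0" "1 \<le> b0" "1 \<le> c0" "a0 + r + 1 = n" "c0 + i = n"
        using 3 s i r by (simp_all add: a0_def b0_def c0_def)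
      have "(a0 = a + 1 \<and> b0 = b) = (c + i = n + 1 \<and> a + (r + 1) + 1 = n)"
        "(a = a0 + 1 \<and> b0 = b) = (c + i + 1 = n \<and> a + r = n)"
        "(a0 = a \<and> b = b0 + 1) = (c + i + 1 = n \<and> a + (r + 1) = n)"
        "(a0 = a \<and> b0 = b + 1) = (c + i = n + 1 \<and> a + r + 1 = n)"
        "(a = a0 + 1 \<and> b0 = b + 1) = False" "(a0 = a + 1 \<and> b = b0 + 1) = False"
        "(b = i + 1 \<and> a = r + 1) = False" "(b + 1 = i \<and> a = r + 1 + 1) = False"
        "(b = i + 1 \<and> a = r) = False" "(b + 1 = i \<and> a = r + 1) = False"
        using abc i sum0 by (intro iffI conjI; (elim conjE)?; (linarith | blast))+
      note eqs = this
      have "A_quiver n (Inner a0 b0 c0) (Inner a b c) = 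
        real (line_neighbour n i (r + 1) (Inner a b c)) - real (line_neighbour n i r (Inner a b c))"
        unfolding A_quiver_Inner_Inner[OF sum0(1-4) sum] line_neighbour.simps eqs by simp
      then show ?thesis unfolding m L unfolding Inner .
    qed
  next
    case (Merged k)
    note k = off_line(2)[OF i v Merged]
    then have k1: "1 \<le> k" "k < n" by auto
    consider "s < n - i" | "s = n - i" | "n - i < s" by linarith
    then show ?thesis
    proof cases
      case 1
      define c0 where "c0 = n - i - s"
      have L: "line_vertex n i s = Inner (r + 1) i c0"
        using 1 by (simp add: line_vertex_def r c0_def)
      have sum0: "r + 1 + i + c0 = n" "1 \<le> r + 1" "1 \<le> i" "1 \<le> c0"
        using 1 i r by (simp_all add: c0_def)
      have less: "r + 1 + i < n" and c0: "c0 + (r + 1) + i = n" using 1 r by (simp_all add: c0_def)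
      have "(k = r + 1 + 1 \<and> i = 1) = (i = 1 \<and> k = r + 1 + 1)" "(r + 1 = k \<and> i = 1) = (i = 1 \<and> k = r + 1)"
        "(c0 = 1 \<and> k = i + 1) = (k = i + 1 \<and> r + 1 + i + 1 = n)" "(c0 = 1 \<and> i = k) = False"
        "(k + 1 = i \<and> r + 1 + i = n) = False" "(i + 1 = n \<and> k = r + 1) = False"
        "(k = i + 1 \<and> r + i + 1 = n) = False" "(k + 1 = i \<and> r + i = n) = False" "(i + 1 = n \<and> k = r) = False"
        using k i less sum0(4) c0 by (intro iffI conjI; (elim conjE)?; (linarith | blast))+
      note eqs = this
      have "A_quiver n (Inner (r + 1) i c0) (Merged k) = 
        real (line_neighbour n i (r + 1) (Merged k)) - real (line_neighbour n i r (Merged k))"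
        unfolding A_quiver_Inner_Merged[OF sum0 k1] line_neighbour.simps eqs by simp
      then show ?thesis unfolding m L unfolding Merged .
    next
      case 2
      then have L: "line_vertex n i s = Merged i"
        by (simp add: line_vertex_def)
      have mid: "r + 1 + i = n" using 2 r i by simp
      have "(k = i + 1 \<and> r + 1 + i + 1 = n) = False" "(k + 1 = i \<and> r + 1 + i = n) = (i = k + 1)"
        "(i = 1 \<and> k = r + 1 + 1) = False" "(i + 1 = n \<and> k = r + 1) = (i + 1 = n \<and> k = 1)"
        "(k = i + 1 \<and> r + i + 1 = n) = (k = i + 1)" "(k + 1 = i \<and> r + i = n) = False"
        "(i = 1 \<and> k = r + 1) = (i = 1 \<and> k + 1 = n)" "(i + 1 = n \<and> k = r) = False"
        using k i mid by (intro iffI conjI; (elim conjE)?; (linarith | blast))+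
      note eqs = this
      have "A_quiver n (Merged i) (Merged k) = 
        real (line_neighbour n i (r + 1) (Merged k)) - real (line_neighbour n i r (Merged k))"
        unfolding A_quiver_Merged_Merged[OF i k1] line_neighbour.simps eqs by simp
      then show ?thesis unfolding m L unfolding Merged .
    next
      case 3
      define a0 b0 c0 where "a0 = n - s" and "b0 = s - (n - i)" and "c0 = n - i"
      have L: "line_vertex n i s = Inner a0 b0 c0"
        using 3 by (simp add: line_vertex_def a0_def b0_def c0_def)
      have sum0: "a0 + b0 + c0 = n" "1 \<le> a0" "1 \<le> b0" "1 \<le> c0" "a0 + r + 1 = n" "c0 + i = n"
        using 3 s i r by (simp_all add: a0_def b0_def c0_def)
      have "(k = a0 + 1 \<and> b0 = 1) = False" "(a0 = k \<and> b0 = 1) = (k + 1 = i \<and> r + i = n)"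
        "(c0 = 1 \<and> k = b0 + 1) = (i + 1 = n \<and> k = r + 1)" "(c0 = 1 \<and> b0 = k) = (i + 1 = n \<and> k = r)"
        "(k = i + 1 \<and> r + 1 + i + 1 = n) = False" "(k + 1 = i \<and> r + 1 + i = n) = False"
        "(i = 1 \<and> k = r + 1 + 1) = False" "(k = i + 1 \<and> r + i + 1 = n) = False" "(i = 1 \<and> k = r + 1) = False"
        using k i sum0 by (intro iffI conjI; (elim conjE)?; (linarith | blast))+
      note eqs = this
      have "A_quiver n (Inner a0 b0 c0) (Merged k) = 
        real (line_neighbour n i (r + 1) (Merged k)) - real (line_neighbour n i r (Merged k))"
        unfolding A_quiver_Inner_Merged[OF sum0(1-4) k1] line_neighbour.simps eqs by simp
      then show ?thesis unfolding m L unfolding Merged .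
    qed
  qed
qed

text \<open>Apart from the chain \<open>y\<^bsub>n-1\<^esub> \<rightarrow> \<dots> \<rightarrow> y\<^sub>1\<close> there is an arrow \<open>y\<^bsub>n-1\<^esub> \<rightarrow> y\<^sub>1\<close>, because the first and the last
  vertex of the line are neighbours.\<close>

lemma A_quiver_line:
  assumes n: "3 \<le> n" and i: "1 \<le> i" "i < n" and s: "1 \<le> s" "t < n" and le: "s \<le> t"
  shows "A_quiver n (line_vertex n i s) (line_vertex n i t) =
    - of_bool (t = s + 1) - of_bool (s = 1 \<and> t = n - 1)"
proof -
  have left: "line_vertex n i t = Inner (n - t) (t - (n - i)) (n - i)" "n - t + (t - (n - i)) + (n - i) = n"
    "1 \<le> n - t" "1 \<le> t - (n - i)" "1 \<le> n - i" if "n - i < t" "t < n" for t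
    using that i by (simp_all add: line_vertex_def)
  have right: "line_vertex n i t = Inner t i (n - i - t)" "t + i + (n - i - t) = n" "1 \<le> n - i - t" if "t < n - i" for t
    using that i by (simp_all add: line_vertex_def)
  have mid: "line_vertex n i (n - i) = Merged i" by (simp add: line_vertex_def)
  consider "t < n - i" | "s < n - i" "t = n - i" | "s < n - i" "n - i < t" | "s = n - i" "t = n - i"
    | "s = n - i" "n - i < t" | "n - i < s" using le by linarith
  then show ?thesis
  proof cases
    case 1
    define c0 c1 where "c0 = n - i - s" and "c1 = n - i - t"
    have sum0: "s + i + c0 = n" "1 \<le> c0" "line_vertex n i s = Inner s i c0"
      and sum1: "t + i + c1 = n" "1 \<le> t" "1 \<le> c1" "line_vertex n i t = Inner t i c1"
      using right[of s] right[of t] 1 s le by (simp_all add: c0_def c1_def)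
    have "(s = t + 1 \<and> i = i) = False" "(t = s + 1 \<and> i = i) = (t = s + 1)"
      "(s = t \<and> i = i + 1) = False" "(t = s + 1 \<and> i = i + 1) = False" "(s = t + 1 \<and> i = i + 1) = False"
      "(s = 1 \<and> t = n - 1) = False"
      using sum1(1-3) s i le by (intro iffI conjI; (elim conjE)?; (linarith | blast))+
    note eqs = this
    show ?thesis
      unfolding sum0(3) sum1(4) A_quiver_Inner_Inner[OF sum0(1) s(1) i(1) sum0(2) sum1(1,2) i(1) sum1(3)] eqs by simp
  next
    case 2
    define c0 where "c0 = n - i - s"
    have sum0: "s + i + c0 = n" "1 \<le> c0" "line_vertex n i s = Inner s i c0" "line_vertex n i t = Merged i" "t + i = n"
      using right[of s] 2 s mid i by (simp_all add: c0_def)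
    have "(i = s + 1 \<and> i = 1) = False" "(s = i \<and> i = 1) = (s = 1 \<and> t = n - 1)"
      "(c0 = 1 \<and> i = i + 1) = False" "(c0 = 1 \<and> i = i) = (t = s + 1)"
      using sum0(1,2,5) s i by (intro iffI conjI; (elim conjE)?; (linarith | blast))+
    note eqs = this
    show ?thesis
      unfolding sum0(3,4) A_quiver_Inner_Merged[OF sum0(1) s(1) i(1) sum0(2) i] eqs by simp
  next
    case 3
    define a0 b0 c0 where "a0 = n - t" and "b0 = t - (n - i)" and "c0 = n - i"
    have sum0: "a0 + b0 + c0 = n" "1 \<le> a0" "1 \<le> b0" "1 \<le> c0" "a0 + t = n" "c0 + i = n" "line_vertex n i t = Inner a0 b0 c0"
      using left[of t] 3 s i by (simp_all add: a0_def b0_def c0_def)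
    have "(s = a0 + 1 \<and> i = b0) = False" "(a0 = s + 1 \<and> i = b0) = False"
      "(s = a0 \<and> b0 = i + 1) = False" "(s = a0 \<and> i = b0 + 1) = (s = 1 \<and> t = n - 1)"
      "(a0 = s + 1 \<and> i = b0 + 1) = False" "(s = a0 + 1 \<and> b0 = i + 1) = False" "(t = s + 1) = False"
      using 3(1)[THEN less_diff_conv[THEN iffD1]] 3(2) s i sum0(1-6) by (intro iffI conjI; (elim conjE)?; (linarith | blast))+
    note eqs = this
    show ?thesis
      unfolding right(1)[OF 3(1)] sum0(7) A_quiver_Inner_Inner[OF right(2)[OF 3(1)] s(1) i(1) right(3)[OF 3(1)] sum0(1-4)] eqs
      by simp
  next
    case 4
    then have "s + i = n" "s = t" using i by simp_all
    then have "(i = i + 1) = False" "(i + 1 = n \<and> i = 1) = False" "(i = 1 \<and> i + 1 = n) = False"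
      "(t = s + 1) = False" "(s = 1 \<and> t = n - 1) = False"
      using n by auto
    note eqs = this
    have "line_vertex n i s = Merged i" "line_vertex n i t = Merged i" using 4 mid by simp_all
    then have "A_quiver n (line_vertex n i s) (line_vertex n i t) = A_quiver n (Merged i) (Merged i)" by simp
    then show ?thesis unfolding A_quiver_Merged_Merged[OF i i] eqs by simp
  next
    case 5
    define a0 b0 c0 where "a0 = n - t" and "b0 = t - (n - i)" and "c0 = n - i"
    have sum0: "a0 + b0 + c0 = n" "1 \<le> a0" "1 \<le> b0" "1 \<le> c0" "a0 + t = n" "c0 + i = n" "line_vertex n i t = Inner a0 b0 c0"
      using left[of t] 5 s i by (simp_all add: a0_def b0_def c0_def)
    have "(i = a0 + 1 \<and> b0 = 1) = (t = s + 1)" "(a0 = i \<and> b0 = 1) = False"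
      "(c0 = 1 \<and> i = b0 + 1) = (s = 1 \<and> t = n - 1)" "(c0 = 1 \<and> b0 = i) = False"
      using 5 s i sum0(1-6) by (intro iffI conjI; (elim conjE)?; (linarith | blast))+
    note eqs = this
    show ?thesis
      unfolding 5(1) mid sum0(7) A_quiver_antisym[of n "Merged i"] A_quiver_Inner_Merged[OF sum0(1-4) i]
      unfolding 5(1)[symmetric] eqs by simp
  next
    case 6
    define a0 b0 c0 where "a0 = n - t" and "b0 = t - (n - i)" and "c0 = n - i"
    have sum0: "a0 + b0 + c0 = n" "1 \<le> a0" "1 \<le> b0" "1 \<le> c0" "a0 + t = n" "c0 + i = n" "line_vertex n i t = Inner a0 b0 c0"
      using left[of t] 6 s i le by (simp_all add: a0_def b0_def c0_def)
    define a1 b1 where "a1 = n - s" and "b1 = s - (n - i)"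
    have sum1: "a1 + b1 + c0 = n" "1 \<le> a1" "1 \<le> b1" "a1 + s = n" "line_vertex n i s = Inner a1 b1 c0"
      using left[of s] 6 s i le by (simp_all add: a1_def b1_def c0_def)
    have "(a1 = a0 + 1 \<and> b1 = b0) = False" "(a0 = a1 + 1 \<and> b1 = b0) = False"
      "(a1 = a0 \<and> b0 = b1 + 1) = False" "(a1 = a0 \<and> b1 = b0 + 1) = False"
      "(a0 = a1 + 1 \<and> b1 = b0 + 1) = False" "(a1 = a0 + 1 \<and> b0 = b1 + 1) = (t = s + 1)"
      "(s = 1 \<and> t = n - 1) = False"
      using 6 s i le sum0(1-6) sum1(1-4) by (intro iffI conjI; (elim conjE)?; (linarith | blast))+
    note eqs = this
    show ?thesis
      unfolding sum0(7) sum1(5) A_quiver_Inner_Inner[OF sum1(1-3) sum0(4) sum0(1-4)] eqs by simp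
  qed
qed

section \<open>Mutations along a chain\<close>

text \<open>Mutations commute with the restriction to a set of vertices that contains the mutated ones. Hence
  the effect on a single variable can be computed on the mutated vertices and one further vertex.\<close>

lemma fold_mutate_relabel:
  assumes "inj_on w K" "set zs \<subseteq> K"
    and "\<And>a b. a \<in> K \<Longrightarrow> b \<in> K \<Longrightarrow> Q (w a) (w b) = Q' a b"
    and "\<And>a. a \<in> K \<Longrightarrow> x (w a) = x' a"
    and "a \<in> K"
  shows "snd (fold mutate (map w zs) (Q, x)) (w a) = snd (fold mutate zs (Q', x')) a"
  using assms(2-5)
proof (induction zs arbitrary: Q x Q' x')
  case Nil
  then show ?case by simp
next
  case (Cons z zs)
  then have z: "z \<in> K" by simp
  have eq: "w c = w z \<longleftrightarrow> c = z" if "c \<in> K" for c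
    using assms(1) z that by (auto dest: inj_onD)
  have "snd (fold mutate (map w zs) (mutate_quiver (w z) Q, mutate_variables (w z) Q x)) (w a)
    = snd (fold mutate zs (mutate_quiver z Q', mutate_variables z Q' x')) a"
    by (rule Cons.IH)
      (use Cons.prems z eq in \<open>auto simp: mutate_quiver_def mutate_variables_def\<close>)
  then show ?case by simp
qed

lemma mutate_quiver_antisym:
  assumes "Q t s = - Q s t" "Q t z = - Q z t" "Q s z = - Q z s"
  shows "mutate_quiver z Q t s = - mutate_quiver z Q s t"
  using assms by (auto simp: mutate_quiver_def)

definition mutation_factor :: "real \<Rightarrow> real \<Rightarrow> real" where
  "mutation_factor Y d =
     (if 0 < d then (1 + Y) powr d else if d < 0 then inverse (1 + inverse Y) powr (- d) else 1)"

text \<open>The mutated vertices form a chain \<open>N \<rightarrow> \<dots> \<rightarrow> 1\<close>. The vertex \<open>0\<close> represents an arbitrary further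
  vertex, with \<open>f s\<close> arrows from \<open>s\<close> to it at the beginning. The numbers of arrows at the moment when
  \<open>s\<close> is mutated are \<open>d s\<close> on the way down from \<open>N\<close> to \<open>1\<close> and \<open>g s\<close> on the way up from \<open>2\<close> to \<open>N\<close>; the
  assumptions are the recursions which quiver mutation implies for them.\<close>

locale chain =
  fixes N :: nat and y :: "nat \<Rightarrow> real" and f d g :: "nat \<Rightarrow> real"
  assumes N: "1 \<le> N"
    and y_pos: "\<And>s. 1 \<le> s \<Longrightarrow> s \<le> N \<Longrightarrow> 0 < y s"
    and d_last: "d N = f N"
    and d_step: "\<And>s. 1 \<le> s \<Longrightarrow> s < N \<Longrightarrow> d s = f s + min (d (s + 1)) 0"
    and g_first: "2 \<le> N \<Longrightarrow> g 2 = min (d 1) 0 - d 2"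
    and g_step: "\<And>s. 2 \<le> s \<Longrightarrow> s < N \<Longrightarrow> g (s + 1) = min (d s) 0 - d (s + 1) + max (g s) 0"
begin

abbreviation "p \<equiv> chain_prod y"
abbreviation "S \<equiv> chain_sum y"

text \<open>The tail sum \<open>1 + y\<^sub>s + y\<^sub>s y\<^bsub>s+1\<^esub> + \<dots> + y\<^sub>s \<cdots> y\<^sub>N\<close>. On the way down the variable at \<open>s\<close> has the value
  \<open>F s - 1\<close> when it is mutated.\<close>

definition F :: "nat \<Rightarrow> real" where
  "F s = (S (N + 1) - S (s - 1)) / p s"

lemma p_pos: "s \<le> N + 1 \<Longrightarrow> 0 < p s"
  by (rule chain_prod_pos) (use y_pos in auto)

lemma S_pos: "1 \<le> s \<Longrightarrow> s \<le> N + 1 \<Longrightarrow> 0 < S s"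
  by (rule chain_sum_pos) (use y_pos in auto)

lemma F_last: "F (N + 1) = 1"
  using p_pos[of "N + 1"] by (simp add: F_def chain_sum_Suc)

lemma F_1: "F 1 = S (N + 1)"
  by (simp add: F_def)

lemma F_step: "1 \<le> s \<Longrightarrow> s \<le> N \<Longrightarrow> F s = 1 + y s * F (s + 1)"
proof -
  assume s: "1 \<le> s" "s \<le> N"
  then have "S s = S (s - 1) + p s" "p (s + 1) = p s * y s"
    using chain_sum_Suc[of y "s - 1"] by (simp_all add: chain_prod_Suc)
  then show ?thesis
    using p_pos[of s] y_pos[of s] s by (simp add: F_def field_simps)
qed

lemma F_pos:
  assumes "1 \<le> s" "s \<le> N + 1"
  shows "0 < F s"
  using assms(2,1)
proof (induction s rule: inc_induct)
  case base
  then show ?case using F_last by simp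
next
  case (step s)
  then show ?case using F_step[of s] y_pos[of s] by (simp add: add_pos_pos)
qed

text \<open>Since \<open>F 1 = S\<^bsub>s-1\<^esub> + p\<^sub>s F\<^sub>s\<close>, this identity evaluates \<open>1 + Y\<close> for the value
  \<open>Y = F\<^sub>1 / (S\<^bsub>s-1\<^esub> y\<^sub>s F\<^bsub>s+1\<^esub>)\<close> which the variable at \<open>s\<close> has when it is mutated on the way up.\<close>

lemma F_S: "1 \<le> s \<Longrightarrow> s \<le> N \<Longrightarrow> F 1 + S (s - 1) * (y s * F (s + 1)) = S s * F s"
proof -
  assume s: "1 \<le> s" "s \<le> N"
  have "S s = S (s - 1) + p s" using s chain_sum_Suc[of y "s - 1"] by simp
  moreover have y: "y s * F (s + 1) = F s - 1" using F_step s by simp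
  moreover have "F 1 = p s * F s + S (s - 1)" using p_pos[of s] s by (simp add: F_def)
  ultimately show ?thesis unfolding y by (simp add: algebra_simps)
qed

definition down_row :: "nat \<Rightarrow> nat \<Rightarrow> real" where
  "down_row k s = (if s < k then f s else if s = k then d s else if s = k + 1 then - d s
      else min (d (s - 1)) 0 - d s)"

definition down_quiver :: "nat \<Rightarrow> nat \<Rightarrow> nat \<Rightarrow> real" where
  "down_quiver k s t = (if t = 0 then down_row k s
     else if s = t + 1 then (if t = k then - 1 else 1)
     else if t = s + 1 then (if s = k then 1 else - 1) else 0)"

definition down_var :: "nat \<Rightarrow> nat \<Rightarrow> real" where
  "down_var k s = (if s < k then y s else if s = k then y s * F (s + 1)
     else if s = k + 1 then inverse (y s * F (s + 1)) else F (s - 1) / (y s * F (s + 1)))"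

text \<open>The state after the mutations at \<open>N, \<dots>, k + 1\<close>. The vertex \<open>k\<close>, which comes next, has
  arrows to both of its neighbours, so its mutation creates no arrows inside the chain.\<close>

definition down_state :: "real \<Rightarrow> nat \<Rightarrow> (nat \<Rightarrow> nat \<Rightarrow> real) \<times> (nat \<Rightarrow> real) \<Rightarrow> bool" where
  "down_state x0 k = (\<lambda>(Q, x).
     (\<forall>s\<in>{1..N}. \<forall>t\<in>{0..N}. Q s t = down_quiver k s t \<and> Q t s = - down_quiver k s t) \<and>
     (\<forall>s\<in>{1..N}. x s = down_var k s) \<and>
     x 0 = x0 * (\<Prod>s=k+1..N. mutation_factor (y s * F (s + 1)) (d s)))"

lemma mutated_value_0:
  assumes "z \<noteq> 0" "Q z 0 = r" "Q 0 z = - r"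
  shows "mutate_variables z Q x 0 = x 0 * mutation_factor (x z) r"
  using assms by (simp add: mutate_variables_def mutation_factor_def)

lemma down_step:
  assumes k: "1 \<le> k" "k \<le> N" and st: "down_state x0 k (Q, x)"
  shows "down_state x0 (k - 1) (mutate k (Q, x))"
proof -
  have Q: "Q s t = down_quiver k s t" "Q t s = - down_quiver k s t" if "1 \<le> s" "s \<le> N" "t \<le> N" for s t
    using st that by (auto simp: down_state_def)
  have x: "x s = down_var k s" if "1 \<le> s" "s \<le> N" for s
    using st that by (auto simp: down_state_def)
  have xk: "x k = y k * F (k + 1)" "1 + x k = F k" "0 < x k" "0 < F k"
    using x[of k] F_step[of k] F_pos[of k] F_pos[of "k + 1"] y_pos[of k] k by (simp_all add: down_var_def)
  have Qk: "Q k t = (if t = 0 then d k else if k = t + 1 \<or> t = k + 1 then 1 else 0)" 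
     "Q t k = - (if t = 0 then d k else if k = t + 1 \<or> t = k + 1 then 1 else 0)" if "t \<le> N" for t
    using Q[of k t] that k by (simp_all add: down_quiver_def down_row_def)
  have M: "max 0 (Q s k) = 0" "max 0 (Q k s) = of_bool (k = s + 1 \<or> s = k + 1)" if "1 \<le> s" "s \<le> N" for s
    using Qk[of s] that by simp_all
  have 1: "mutate_quiver k Q s t = down_quiver (k - 1) s t" if "1 \<le> s" "s \<le> N" "t \<le> N" for s t
  proof -
    consider "s = k" "t = 0" | "s = k" "t \<noteq> 0" | "s \<noteq> k" "t = k" | "s \<noteq> k" "t = 0"
      | "s \<noteq> k" "t \<noteq> k" "t \<noteq> 0" by blast
    then show ?thesis
    proof cases
      case 1
      then show ?thesis
        using Qk[of 0] k by (auto simp: mutate_quiver_def down_quiver_def down_row_def)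
    next
      case 2
      then show ?thesis
        using Qk[of t] k that by (auto simp: mutate_quiver_def down_quiver_def)
    next
      case 3
      then show ?thesis
        using Qk[of s] k that by (auto simp: mutate_quiver_def down_quiver_def)
    next
      case 4
      have "mutate_quiver k Q s t = down_row k s + of_bool (k = s + 1 \<or> s = k + 1) * min (d k) 0"
        using 4 Q[of s 0] Qk[of 0] M[of s] that k
        by (simp add: mutate_quiver_def down_quiver_def max_def min_def)
      also have "\<dots> = down_row (k - 1) s"
      proof -
        obtain k' where k': "k = Suc k'" using k by (cases k) auto
        consider "s + 1 = k" | "s = k + 1" | "s + 1 < k" | "k + 1 < s" using 4 by linarith
        then show ?thesis
          by cases (use k k' that d_step[of s] in \<open>auto simp: down_row_def\<close>)
      qed
      finally show ?thesis using 4 by (simp add: down_quiver_def)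
    next
      case 5
      then have "mutate_quiver k Q s t = down_quiver k s t"
        using M[of s] M[of t] Q[of s t] that by (simp add: mutate_quiver_def)
      also have "\<dots> = down_quiver (k - 1) s t"
        using 5 k by (auto simp: down_quiver_def)
      finally show ?thesis .
    qed
  qed
  have 2: "mutate_quiver k Q t s = - mutate_quiver k Q s t" if "1 \<le> s" "s \<le> N" "t \<le> N" for s t
    by (rule mutate_quiver_antisym) (use Q[of s t] Qk[of s] Qk[of t] that in simp_all)
  have 3: "mutate_variables k Q x s = down_var (k - 1) s" if "1 \<le> s" "s \<le> N" for s
  proof -
    obtain k' where k': "k = Suc k'" using k by (cases k) auto
    consider "s = k" | "s + 1 = k" | "s = k + 1" | "s + 1 < k" | "k + 1 < s" by linarith
    then show ?thesis
    proof cases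
      case 1
      then show ?thesis using k k' by (auto simp: mutate_variables_def down_var_def xk(1)[unfolded k'])
    next
      case 2
      then have "mutate_variables k Q x s = x s * F k"
        using Qk[of s] that xk(4) unfolding mutate_variables_def xk(2) by simp
      then show ?thesis using 2 x[of s] that k k' by (auto simp: down_var_def)
    next
      case 3
      then have "mutate_variables k Q x s = x s * F k"
        using Qk[of s] that xk(4) unfolding mutate_variables_def xk(2) by simp
      then show ?thesis using 3 x[of s] that k k' by (auto simp: down_var_def field_simps)
    next
      case 4
      then show ?thesis using Qk[of s] x[of s] that k k' by (auto simp: mutate_variables_def down_var_def)
    next
      case 5
      then show ?thesis using Qk[of s] x[of s] that k k' by (auto simp: mutate_variables_def down_var_def)
    qed
  qed
  have "x 0 = x0 * (\<Prod>s=k+1..N. mutation_factor (y s * F (s + 1)) (d s))"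
    using st by (simp add: down_state_def)
  moreover have "{k..N} = insert k {k+1..N}" using k by auto
  ultimately have 4: "mutate_variables k Q x 0 = x0 * (\<Prod>s=k-1+1..N. mutation_factor (y s * F (s + 1)) (d s))"
    using mutated_value_0[of k Q "d k" x] Qk[of 0] k xk(1) by (simp add: ac_simps)
  show ?thesis
    using 1 2 3 4 by (simp add: down_state_def)
qed

definition up_quiver :: "nat \<Rightarrow> nat \<Rightarrow> nat \<Rightarrow> real" where
  "up_quiver k s t = (if t = 0 then (if s = k + 1 then g s else min (d (s - 1)) 0 - d s)
     else if s = k + 1 then (if t = 1 then 1 else if t = k \<or> t = k + 2 then - 1 else 0)
     else if s = t + 1 then 1 else if t = s + 1 then - 1 else 0)"

definition up_var :: "nat \<Rightarrow> nat \<Rightarrow> real" where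
  "up_var k s = (if s = 1 then S k / (p (k + 1) * F (k + 1))
     else if s < k then S (s - 1) * y s / S (s + 1)
     else if s = k then S (s - 1) * (y s * F (s + 1)) / F 1
     else if s = k + 1 then F 1 / (S k * (y s * F (s + 1)))
     else F (s - 1) / (y s * F (s + 1)))"

text \<open>The state after the mutations at \<open>2, \<dots>, k\<close> on the way up. The vertex \<open>k + 1\<close>, which comes next, has
  an arrow to \<open>1\<close> and arrows from its neighbours \<open>k\<close> and \<open>k + 2\<close>. Only the rows of vertices yet to be
  mutated are recorded, because the later mutations read only these.\<close>

definition up_state :: "real \<Rightarrow> nat \<Rightarrow> (nat \<Rightarrow> nat \<Rightarrow> real) \<times> (nat \<Rightarrow> real) \<Rightarrow> bool" where
  "up_state x0 k = (\<lambda>(Q, x).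
     (\<forall>s\<in>{k+1..N}. \<forall>t\<in>{0..N}. Q s t = up_quiver k s t \<and> Q t s = - up_quiver k s t) \<and>
     (\<forall>s\<in>{1..N}. x s = up_var k s) \<and>
     x 0 = x0 * (\<Prod>s=1..N. mutation_factor (y s * F (s + 1)) (d s))
       * (\<Prod>s=2..k. mutation_factor (F 1 / (S (s - 1) * (y s * F (s + 1)))) (g s)))"

text \<open>After the mutations at \<open>N, \<dots>, 1\<close> the chain has its original orientation.\<close>

lemma turn:
  assumes "down_state x0 0 (Q, x)"
  shows "up_state x0 1 (Q, x)"
proof -
  have *: "down_quiver 0 s t = up_quiver 1 s t" if "2 \<le> s" "s \<le> N" "t \<le> N" for s t
    using that g_first by (auto simp: down_quiver_def up_quiver_def down_row_def numeral_2_eq_2)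
  have **: "down_var 0 s = up_var 1 s" if "1 \<le> s" "s \<le> N" for s
    using that chain_prod_Suc[of 1 y] F_1
    by (auto simp: down_var_def up_var_def chain_sum_Suc field_simps)
  show ?thesis
    using assms * ** by (auto simp: down_state_def up_state_def)
qed

lemma up_step:
  assumes k: "1 \<le> k" "k < N" and st: "up_state x0 k (Q, x)"
  shows "up_state x0 (k + 1) (mutate (k + 1) (Q, x))"
proof -
  define z where "z = k + 1"
  have z: "2 \<le> z" "z \<le> N" "z = Suc k" "z - 1 = k" using k z_def by auto
  have Q: "Q s t = up_quiver k s t" "Q t s = - up_quiver k s t" if "z \<le> s" "s \<le> N" "t \<le> N" for s t
    using st that z_def by (auto simp: up_state_def)
  have x: "x s = up_var k s" if "1 \<le> s" "s \<le> N" for s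
    using st that by (auto simp: up_state_def)
  have pos: "0 < S k" "0 < S z" "0 < y z" "0 < F z" "0 < F (z + 1)" "0 < F 1" "0 < p z"
    using k z by (auto intro!: S_pos y_pos F_pos p_pos)
  have xz: "x z = F 1 / (S k * (y z * F (z + 1)))"
    using x[of z] z by (simp add: up_var_def)
  then have xz_pos: "0 < x z" using pos by simp
  have FS: "F 1 + S k * (y z * F (z + 1)) = S z * F z" using F_S[of z] z by simp
  have one: "1 + x z = S z * F z / (S k * (y z * F (z + 1)))"
    "inverse (1 + inverse (x z)) = F 1 / (S z * F z)"
    unfolding FS[symmetric] xz using pos by (simp_all add: field_simps)
  have Qz: "Q z t = (if t = 0 then g z else if t = 1 then 1 else if t = k \<or> t = k + 2 then - 1 else 0)" 
     "Q t z = - (if t = 0 then g z else if t = 1 then 1 else if t = k \<or> t = k + 2 then - 1 else 0)" if "t \<le> N" for t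
    using Q[of z t] that z by (simp_all add: up_quiver_def)
  have M: "max 0 (Q s z) = of_bool (s = z + 1)" "max 0 (Q z s) = 0" if "z + 1 \<le> s" "s \<le> N" for s
    using Qz[of s] that z by (simp_all add: max_def)
  have 1: "mutate_quiver z Q s t = up_quiver z s t" if s: "z + 1 \<le> s" "s \<le> N" "t \<le> N" for s t
  proof (cases "t = z")
    case True
    then show ?thesis
      using Qz[of s] s z by (auto simp: mutate_quiver_def up_quiver_def)
  next
    case False
    then have m: "mutate_quiver z Q s t = Q s t + of_bool (s = z + 1) * max 0 (Q z t)"
      using M[of s] s by (simp add: mutate_quiver_def)
    consider "s = z + 1" "t = 0" | "s = z + 1" "t = 1" | "s = z + 1" "t \<noteq> 0" "t \<noteq> 1" | "s \<noteq> z + 1"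
      by blast
    then show ?thesis
    proof cases
      case 1
      then show ?thesis
        using m Q[of s 0] Qz[of 0] s z g_step[of z] by (simp add: up_quiver_def max_def)
    next
      case 2
      then show ?thesis
        using m Q[of s 1] Qz[of 1] s z by (simp add: up_quiver_def)
    next
      case 3
      have "mutate_quiver z Q s t = up_quiver k s t"
        using 3 m Q[of s t] Qz[of t] s z by (auto simp: max_def)
      then show ?thesis using 3 False z by (auto simp: up_quiver_def)
    next
      case 4
      then show ?thesis using m Q[of s t] s z by (auto simp: up_quiver_def)
    qed
  qed
  have 2: "mutate_quiver z Q t s = - mutate_quiver z Q s t" if "z + 1 \<le> s" "s \<le> N" "t \<le> N" for s t
    by (rule mutate_quiver_antisym) (use Q[of s t] Qz[of s] Qz[of t] that z in simp_all)
  have 3: "mutate_variables z Q x s = up_var z s" if "1 \<le> s" "s \<le> N" for s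
  proof -
    have "s = 1 \<or> 2 \<le> s \<and> s < k \<or> 2 \<le> s \<and> s = k \<or> s = z \<or> s = z + 1 \<or> z + 1 < s"
      using that z by linarith
    then consider "s = 1" | "2 \<le> s" "s < k" | "2 \<le> s" "s = k" | "s = z" | "s = z + 1" | "z + 1 < s"
      by blast
    then show ?thesis
    proof cases
      case 1
      have "p (z + 1) = p z * y z" using z by (simp add: chain_prod_Suc)
      then show ?thesis
        using 1 Qz[of s] that z x[of s] pos unfolding mutate_variables_def one
        by (simp add: up_var_def field_simps)
    next
      case 2
      then show ?thesis
        using Qz[of s] that z x[of s] by (simp add: mutate_variables_def up_var_def)
    next
      case 3
      then have "mutate_variables z Q x s = x s * (F 1 / (S z * F z))"
        using Qz[of s] that z unfolding mutate_variables_def one using pos by simp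
      then show ?thesis
        using 3 x[of s] z pos by (simp add: up_var_def)
    next
      case 4
      then show ?thesis
        using z(1,4) by (simp add: mutate_variables_def up_var_def xz)
    next
      case 5
      then have "mutate_variables z Q x s = x s * (F 1 / (S z * F z))"
        using Qz[of s] that z unfolding mutate_variables_def one using pos by simp
      then show ?thesis
        using 5 x[of s] z pos that by (simp add: up_var_def)
    next
      case 6
      then show ?thesis
        using Qz[of s] that z x[of s] by (simp add: mutate_variables_def up_var_def)
    qed
  qed
  have "x 0 = x0 * (\<Prod>s=1..N. mutation_factor (y s * F (s + 1)) (d s))
       * (\<Prod>s=2..k. mutation_factor (F 1 / (S (s - 1) * (y s * F (s + 1)))) (g s))"
    using st by (simp add: up_state_def)
  moreover have "{2..z} = insert z {2..k}" "z \<notin> {2..k}" using k z by auto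
  ultimately have 4: "mutate_variables z Q x 0 = x0 * (\<Prod>s=1..N. mutation_factor (y s * F (s + 1)) (d s))
       * (\<Prod>s=2..z. mutation_factor (F 1 / (S (s - 1) * (y s * F (s + 1)))) (g s))"
    using mutated_value_0[of z Q "g z" x] Qz[of 0] z xz by (simp add: ac_simps)
  show ?thesis
    using 1 2 3 4 unfolding z_def[symmetric] by (simp add: up_state_def)
qed

theorem chain_mutation:
  assumes Q: "\<And>s t. 1 \<le> s \<Longrightarrow> s \<le> N \<Longrightarrow> 1 \<le> t \<Longrightarrow> t \<le> N \<Longrightarrow>
      Q s t = (if s = t + 1 then 1 else if t = s + 1 then - 1 else 0)"
    and f: "\<And>s. 1 \<le> s \<Longrightarrow> s \<le> N \<Longrightarrow> Q s 0 = f s \<and> Q 0 s = - f s"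
    and x: "\<And>s. 1 \<le> s \<Longrightarrow> s \<le> N \<Longrightarrow> x s = y s"
  defines "x' \<equiv> snd (fold mutate (rev [1..<N+1] @ [2..<N+1]) (Q, x))"
  shows "x' 1 = S N / p (N + 1)"
    and "\<And>s. 2 \<le> s \<Longrightarrow> s \<le> N \<Longrightarrow> x' s = S (s - 1) * y s / S (s + 1)"
    and "x' 0 = x 0 * (\<Prod>s=1..N. mutation_factor (y s * F (s + 1)) (d s))
       * (\<Prod>s=2..N. mutation_factor (F 1 / (S (s - 1) * (y s * F (s + 1)))) (g s))"
proof -
  have start: "down_state (x 0) N (Q, x)"
    using Q f x d_last F_last by (auto simp: down_state_def down_quiver_def down_row_def down_var_def)
  have down: "down_state (x 0) k (fold mutate (rev [k+1..<N+1]) (Q, x))" if "k \<le> N" for k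
    using that
  proof (induction k rule: inc_induct)
    case base
    then show ?case using start by simp
  next
    case (step k)
    have "rev [k+1..<N+1] = rev [Suc k + 1..<N+1] @ [Suc k]"
      using step.hyps by (simp add: upt_conv_Cons)
    then show ?case
      using step.IH step.hyps down_step[of "Suc k" "x 0"]
      by (cases "fold mutate (rev [Suc k + 1..<N+1]) (Q, x)") auto
  qed
  obtain Q1 x1 where 1: "fold mutate (rev [1..<N+1]) (Q, x) = (Q1, x1)" by force
  have up: "up_state (x 0) k (fold mutate [2..<k+1] (Q1, x1))" if "1 \<le> k" "k \<le> N" for k
    using that
  proof (induction k rule: dec_induct)
    case base
    then show ?case using down[of 0] turn 1 by (simp add: numeral_2_eq_2)
  next
    case (step k)
    have "[2..<Suc k + 1] = [2..<k+1] @ [Suc k]" using step.hyps by simp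
    then show ?case
      using step up_step[of k "x 0"]
      by (cases "fold mutate [2..<k+1] (Q1, x1)") auto
  qed
  have "up_state (x 0) N (fold mutate [2..<N+1] (Q1, x1))" using up N by simp
  moreover have "x' = snd (fold mutate [2..<N+1] (Q1, x1))"
    unfolding x'_def using 1 by simp
  ultimately have *: "\<forall>s\<in>{1..N}. x' s = up_var N s"
    "x' 0 = x 0 * (\<Prod>s=1..N. mutation_factor (y s * F (s + 1)) (d s))
       * (\<Prod>s=2..N. mutation_factor (F 1 / (S (s - 1) * (y s * F (s + 1)))) (g s))"
    by (auto simp: up_state_def split: prod.splits)
  show "x' 1 = S N / p (N + 1)"
    using * N F_last by (simp add: up_var_def)
  show "x' s = S (s - 1) * y s / S (s + 1)" if "2 \<le> s" "s \<le> N" for s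
    using * F_last F_1 that by (auto simp: up_var_def)
  show "x' 0 = x 0 * (\<Prod>s=1..N. mutation_factor (y s * F (s + 1)) (d s))
       * (\<Prod>s=2..N. mutation_factor (F 1 / (S (s - 1) * (y s * F (s + 1)))) (g s))"
    by (rule *(2))
qed

end

text \<open>The mutations at the same vertex on the way down and on the way up contribute opposite numbers
  of arrows; their product takes the same form for both signs.\<close>

lemma mutation_factor_pair:
  assumes "0 < Y" "0 < A" "0 < B" "0 < C" and AB: "A + B * Y = C * (1 + Y)"
  shows "mutation_factor Y d * mutation_factor (A / (B * Y)) (- d) = (A / C) powr max d 0 * (C / B) powr max (- d) 0"
proof -
  have 1: "inverse (1 + inverse (A / (B * Y))) = A / (C * (1 + Y))" "1 + A / (B * Y) = C * (1 + Y) / (B * Y)"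
    "inverse (1 + inverse Y) = Y / (1 + Y)"
    using assms(1-4) unfolding AB[symmetric] by (simp_all add: field_simps)
  have nz: "1 + Y \<noteq> 0" using assms(1) by simp
  consider "0 < d" | "d = 0" | "d < 0" by linarith
  then show ?thesis
  proof cases
    case 1
    then have "mutation_factor Y d * mutation_factor (A / (B * Y)) (- d)
       = (1 + Y) powr d * (A / (C * (1 + Y))) powr d"
      unfolding mutation_factor_def \<open>inverse (1 + inverse (A / (B * Y))) = A / (C * (1 + Y))\<close> by simp
    also have "\<dots> = ((1 + Y) * (A / (C * (1 + Y)))) powr d"
      by (subst powr_mult) (use assms(1-4) in simp_all)
    also have "(1 + Y) * (A / (C * (1 + Y))) = A / C" using nz by simp
    finally show ?thesis using 1 assms by simp
  next
    case 2
    then show ?thesis using assms by (simp add: mutation_factor_def)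
  next
    case 3
    then have "mutation_factor Y d * mutation_factor (A / (B * Y)) (- d)
       = (Y / (1 + Y)) powr (- d) * (C * (1 + Y) / (B * Y)) powr (- d)"
      unfolding mutation_factor_def 1(2,3) by simp
    also have "\<dots> = (Y / (1 + Y) * (C * (1 + Y) / (B * Y))) powr (- d)"
      by (subst powr_mult) (use assms(1-4) in simp_all)
    also have "Y / (1 + Y) * (C * (1 + Y) / (B * Y)) = C / B" using nz assms(1) by simp
    finally show ?thesis using 3 assms by simp
  qed
qed

text \<open>For a vertex with \<open>m s - m (s - 1)\<close> arrows from \<open>s\<close>, the number of arrows at \<open>s\<close> on the way
  down is \<open>tail_min s - m (s - 1)\<close>.\<close>

definition tail_min :: "nat \<Rightarrow> (nat \<Rightarrow> real) \<Rightarrow> nat \<Rightarrow> real" where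
  "tail_min N m s = Min (m ` {s..N})"

lemma tail_min_last: "tail_min N m N = m N"
  by (simp add: tail_min_def)

lemma tail_min_step: "s < N \<Longrightarrow> tail_min N m s = min (m s) (tail_min N m (Suc s))"
proof -
  assume "s < N"
  then have "{s..N} = insert s {Suc s..N}" "{Suc s..N} \<noteq> {}" by auto
  then show ?thesis by (simp add: tail_min_def)
qed

lemma tail_min_nonneg: "s \<le> N \<Longrightarrow> (\<And>t. 0 \<le> m t) \<Longrightarrow> 0 \<le> tail_min N m s"
  by (auto simp: tail_min_def)

text \<open>The exponents of \<open>F 1\<close>, \<open>F s\<close> and \<open>S s\<close> telescope. The factors \<open>F s\<close> cancel between the way down
  and the way up, and what remains depends on the multiplicities \<open>m t\<close> linearly, although the
  numbers of arrows in between do not.\<close>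

lemma chain_mutation_neighbour:
  fixes m :: "nat \<Rightarrow> real"
  assumes N: "1 \<le> N" and y: "\<And>s. 1 \<le> s \<Longrightarrow> s \<le> N \<Longrightarrow> 0 < y s"
    and m: "m 0 = 0" "\<And>t. 0 \<le> m t"
    and Q: "\<And>s t. 1 \<le> s \<Longrightarrow> s \<le> N \<Longrightarrow> 1 \<le> t \<Longrightarrow> t \<le> N \<Longrightarrow>
      Q s t = (if s = t + 1 then 1 else if t = s + 1 then - 1 else 0)"
    and Q0: "\<And>s. 1 \<le> s \<Longrightarrow> s \<le> N \<Longrightarrow> Q s 0 = m s - m (s - 1) \<and> Q 0 s = - (m s - m (s - 1))"
    and x: "\<And>s. 1 \<le> s \<Longrightarrow> s \<le> N \<Longrightarrow> x s = y s"
  shows "snd (fold mutate (rev [1..<N+1] @ [2..<N+1]) (Q, x)) 0 = x 0 * (\<Prod>t=1..N. chain_ratio y t powr m t)"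
proof -
  define \<mu> where "\<mu> = tail_min N m"
  define d where "d s = \<mu> s - m (s - 1)" for s
  have d1: "d 1 = \<mu> 1" "0 \<le> \<mu> 1" using m N tail_min_nonneg[of 1 N m] by (simp_all add: d_def \<mu>_def)
  have \<mu>: "\<mu> s = min (m s) (\<mu> (Suc s))" if "s < N" for s
    unfolding \<mu>_def by (rule tail_min_step) (rule that)
  interpret chain N y "\<lambda>s. m s - m (s - 1)" d "\<lambda>s. - d s"
  proof
    show "d N = m N - m (N - 1)" by (simp add: d_def \<mu>_def tail_min_last)
    show "d s = m s - m (s - 1) + min (d (s + 1)) 0" if "1 \<le> s" "s < N" for s
      using \<mu>[of s] that by (simp add: d_def)
    show "- d 2 = min (d 1) 0 - d 2" using d1 by simp
  qed (use N y in auto)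
  let ?a = "\<lambda>s. mutation_factor (y s * F (s + 1)) (d s)"
  let ?b = "\<lambda>s. mutation_factor (F 1 / (S (s - 1) * (y s * F (s + 1)))) (- d s)"
  have partial: "(\<Prod>s=1..r. ?a s) * (\<Prod>s=2..r. ?b s) = (F 1 / S r) powr \<mu> r * (\<Prod>t=1..<r. chain_ratio y t powr m t)"
    if "1 \<le> r" "r \<le> N" for r
    using that
  proof (induction r rule: dec_induct)
    case base
    have "?a 1 = F 1 powr \<mu> 1"
      using d1 F_step[of 1] N F_pos[of 1] unfolding mutation_factor_def by (cases "\<mu> 1 = 0") auto
    then show ?case by (simp add: chain_sum_Suc)
  next
    case (step r)
    have pos: "0 < y (Suc r)" "0 < F (Suc (Suc r))" "0 < F 1" "0 < S r" "0 < S (Suc r)"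
      using step by (auto intro!: y F_pos S_pos)
    \<comment> \<open>\<open>F_S\<close> is the relation required between the four parameters\<close>
    have pair: "?a (Suc r) * ?b (Suc r) =
      (F 1 / S (Suc r)) powr max (d (Suc r)) 0 * (S (Suc r) / S r) powr max (- d (Suc r)) 0"
      using mutation_factor_pair[of "y (Suc r) * F (Suc r + 1)" "F 1" "S r" "S (Suc r)" "d (Suc r)"]
        pos F_S[of "Suc r"] F_step[of "Suc r"] step by simp
    have "max (d (Suc r)) 0 = \<mu> (Suc r) - \<mu> r" "max (- d (Suc r)) 0 = m r - \<mu> r"
      using \<mu>[of r] step by (simp_all add: d_def max_def min_def)
    note pair = pair[unfolded this]
    have "(\<Prod>s=1..Suc r. ?a s) * (\<Prod>s=2..Suc r. ?b s) = (\<Prod>s=1..r. ?a s) * (\<Prod>s=2..r. ?b s) * (?a (Suc r) * ?b (Suc r))"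
      using step.hyps by (simp add: mult_ac)
    also have "\<dots> = (F 1 / S r) powr \<mu> r * (\<Prod>t=1..<r. chain_ratio y t powr m t) *
       ((F 1 / S (Suc r)) powr (\<mu> (Suc r) - \<mu> r) * (S (Suc r) / S r) powr (m r - \<mu> r))"
      unfolding pair using step by simp
    also have "\<dots> = ((F 1 / S r) powr \<mu> r * (F 1 / S (Suc r)) powr (\<mu> (Suc r) - \<mu> r) * (S (Suc r) / S r) powr (m r - \<mu> r))
        * (\<Prod>t=1..<r. chain_ratio y t powr m t)"
      by simp
    also have "(F 1 / S r) powr \<mu> r * (F 1 / S (Suc r)) powr (\<mu> (Suc r) - \<mu> r) * (S (Suc r) / S r) powr (m r - \<mu> r)
       = (F 1 / S (Suc r)) powr \<mu> (Suc r) * (S (Suc r) / S r) powr m r"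
      using pos by (simp add: powr_def ln_div algebra_simps flip: exp_add)
    finally show ?case
      using step.hyps by (simp add: chain_ratio_def)
  qed
  have "snd (fold mutate (rev [1..<N+1] @ [2..<N+1]) (Q, x)) 0
    = x 0 * ((\<Prod>s=1..N. ?a s) * (\<Prod>s=2..N. ?b s))"
    using chain_mutation(3)[OF Q Q0 x] by simp
  also have "\<dots> = x 0 * ((F 1 / S N) powr \<mu> N * (\<Prod>t=1..<N. chain_ratio y t powr m t))"
    using partial[of N] N by simp
  also have "(F 1 / S N) powr \<mu> N = chain_ratio y N powr m N"
    by (simp add: F_1[simplified] \<mu>_def tail_min_last chain_ratio_def)
  also have "\<dots> * (\<Prod>t=1..<N. chain_ratio y t powr m t) = (\<Prod>t=1..N. chain_ratio y t powr m t)"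
    using N by (simp add: mult.commute flip: prod.last_plus atLeastLessThanSuc_atLeastAtMost)
  finally show ?thesis .
qed

text \<open>The row of \<open>y\<^bsub>N+1\<^esub>\<close>, which has an arrow to \<open>y\<^sub>N\<close> and an arrow to \<open>y\<^sub>1\<close>; both coincide for \<open>N = 1\<close>.\<close>

lemma chain_mutation_end:
  assumes N: "1 \<le> N" and y: "\<And>s. 1 \<le> s \<Longrightarrow> s \<le> N \<Longrightarrow> 0 < y s"
    and Q: "\<And>s t. 1 \<le> s \<Longrightarrow> s \<le> N \<Longrightarrow> 1 \<le> t \<Longrightarrow> t \<le> N \<Longrightarrow>
      Q s t = (if s = t + 1 then 1 else if t = s + 1 then - 1 else 0)"
    and Q0: "\<And>s. 1 \<le> s \<Longrightarrow> s \<le> N \<Longrightarrow> Q s 0 = - of_bool (s = 1) - of_bool (s = N) \<and>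
        Q 0 s = of_bool (s = 1) + of_bool (s = N)"
    and x: "\<And>s. 1 \<le> s \<Longrightarrow> s \<le> N \<Longrightarrow> x s = y s"
  shows "snd (fold mutate (rev [1..<N+1] @ [2..<N+1]) (Q, x)) 0
    = x 0 * (chain_prod y (N + 1) * y 1 / (chain_sum y 2 * chain_sum y (N + 1)))"
    and "snd (fold mutate (rev [1..<N+1] @ [2..<N+1]) (Q, x)) 1 = chain_sum y N / chain_prod y (N + 1)"
    and "\<And>s. 2 \<le> s \<Longrightarrow> s \<le> N \<Longrightarrow> snd (fold mutate (rev [1..<N+1] @ [2..<N+1]) (Q, x)) s
      = chain_sum y (s - 1) * y s / chain_sum y (s + 1)"
proof -
  define d :: "nat \<Rightarrow> real" where "d s = (if s = 1 then - 2 else - 1)" for s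
  define g :: "nat \<Rightarrow> real" where "g s = (if s = 2 then - 1 else 0)" for s
  interpret chain N y "\<lambda>s. - of_bool (s = 1) - of_bool (s = N)" d g
    by unfold_locales (use N y in \<open>auto simp: d_def g_def\<close>)
  let ?a = "\<lambda>s. mutation_factor (y s * F (s + 1)) (d s)"
  let ?b = "\<lambda>s. mutation_factor (F 1 / (S (s - 1) * (y s * F (s + 1)))) (g s)"
  have a: "?a s = y s * F (s + 1) / F s * (if s = 1 then y 1 * F 2 / F 1 else 1)" if "1 \<le> s" "s \<le> N" for s
  proof -
    have "0 < y s * F (s + 1)" using that y[of s] F_pos[of "s + 1"] by simp
    moreover have "1 + y s * F (s + 1) = F s" using F_step that by simp
    moreover have "inverse (1 + inverse Y) = Y / (1 + Y)" if "0 < Y" for Y :: real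
      using that by (simp add: field_simps)
    ultimately have "inverse (1 + inverse (y s * F (s + 1))) = y s * F (s + 1) / F s"
      by metis
    moreover have "0 < y s * F (s + 1) / F s"
      using F_pos[of s] \<open>0 < y s * F (s + 1)\<close> that by simp
    ultimately have "inverse (1 + inverse (y s * F (s + 1))) = y s * F (s + 1) / F s" "0 < y s * F (s + 1) / F s"
      by blast+
    note inv = this
    have "mutation_factor Y (- 1) = r" "mutation_factor Y (- 2) = r * r"
      if "inverse (1 + inverse Y) = r" "0 < r" for Y r
      using that by (simp_all add: mutation_factor_def powr_numeral power2_eq_square)
    note factors = this[OF inv]
    show ?thesis
    proof (cases "s = 1")
      case True
      have "?a s = y s * F (s + 1) / F s * (y s * F (s + 1) / F s)"
        using factors(2) by (simp only: d_def True if_True simp_thms)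
      then show ?thesis using True by (simp add: numeral_2_eq_2)
    next
      case False
      then have "?a s = y s * F (s + 1) / F s" using factors(1) by (simp only: d_def if_False)
      then show ?thesis using False by simp
    qed
  qed
  have pa: "(\<Prod>s=1..r. y s * F (s + 1) / F s) = p (r + 1) * F (r + 1) / F 1" if "1 \<le> r" "r \<le> N" for r
    using that
  proof (induction r rule: dec_induct)
    case base
    then show ?case by (simp add: chain_prod_Suc numeral_2_eq_2)
  next
    case (step r)
    then show ?case using F_pos[of "r + 1"] by (simp add: chain_prod_Suc)
  qed
  have "(\<Prod>s=1..N. ?a s) = (\<Prod>s=1..N. y s * F (s + 1) / F s) * (\<Prod>s=1..N. if s = 1 then y 1 * F 2 / F 1 else 1)"
    unfolding prod.distrib[symmetric] by (rule prod.cong) (use a in auto)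
  also have "\<dots> = p (N + 1) / F 1 * (y 1 * F 2 / F 1)"
    using pa[of N] N F_last by (simp add: prod.delta)
  finally have A: "(\<Prod>s=1..N. ?a s) = p (N + 1) / F 1 * (y 1 * F 2 / F 1)" .
  have B: "(\<Prod>s=2..N. ?b s) = F 1 / (S 2 * F 2)"
  proof (cases "N = 1")
    case True
    then show ?thesis using F_last F_1 S_pos[of 2] by (simp add: numeral_2_eq_2)
  next
    case False
    then have pos: "0 < y 2" "0 < F 3" "0 < F 1" "0 < F 2" "0 < S 2"
      using N by (auto intro!: y F_pos S_pos)
    have "(\<Prod>s=2..N. ?b s) = (\<Prod>s=2..N. if s = 2 then ?b 2 else 1)"
      by (rule prod.cong) (auto simp: g_def mutation_factor_def)
    also have "\<dots> = ?b 2" using False N by (simp add: prod.delta)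
    also have "\<dots> = inverse (1 + inverse (F 1 / (y 2 * F 3)))"
      using pos by (simp add: mutation_factor_def g_def chain_sum_Suc numeral_2_eq_2 numeral_3_eq_3 add_pos_pos)
    also have "\<dots> = F 1 / (F 1 + S 1 * (y 2 * F 3))"
      using pos by (simp add: chain_sum_Suc field_simps)
    also have "F 1 + S 1 * (y 2 * F 3) = S 2 * F 2"
      using F_S[of 2] False N by simp
    finally show ?thesis .
  qed
  have row: "Q s 0 = - of_bool (s = 1) - of_bool (s = N) \<and> Q 0 s = - (- of_bool (s = 1) - of_bool (s = N))"
    if "1 \<le> s" "s \<le> N" for s
    using Q0 that by simp
  note result = chain_mutation[OF Q row x]
  have "snd (fold mutate (rev [1..<N+1] @ [2..<N+1]) (Q, x)) 0
    = x 0 * ((\<Prod>s=1..N. ?a s) * (\<Prod>s=2..N. ?b s))"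
    using result(3) by simp
  also have "\<dots> = x 0 * (chain_prod y (N + 1) * y 1 / (chain_sum y 2 * chain_sum y (N + 1)))"
    unfolding A B using F_1 F_pos[of 1] F_pos[of 2] N by simp
  finally show "snd (fold mutate (rev [1..<N+1] @ [2..<N+1]) (Q, x)) 0
    = x 0 * (chain_prod y (N + 1) * y 1 / (chain_sum y 2 * chain_sum y (N + 1)))" .
  show "snd (fold mutate (rev [1..<N+1] @ [2..<N+1]) (Q, x)) 1 = chain_sum y N / chain_prod y (N + 1)"
    using result(1) by simp
  show "snd (fold mutate (rev [1..<N+1] @ [2..<N+1]) (Q, x)) s = chain_sum y (s - 1) * y s / chain_sum y (s + 1)"
    if "2 \<le> s" "s \<le> N" for s
    using result(2) that by simp
qed

section \<open>The transformed variables and the braid relation\<close>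

definition line_var :: "nat \<Rightarrow> nat \<Rightarrow> (vertex \<Rightarrow> real) \<Rightarrow> nat \<Rightarrow> real" where
  "line_var n i x t = x (line_vertex n i t)"

locale positive_line =
  fixes n i :: nat and x :: "vertex \<Rightarrow> real"
  assumes n: "3 \<le> n" and i: "1 \<le> i" "i < n" and x_pos: "\<forall>v\<in>vertices n. 0 < x v"
begin

abbreviation "y \<equiv> line_var n i x"
abbreviation "P \<equiv> chain_prod y"
abbreviation "S \<equiv> chain_sum y"

lemma y_pos: "1 \<le> t \<Longrightarrow> t < n \<Longrightarrow> 0 < y t"
  using x_pos line_vertex_in i by (simp add: line_var_def)

lemma P_pos: "t \<le> n \<Longrightarrow> 0 < P t"
  by (rule chain_prod_pos) (use y_pos in auto)

lemma S_pos: "1 \<le> t \<Longrightarrow> t \<le> n \<Longrightarrow> 0 < S t"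
  by (rule chain_sum_pos) (use y_pos in auto)

lemma ratio_pos: "1 \<le> t \<Longrightarrow> t < n \<Longrightarrow> 0 < chain_ratio y t"
  using S_pos[of t] S_pos[of "Suc t"] by (simp add: chain_ratio_def)

definition mutated :: "vertex \<Rightarrow> real" where
  "mutated = snd (fold mutate (line_sequence n i) (A_quiver n, x))"

text \<open>The embedding of the chain and a further vertex \<open>v\<close> into the quiver.\<close>

definition probe :: "vertex \<Rightarrow> nat \<Rightarrow> vertex" where
  "probe v t = (if t = 0 then v else line_vertex n i t)"

lemma mutated_probe:
  assumes v: "v \<notin> line_vertex n i ` {1..n-2}" and t: "t \<le> n - 2"
  shows "mutated (probe v t) = snd (fold mutate (rev [1..<n - 2 + 1] @ [2..<n - 2 + 1])
      (\<lambda>a b. A_quiver n (probe v a) (probe v b), \<lambda>a. x (probe v a))) t"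
proof -
  let ?zs = "rev [1..<n - 2 + 1] @ [2..<n - 2 + 1]"
  have "line_sequence n i = map (line_vertex n i) ?zs"
    using n unfolding line_sequence_def by (simp add: Suc_diff_Suc numeral_2_eq_2)
  also have "\<dots> = map (probe v) ?zs"
    by (rule map_cong) (auto simp: probe_def)
  finally have seq: "line_sequence n i = map (probe v) ?zs" .
  have inj: "inj_on (probe v) {0..n-2}"
  proof (rule inj_onI)
    fix a b assume ab: "a \<in> {0..n-2}" "b \<in> {0..n-2}" "probe v a = probe v b"
    have new: "c = 0" if "line_vertex n i c = v" "c \<le> n - 2" for c
    proof (rule ccontr)
      assume "c \<noteq> 0"
      then have "c \<in> {1..n-2}" using that by simp
      then show False using v that(1) by blast
    qed
    consider "a = 0" "b = 0" | "a = 0" "1 \<le> b" | "1 \<le> a" "b = 0" | "1 \<le> a" "1 \<le> b" by linarith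
    then show "a = b"
    proof cases
      case 2
      then have "line_vertex n i b = v" "b \<le> n - 2" using ab by (simp_all add: probe_def)
      then show ?thesis using new[of b] 2 by simp
    next
      case 3
      then have "line_vertex n i a = v" "a \<le> n - 2" using ab by (simp_all add: probe_def)
      then show ?thesis using new[of a] 3 by simp
    next
      case 4
      then have "a \<in> {1..<n}" "b \<in> {1..<n}" "line_vertex n i a = line_vertex n i b"
        using ab n by (simp_all add: probe_def)
      then show ?thesis using inj_onD[OF line_vertex_inj[OF i]] by blast
    qed simp
  qed
  show ?thesis
    unfolding mutated_def seq
    by (rule fold_mutate_relabel[OF inj]) (use t n in auto)
qed

lemma quiver_chain:
  assumes "1 \<le> s" "s \<le> n - 2" "1 \<le> t" "t \<le> n - 2"
  shows "A_quiver n (probe v s) (probe v t) = (if s = t + 1 then 1 else if t = s + 1 then - 1 else 0)"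
proof -
  have st: "s < n" "t < n" "t \<noteq> n - 1" "s \<noteq> n - 1" using assms n by auto
  have "A_quiver n (line_vertex n i s) (line_vertex n i t)
    = (if s = t + 1 then 1 else if t = s + 1 then - 1 else 0)"
  proof (cases "s \<le> t")
    case True
    then show ?thesis using A_quiver_line[OF n i assms(1) st(2)] st by auto
  next
    case False
    then show ?thesis
      using A_quiver_line[OF n i assms(3) st(1)] A_quiver_antisym[of n "line_vertex n i s"] st by auto
  qed
  then show ?thesis using assms by (simp add: probe_def)
qed

lemma mutated_off_line:
  assumes v: "v \<in> vertices n" "v \<notin> line_vertex n i ` {1..<n}"
  shows "mutated v = x v * (\<Prod>t=1..n-2. chain_ratio y t powr line_mult n i v t)"
proof -
  have v': "v \<notin> line_vertex n i ` {1..n-2}" using v(2) n by auto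
  have "mutated (probe v 0) = x (probe v 0) * (\<Prod>t=1..n-2. chain_ratio y t powr line_mult n i v t)"
    unfolding mutated_probe[OF v' le0]
  proof (rule chain_mutation_neighbour)
    show "1 \<le> n - 2" using n by simp
    show "0 < y s" if "1 \<le> s" "s \<le> n - 2" for s using y_pos that n by auto
    show "line_mult n i v 0 = 0" "0 \<le> line_mult n i v t" for t by (simp_all add: line_mult_def)
    show "A_quiver n (probe v s) (probe v t) = (if s = t + 1 then 1 else if t = s + 1 then - 1 else 0)"
      if "1 \<le> s" "s \<le> n - 2" "1 \<le> t" "t \<le> n - 2" for s t by (rule quiver_chain[OF that])
    show "A_quiver n (probe v s) (probe v 0) = line_mult n i v s - line_mult n i v (s - 1) \<and>
        A_quiver n (probe v 0) (probe v s) = - (line_mult n i v s - line_mult n i v (s - 1))"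
      if "1 \<le> s" "s \<le> n - 2" for s
    proof -
      have "A_quiver n (line_vertex n i s) v = line_mult n i v s - line_mult n i v (s - 1)"
        by (rule A_quiver_off_line[OF i v]) (use that n in auto)
      then show ?thesis using A_quiver_antisym[of n v "line_vertex n i s"] that by (simp add: probe_def)
    qed
    show "x (probe v s) = y s" if "1 \<le> s" "s \<le> n - 2" for s using that by (simp add: probe_def line_var_def)
  qed
  then show ?thesis by (simp add: probe_def)
qed

lemma mutated_line:
  shows "mutated (line_vertex n i (n - 1)) = y (n - 1) * (P (n - 1) * y 1 / (S 2 * S (n - 1)))"
    and "mutated (line_vertex n i 1) = S (n - 2) / P (n - 1)"
    and "\<And>s. 2 \<le> s \<Longrightarrow> s \<le> n - 2 \<Longrightarrow> mutated (line_vertex n i s) = S (s - 1) * y s / S (s + 1)"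
proof -
  define v where "v = line_vertex n i (n - 1)"
  have v': "v \<notin> line_vertex n i ` {1..n-2}"
  proof
    assume "v \<in> line_vertex n i ` {1..n-2}"
    then obtain t where "t \<in> {1..n-2}" "line_vertex n i (n - 1) = line_vertex n i t" by (auto simp: v_def)
    moreover have "n - 1 \<in> {1..<n}" "t \<in> {1..<n}" "n - 1 \<noteq> t" using \<open>t \<in> {1..n-2}\<close> n by auto
    ultimately show False using inj_onD[OF line_vertex_inj[OF i], of "n - 1" t] by blast
  qed
  have N: "1 \<le> n - 2" using n by simp
  have y: "0 < y s" if "1 \<le> s" "s \<le> n - 2" for s using y_pos that n by auto
  have row: "A_quiver n (probe v s) (probe v 0) = - of_bool (s = 1) - of_bool (s = n - 2) \<and>
      A_quiver n (probe v 0) (probe v s) = of_bool (s = 1) + of_bool (s = n - 2)"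
    if s: "1 \<le> s" "s \<le> n - 2" for s
  proof -
    have le: "n - 1 < n" "s \<le> n - 1" using s n by auto
    have "(n - 1 = s + 1) = (s = n - 2)" using n by auto
    then have "A_quiver n (line_vertex n i s) v = - of_bool (s = 1) - of_bool (s = n - 2)"
      unfolding v_def A_quiver_line[OF n i s(1) le] by simp
    then show ?thesis using A_quiver_antisym[of n v "line_vertex n i s"] s by (simp add: probe_def)
  qed
  have xy: "x (probe v s) = y s" if "1 \<le> s" "s \<le> n - 2" for s using that by (simp add: probe_def line_var_def)
  note res = chain_mutation_end[where N = "n - 2" and y = y and x = "\<lambda>a. x (probe v a)"
      and Q = "\<lambda>a b. A_quiver n (probe v a) (probe v b)", OF N y quiver_chain row xy]
  have n': "n - 2 + 1 = n - 1" using n by simp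
  have "mutated (probe v 0) = x (probe v 0) * (P (n - 2 + 1) * y 1 / (S 2 * S (n - 2 + 1)))"
    unfolding mutated_probe[OF v' le0] by (rule res(1)) simp_all
  then show "mutated (line_vertex n i (n - 1)) = y (n - 1) * (P (n - 1) * y 1 / (S 2 * S (n - 1)))"
    unfolding n' by (simp add: probe_def v_def line_var_def)
  have "mutated (probe v 1) = S (n - 2) / P (n - 2 + 1)"
    unfolding mutated_probe[OF v' N] by (rule res(2)) simp_all
  then show "mutated (line_vertex n i 1) = S (n - 2) / P (n - 1)"
    unfolding n' by (simp add: probe_def)
  show "mutated (line_vertex n i s) = S (s - 1) * y s / S (s + 1)" if s: "2 \<le> s" "s \<le> n - 2" for s
  proof -
    have "mutated (probe v s) = S (s - 1) * y s / S (s + 1)"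
      unfolding mutated_probe[OF v' s(2)] by (rule res(3)) (use s in simp_all)
    then show ?thesis using s by (simp add: probe_def)
  qed
qed

text \<open>The first and the last value account for the interchange of \<open>y\<^sub>1\<close> and \<open>y\<^bsub>n-1\<^esub>\<close>.\<close>

definition line_factor :: "nat \<Rightarrow> real" where
  "line_factor t = (if t = 1 then P n / (S 2 * S (n - 1))
     else if t = n - 1 then S (n - 2) / P n else S (t - 1) / S (t + 1))"

lemma transformed_line:
  assumes "1 \<le> t" "t < n"
  shows "line_transformation n i x (line_vertex n i t) = y t * line_factor t"
proof -
  have T: "line_transformation n i x = mutated(line_vertex n i 1 := mutated (line_vertex n i (n - 1)),
      line_vertex n i (n - 1) := mutated (line_vertex n i 1))"
    by (simp add: line_transformation_def swap_variables_def mutated_def)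
  have eq: "line_vertex n i a = line_vertex n i b \<longleftrightarrow> a = b" if "1 \<le> a" "a < n" "1 \<le> b" "b < n" for a b
    using inj_onD[OF line_vertex_inj[OF i], of a b] that by auto
  have Pn: "P n = P (n - 1) * y (n - 1)"
    using chain_prod_Suc[of "n - 1" y] n by (simp add: Suc_diff_Suc)
  have ne: "(1::nat) \<noteq> n - 1" "1 \<le> n - 1" "n - 1 < n" "1 < n" using n by auto
  consider "t = 1" | "t = n - 1" | "2 \<le> t" "t \<le> n - 2" using assms by linarith
  then show ?thesis
  proof cases
    case 1
    then show ?thesis using eq[OF order.refl ne(4) ne(2,3)] ne mutated_line(1) Pn by (simp add: T line_factor_def)
  next
    case 2
    then show ?thesis using ne mutated_line(2) Pn y_pos[of "n - 1"] by (simp add: T line_factor_def)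
  next
    case 3
    then have "t \<noteq> 1" "t \<noteq> n - 1" using n by auto
    moreover have "line_vertex n i t \<noteq> line_vertex n i 1" "line_vertex n i t \<noteq> line_vertex n i (n - 1)"
      using eq[OF assms order.refl ne(4)] eq[OF assms ne(2,3)] calculation by simp_all
    ultimately show ?thesis using mutated_line(3)[OF 3] by (simp add: T line_factor_def)
  qed
qed

lemma transformed_off_line:
  assumes v: "v \<in> vertices n" "v \<notin> line_vertex n i ` {1..<n}"
  shows "line_transformation n i x v = x v * (\<Prod>t=1..n-2. chain_ratio y t powr line_mult n i v t)"
proof -
  have "v \<noteq> line_vertex n i 1" "v \<noteq> line_vertex n i (n - 1)" using v n by auto
  then have "line_transformation n i x v = mutated v"
    by (simp add: line_transformation_def swap_variables_def mutated_def)
  then show ?thesis using mutated_off_line[OF v] by simp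
qed

lemma prod_powr_single:
  "(\<Prod>t=1..n-2. chain_ratio y t powr of_bool (c \<and> t = t0)) = (if c \<and> 1 \<le> t0 \<and> t0 \<le> n - 2 then chain_ratio y t0 else 1)"
proof -
  have "chain_ratio y t powr of_bool (c \<and> t = t0) = (if t = t0 then (if c then chain_ratio y t0 else 1) else 1)"
    if "t \<in> {1..n-2}" for t
  proof -
    have "1 \<le> t" "t < n" using that n by auto
    then have "0 < chain_ratio y t" by (rule ratio_pos)
    then show ?thesis by auto
  qed
  then have "(\<Prod>t=1..n-2. chain_ratio y t powr of_bool (c \<and> t = t0))
    = (\<Prod>t=1..n-2. if t = t0 then (if c then chain_ratio y t0 else 1) else 1)"
    by (rule prod.cong[OF refl])
  then show ?thesis by (simp add: prod.delta)
qed

text \<open>Each of the four conditions in \<open>line_neighbour\<close> determines \<open>t\<close>.\<close>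

lemma off_line_factor:
  assumes "\<And>t. 1 \<le> t \<Longrightarrow> t \<le> n - 2 \<Longrightarrow> line_neighbour n i t v =
     of_bool (c1 \<and> t = t1) + of_bool (c2 \<and> t = t2) + of_bool (c3 \<and> t = t3) + of_bool (c4 \<and> t = t4)"
    and "c1 \<Longrightarrow> 1 \<le> t1 \<and> t1 \<le> n - 2" "c2 \<Longrightarrow> 1 \<le> t2 \<and> t2 \<le> n - 2"
      "c3 \<Longrightarrow> 1 \<le> t3 \<and> t3 \<le> n - 2" "c4 \<Longrightarrow> 1 \<le> t4 \<and> t4 \<le> n - 2"
  shows "(\<Prod>t=1..n-2. chain_ratio y t powr line_mult n i v t)
    = (if c1 then chain_ratio y t1 else 1) * (if c2 then chain_ratio y t2 else 1)
    * (if c3 then chain_ratio y t3 else 1) * (if c4 then chain_ratio y t4 else 1)"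
proof -
  have "chain_ratio y t powr line_mult n i v t =
     chain_ratio y t powr of_bool (c1 \<and> t = t1) * chain_ratio y t powr of_bool (c2 \<and> t = t2)
   * chain_ratio y t powr of_bool (c3 \<and> t = t3) * chain_ratio y t powr of_bool (c4 \<and> t = t4)"
    if "t \<in> {1..n-2}" for t
  proof -
    have "line_mult n i v t = of_bool (c1 \<and> t = t1) + of_bool (c2 \<and> t = t2) + of_bool (c3 \<and> t = t3) + of_bool (c4 \<and> t = t4)"
    proof -
      have t: "1 \<le> t" "t \<le> n - 2" "t + 2 \<le> n" using that n by auto
      show ?thesis unfolding line_mult_def assms(1)[OF t(1,2)] using t by simp
    qed
    then show ?thesis by (simp add: powr_add)
  qed
  then have "(\<Prod>t=1..n-2. chain_ratio y t powr line_mult n i v t) =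
    (\<Prod>t=1..n-2. chain_ratio y t powr of_bool (c1 \<and> t = t1) * chain_ratio y t powr of_bool (c2 \<and> t = t2)
   * chain_ratio y t powr of_bool (c3 \<and> t = t3) * chain_ratio y t powr of_bool (c4 \<and> t = t4))"
    by (rule prod.cong[OF refl])
  also have "\<dots> = (if c1 then chain_ratio y t1 else 1) * (if c2 then chain_ratio y t2 else 1)
    * (if c3 then chain_ratio y t3 else 1) * (if c4 then chain_ratio y t4 else 1)"
    unfolding prod.distrib prod_powr_single using assms(2-5) by auto
  finally show ?thesis .
qed

abbreviation "r \<equiv> line_ratio n i y"

lemma r_boundary: "r a 0 = 1" "n < a + j \<Longrightarrow> r a j = 1" "r 0 j = 1"
  by (simp_all add: line_ratio_def)

lemma r_pos: "0 < r a j"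
proof -
  have *: "0 < chain_ratio y t" if "1 \<le> t" "t < n" for t using ratio_pos that by simp
  have "0 < S (n - 1) / P n" using S_pos[of "n - 1"] P_pos[of n] n by simp
  then show ?thesis
    using *[of "n - a - 1"] *[of "n - a"] *[of "a - 1"] *[of a] i
    by (auto simp: line_ratio_def)
qed

lemma ratio_Inner_off_line:
  assumes v: "Inner a b c \<in> vertices n" "Inner a b c \<notin> line_vertex n i ` {1..<n}"
  shows "(\<Prod>t=1..n-2. chain_ratio y t powr line_mult n i (Inner a b c) t) = r a (b + 1) / r a b"
proof -
  note abc = off_line(1)[OF i v refl]
  then have abc': "a + b + c = n" "1 \<le> a" "1 \<le> b" "1 \<le> c" "b \<noteq> i" "c + i \<noteq> n" by auto
  have "(\<Prod>t=1..n-2. chain_ratio y t powr line_mult n i (Inner a b c) t)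
    = (if b = i + 1 then chain_ratio y a else 1) * (if b + 1 = i then chain_ratio y (a - 1) else 1)
    * (if c + i + 1 = n then chain_ratio y (n - a) else 1) * (if c + i = n + 1 then chain_ratio y (n - a - 1) else 1)"
  proof (rule off_line_factor)
    fix t assume t: "1 \<le> t" "t \<le> n - 2"
    have "(b + 1 = i \<and> a = t + 1) = (b + 1 = i \<and> t = a - 1)" "(c + i + 1 = n \<and> a + t = n) = (c + i + 1 = n \<and> t = n - a)"
      "(c + i = n + 1 \<and> a + t + 1 = n) = (c + i = n + 1 \<and> t = n - a - 1)" "(b = i + 1 \<and> a = t) = (b = i + 1 \<and> t = a)"
      using t abc'(1-4) by auto
    note eqs = this
    show "line_neighbour n i t (Inner a b c) = of_bool (b = i + 1 \<and> t = a) + of_bool (b + 1 = i \<and> t = a - 1)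
      + of_bool (c + i + 1 = n \<and> t = n - a) + of_bool (c + i = n + 1 \<and> t = n - a - 1)"
      unfolding line_neighbour.simps eqs ..
  next
    show "b = i + 1 \<Longrightarrow> 1 \<le> a \<and> a \<le> n - 2" using abc' by auto
    show "b + 1 = i \<Longrightarrow> 1 \<le> a - 1 \<and> a - 1 \<le> n - 2"
    proof -
      assume "b + 1 = i"
      then have "a \<noteq> 1" using abc' by auto
      then show ?thesis using abc' by auto
    qed
    show "c + i + 1 = n \<Longrightarrow> 1 \<le> n - a \<and> n - a \<le> n - 2"
    proof -
      assume "c + i + 1 = n"
      then have "a \<noteq> 1" using abc' by auto
      then show ?thesis using abc' by auto
    qed
    show "c + i = n + 1 \<Longrightarrow> 1 \<le> n - a - 1 \<and> n - a - 1 \<le> n - 2" using abc' by auto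
  qed
  moreover have "r a (b + 1) = (if c + i = n + 1 then chain_ratio y (n - a - 1) else if b + 1 = i then chain_ratio y (a - 1) else 1)"
  proof -
    have "(a + (b + 1) = i) = (c + i = n + 1)" "(a = 1 \<and> b + 1 = i) = False" "(a + (b + 1) = i + 1) = False"
      "(b + 1 = i + 1) = False" "(a = 0 \<or> b + 1 = 0 \<or> n < a + (b + 1)) = False"
      using abc' by auto
    note eqs = this
    show ?thesis unfolding line_ratio_def eqs by simp
  qed
  moreover have "r a b = (if c + i + 1 = n then 1 / chain_ratio y (n - a) else if b = i + 1 then 1 / chain_ratio y a else 1)"
  proof -
    have "(a + b = i) = False" "(a = 1 \<and> b = i) = False" "(a + b = i + 1) = (c + i + 1 = n)"
      "(b = i) = False" "(a = 0 \<or> b = 0 \<or> n < a + b) = False"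
      using abc' by auto
    note eqs = this
    show ?thesis unfolding line_ratio_def eqs by simp
  qed
  moreover have "\<not> (c + i = n + 1 \<and> b + 1 = i)" "\<not> (c + i + 1 = n \<and> b = i + 1)" using abc' by auto
  ultimately show ?thesis by auto
qed

lemma ratio_Merged_off_line:
  assumes v: "Merged k \<in> vertices n" "Merged k \<notin> line_vertex n i ` {1..<n}"
  shows "(\<Prod>t=1..n-2. chain_ratio y t powr line_mult n i (Merged k) t) = r k 1 / r (n - k) k"
proof -
  have k: "1 \<le> k" "k < n" "k \<noteq> i" using off_line(2)[OF i v refl] by auto
  have "(\<Prod>t=1..n-2. chain_ratio y t powr line_mult n i (Merged k) t)
    = (if k = i + 1 then chain_ratio y (n - k) else 1) * (if k + 1 = i then chain_ratio y (n - k - 1) else 1)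
    * (if i = 1 then chain_ratio y (k - 1) else 1) * (if i + 1 = n then chain_ratio y k else 1)"
  proof (rule off_line_factor)
    fix t assume t: "1 \<le> t" "t \<le> n - 2"
    have "(k = i + 1 \<and> t + i + 1 = n) = (k = i + 1 \<and> t = n - k)" "(k + 1 = i \<and> t + i = n) = (k + 1 = i \<and> t = n - k - 1)"
      "(i = 1 \<and> k = t + 1) = (i = 1 \<and> t = k - 1)" "(i + 1 = n \<and> k = t) = (i + 1 = n \<and> t = k)"
      using t k by auto
    note eqs = this
    show "line_neighbour n i t (Merged k) = of_bool (k = i + 1 \<and> t = n - k) + of_bool (k + 1 = i \<and> t = n - k - 1)
      + of_bool (i = 1 \<and> t = k - 1) + of_bool (i + 1 = n \<and> t = k)"
      unfolding line_neighbour.simps eqs ..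
  next
    show "k = i + 1 \<Longrightarrow> 1 \<le> n - k \<and> n - k \<le> n - 2" using k i by auto
    show "k + 1 = i \<Longrightarrow> 1 \<le> n - k - 1 \<and> n - k - 1 \<le> n - 2" using k i by auto
    show "i = 1 \<Longrightarrow> 1 \<le> k - 1 \<and> k - 1 \<le> n - 2" using k by auto
    show "i + 1 = n \<Longrightarrow> 1 \<le> k \<and> k \<le> n - 2" using k by auto
  qed
  moreover have "r k 1 = (if k + 1 = i then chain_ratio y (n - k - 1) else if i = 1 then chain_ratio y (k - 1) else 1)"
  proof -
    have "(k = 1 \<and> 1 = i) = False" "(k = 1 \<and> i = 1) = False" "(k + 1 = i + 1) = False" "((1::nat) = i + 1) = False" "(1 = i) = (i = 1)"
      "(k = 0 \<or> (1::nat) = 0 \<or> n < k + 1) = False"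
      using k i by auto
    note eqs = this
    show ?thesis unfolding line_ratio_def eqs by simp
  qed
  moreover have "r (n - k) k = (if i + 1 = n then 1 / chain_ratio y k else if k = i + 1 then 1 / chain_ratio y (n - k) else 1)"
  proof -
    have "(n - k + k = i) = False" "(n - k = 1 \<and> k = i) = False" "(n - k + k = i + 1) = (i + 1 = n)"
      "(k = i) = False" "(n - k = 0 \<or> k = 0 \<or> n < n - k + k) = False" "n - (n - k) = k"
      using k i by auto
    note eqs = this
    show ?thesis unfolding line_ratio_def eqs by simp
  qed
  moreover have "\<not> (k + 1 = i \<and> i = 1)" "\<not> (i + 1 = n \<and> k = i + 1)" using k by auto
  ultimately show ?thesis by auto
qed

lemma ratio_right:
  assumes "1 \<le> s" "s < n - i"
  shows "r s (i + 1) / r s i = line_factor s"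
proof -
  have "(s = 0 \<or> i + 1 = 0 \<or> n < s + (i + 1)) = False" "(s + (i + 1) = i) = False" "(s = 1 \<and> i + 1 = i) = False"
    "(s + (i + 1) = i + 1) = False" "(i + 1 = i) = False" "(i + 1 = i + 1) = True"
    using assms i by auto
  note eqs = this
  have 1: "r s (i + 1) = 1 / chain_ratio y s" unfolding line_ratio_def eqs by simp
  have "(s = 0 \<or> i = 0 \<or> n < s + i) = False" "(s + i = i) = False" "(i = i) = True"
    using assms i by auto
  note eqs = this
  have 2: "r s i = (if s = 1 then S (n - 1) / P n else chain_ratio y (s - 1))"
    unfolding line_ratio_def eqs using assms by simp
  have "s \<noteq> n - 1" using assms i by auto
  moreover have "0 < S s" "0 < S (Suc s)" using assms i by (auto intro!: S_pos)
  ultimately show ?thesis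
    unfolding 1 2 using assms by (auto simp: line_factor_def chain_ratio_def chain_sum_Suc numeral_2_eq_2)
qed

lemma ratio_left:
  assumes "n - i < t" "t < n"
  shows "r (n - t) (t - (n - i) + 1) / r (n - t) (t - (n - i)) = line_factor t"
proof -
  define a b where "a = n - t" and "b = t - (n - i)"
  have ab: "1 \<le> a" "1 \<le> b" "a + b = i" "n - a = t" "a + t = n" "2 \<le> t" using assms i by (auto simp: a_def b_def)
  have "(a = 0 \<or> b + 1 = 0 \<or> n < a + (b + 1)) = False" "(a + (b + 1) = i) = False" "(a = 1 \<and> b + 1 = i) = (a = 1)"
    "(a + (b + 1) = i + 1) = True"
    using ab i by auto
  note eqs = this
  have 1: "r a (b + 1) = (if a = 1 then S (n - 1) / P n else 1 / chain_ratio y t)" 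
    unfolding line_ratio_def eqs using ab by simp
  have "(a = 0 \<or> b = 0 \<or> n < a + b) = False" "(a + b = i) = True"
    using ab i by auto
  note eqs = this
  have 2: "r a b = chain_ratio y (t - 1)"
    unfolding line_ratio_def eqs using ab by simp
  have "(a = 1) = (t = n - 1)" "t \<noteq> 1" "Suc (t - 1) = t" using ab by auto
  moreover have "0 < S t" by (rule S_pos) (use ab assms in auto)
  moreover have "0 < S (n - 1)" by (rule S_pos) (use n in auto)
  ultimately show ?thesis
    unfolding a_def[symmetric] b_def[symmetric] 1 2
    by (auto simp: line_factor_def chain_ratio_def diff_diff_eq numeral_2_eq_2)
qed

lemma ratio_Merged: "r i 1 / r (n - i) i = line_factor (n - i)"
proof -
  have "(i = 0 \<or> (1::nat) = 0 \<or> n < i + 1) = False" "(i + 1 = i) = False" "(i = 1 \<and> 1 = i) = (i = 1)" "(i + 1 = i + 1) = True"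
    using i by auto
  note eqs = this
  have 1: "r i 1 = (if i = 1 then S (n - 1) / P n else 1 / chain_ratio y (n - i))"
    unfolding line_ratio_def eqs by simp
  have "(n - i = 0 \<or> i = 0 \<or> n < n - i + i) = False" "(n - i + i = i) = False" "(n - i = 1) = (i + 1 = n)"
     "(n - i + i = i + 1) = (i + 1 = n)"
    using i by auto
  note eqs = this
  have 2: "r (n - i) i = (if i + 1 = n then S (n - 1) / P n else chain_ratio y (n - i - 1))"
    unfolding line_ratio_def eqs by simp
  have pos: "0 < S (n - i)" "0 < S (n - 1)" "0 < S (n - i + 1)" using i n by (auto intro!: S_pos)
  consider "i = 1" | "i + 1 = n" | "i \<noteq> 1" "i + 1 \<noteq> n" by blast
  then show ?thesis
  proof cases
    case 1
    have eq: "n - i = n - 1" "n - i - 1 = n - 2" "Suc (n - 2) = n - 1" "n - i \<noteq> 1" "i + 1 \<noteq> n"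
      using 1 n by auto
    have "line_factor (n - i) = S (n - 2) / P n"
      unfolding line_factor_def using eq by simp
    moreover have "r i 1 = S (n - 1) / P n" using \<open>r i 1 = _\<close> unfolding if_P[OF 1] .
    moreover have "r (n - i) i = S (n - 1) / S (n - 2)"
      using 2 unfolding if_not_P[OF eq(5)] chain_ratio_def eq(2,3) .
    moreover have "S (n - 1) \<noteq> 0" using pos by simp
    ultimately show ?thesis by simp
  next
    case 2
    then have "n - i = 1" "i \<noteq> 1" using n by auto
    then show ?thesis using 1 \<open>r (n - i) i = _\<close> 2 n pos
      by (simp add: line_factor_def chain_ratio_def chain_sum_Suc numeral_2_eq_2)
  next
    case 3
    then have "n - i \<noteq> 1" "n - i \<noteq> n - 1" "Suc (n - i - 1) = n - i" using i by auto
    then show ?thesis using 1 2 3 pos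
      by (simp add: line_factor_def chain_ratio_def)
  qed
qed

text \<open>The variable of a merged vertex has to be distributed over two faces. This choice makes the change
  of the column products equal to \<open>line_ratio\<close> and leaves the products of full columns invariant.\<close>

definition line_change_faces :: "(face \<Rightarrow> real) \<Rightarrow> face \<Rightarrow> real" where
  "line_change_faces Z = (\<lambda>(a, b, c). Z (a, b, c) * (r a (b + 1) / r a b))"

lemma column_weight_change:
  "column_weight n (line_change_faces Z) a j = r a j * column_weight n Z a j"
proof (induction j)
  case 0
  then show ?case by (simp add: r_boundary)
next
  case (Suc j)
  then show ?case
    using r_pos[of a j] by (simp add: column_weight_Suc line_change_faces_def)
qed

lemma corner_weight_change: "corner_weight n (line_change_faces Z) k = corner_weight n Z k"
  unfolding corner_weight_def column_weight_change by (rule prod.cong) (auto simp: r_boundary)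

lemma line_vertex_cases:
  assumes "v \<in> line_vertex n i ` {1..<n}"
  obtains (right) s where "1 \<le> s" "s < n - i" "v = line_vertex n i s" "v = Inner s i (n - i - s)"
    | (mid) "v = line_vertex n i (n - i)" "v = Merged i"
    | (left) t where "n - i < t" "t < n" "v = line_vertex n i t" "v = Inner (n - t) (t - (n - i)) (n - i)"
proof -
  obtain t where t: "1 \<le> t" "t < n" "v = line_vertex n i t" using assms by auto
  consider "t < n - i" | "t = n - i" | "n - i < t" by linarith
  then show ?thesis
    by cases (use t that in \<open>auto simp: line_vertex_def\<close>)
qed

text \<open>The changed face variables induce the mutated quiver variables: on each kind of vertex, the quotient
  of two consecutive values of \<open>line_ratio\<close> is the factor computed from the mutations.\<close>

lemma induces_line_change:
  assumes Z: "induces n Z x"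
  shows "induces n (line_change_faces Z) (line_transformation n i x)"
  unfolding induces_def
proof (intro conjI ballI)
  fix \<alpha> assume "\<alpha> \<in> faces n"
  then have "0 < Z \<alpha>" using Z by (simp add: induces_def)
  then show "0 < line_change_faces Z \<alpha>"
    using r_pos by (cases \<alpha>) (simp add: line_change_faces_def)
next
  fix v assume v: "v \<in> vertices n"
  then have xv: "x v = (\<Prod>\<alpha>\<in>constituents n v. Z \<alpha>)" using Z by (simp add: induces_def)
  have Inner: "(\<Prod>\<alpha>\<in>constituents n v. line_change_faces Z \<alpha>) = x v * (r a (b + 1) / r a b)"
    if "v = Inner a b c" for a b c
    using xv that by (simp add: line_change_faces_def)
  have Merged: "(\<Prod>\<alpha>\<in>constituents n v. line_change_faces Z \<alpha>) = x v * (r k 1 / r (n - k) k)"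
    if "v = Merged k" for k
  proof -
    have k: "1 \<le> k" "k < n" using v that n by auto
    then have "(k, 0, n - k) \<noteq> (n - k, k, 0)" by auto
    then show ?thesis
      using xv that k r_boundary(2)[of "n - k" "k + 1"] by (simp add: line_change_faces_def r_boundary(1))
  qed
  show "line_transformation n i x v = (\<Prod>\<alpha>\<in>constituents n v. line_change_faces Z \<alpha>)"
  proof (cases "v \<in> line_vertex n i ` {1..<n}")
    case False
    show ?thesis
    proof (cases v)
      case (Inner a b c)
      show ?thesis
        unfolding transformed_off_line[OF v False] \<open>\<And>c b a. v = Inner a b c \<Longrightarrow> _\<close>[OF Inner]
        using ratio_Inner_off_line[of a b c] v False Inner by simp
    next
      case (Merged k)
      show ?thesis
        unfolding transformed_off_line[OF v False] \<open>\<And>k. v = Merged k \<Longrightarrow> _\<close>[OF Merged]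
        using ratio_Merged_off_line[of k] v False Merged by simp
    qed
  next
    case True
    then show ?thesis
    proof (cases rule: line_vertex_cases)
      case (right s)
      have "line_transformation n i x v = y s * line_factor s"
        unfolding right(3) by (rule transformed_line) (use right i in auto)
      also have "\<dots> = x v * (r s (i + 1) / r s i)"
        unfolding ratio_right[OF right(1,2)] using right(3) by (simp add: line_var_def)
      finally show ?thesis using Inner[OF right(4)] by simp
    next
      case mid
      have "line_transformation n i x v = y (n - i) * line_factor (n - i)"
        unfolding mid(1) by (rule transformed_line) (use i in auto)
      also have "\<dots> = x v * (r i 1 / r (n - i) i)"
        unfolding ratio_Merged using mid(1) by (simp add: line_var_def)
      finally show ?thesis using Merged[OF mid(2)] by simp
    next
      case (left t)
      have "line_transformation n i x v = y t * line_factor t"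
        unfolding left(3) by (rule transformed_line) (use left in auto)
      also have "\<dots> = x v * (r (n - t) (t - (n - i) + 1) / r (n - t) (t - (n - i)))"
        unfolding ratio_left[OF left(1,2)] using left(3) by (simp add: line_var_def)
      finally show ?thesis using Inner[OF left(4)] by simp
    qed
  qed
qed

lemma braid_line_change:
  assumes Z: "induces n Z x"
  shows "A_matrix n Z = braid_matrix n i (A_matrix n Z) * A_matrix n (line_change_faces Z)
     * (braid_matrix n i (A_matrix n Z))\<^sup>T"
proof -
  have pos: "\<forall>\<alpha>\<in>faces n. 0 < Z \<alpha>" using Z by (simp add: induces_def)
  then have posZ: "0 < Z (a, b, c)" if "a + b + c = n" for a b c using that by (auto simp: faces_def)
  have pos': "\<forall>\<alpha>\<in>faces n. 0 < line_change_faces Z \<alpha>"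
    using induces_line_change[OF Z] by (simp add: induces_def)
  define q q' where "q = column_weight n Z" and "q' = column_weight n (line_change_faces Z)"
  define R where "R = corner_weight n Z"
  have Inner: "Z (a, b, c) = x (Inner a b c)" if "a + b + c = n" "1 \<le> a" "1 \<le> b" "1 \<le> c" for a b c
  proof -
    have "Inner a b c \<in> vertices n" using that by simp
    then show ?thesis using Z unfolding induces_def by fastforce
  qed
  have Merged: "Z (i, 0, n - i) * Z (n - i, i, 0) = y (n - i)"
  proof -
    have "Merged i \<in> vertices n" "(i, 0, n - i) \<noteq> (n - i, i, 0)" using i by auto
    then have "x (Merged i) = Z (i, 0, n - i) * Z (n - i, i, 0)" using Z unfolding induces_def by fastforce
    then show ?thesis by (simp add: line_var_def line_vertex_def)
  qed
  interpret C: line_change n i y q q'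
  proof
    show "1 \<le> i" "i < n" by (fact i)+
    show "0 < y t" if "1 \<le> t" "t < n" for t by (rule y_pos[OF that])
    show "0 < q a j" if "a + j \<le> n" for a j
      unfolding q_def by (rule column_weight_pos[OF pos]) (use that in simp)
    show "q a (i + 1) = q a i * y a" if "1 \<le> a" "a < n - i" for a
      using Inner[of a i "n - a - i"] that i
      by (simp add: q_def column_weight_Suc line_var_def line_vertex_def add.commute)
    show "q a (i - a + 1) = q a (i - a) * y (n - a)" if a: "1 \<le> a" "a < i" for a
    proof -
      have "\<not> n - a < n - i" "n - a \<noteq> n - i" "n - (n - a) = a" "n - a - (n - i) = i - a"
        using a i by auto
      then have "line_vertex n i (n - a) = Inner a (i - a) (n - i)"
        by (simp add: line_vertex_def)
      moreover have "n - a - (i - a) = n - i" using a i by simp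
      ultimately show ?thesis
        using Inner[of a "i - a" "n - i"] a i by (simp add: q_def column_weight_Suc line_var_def)
    qed
    show "q' a j = line_ratio n i y a j * q a j" if "1 \<le> j" "a + j \<le> n" for a j
      by (simp add: q_def q'_def column_weight_change)
  qed
  \<comment> \<open>\<open>R (i + 1) / R i\<close> contains the bottom face of \<open>Merged i\<close>, and \<open>left_mix\<close> its left face\<close>
  have R: "R i * C.left_mix + R (i + 1) * C.bottom_mix = 0"
  proof -
    have "{n + 1 - (i + 1)..n} = insert (n - i) {n + 1 - i..n}" using i by auto
    then have Ri: "R (i + 1) = q (n - i) i * Z (n - i, i, 0) * R i"
      using i by (simp add: R_def corner_weight_def q_def column_weight_Suc)
    have P: "P (n - i + 1) = P (n - i) * (Z (i, 0, n - i) * Z (n - i, i, 0))"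
      unfolding Merged using chain_prod_Suc[of "n - i" y] i by simp
    have qi: "q i 1 = Z (i, 0, n - i)" by (simp add: q_def column_weight_Suc)
    have "Z (i, 0, n - i) \<noteq> 0" using posZ[of i 0 "n - i"] i by simp
    moreover have "q (n - i) i \<noteq> 0" using C.q_pos[of "n - i" i] i by simp
    moreover have "0 < S (n - i)" by (rule S_pos) (use i in auto)
    then have "S (n - i) \<noteq> 0" by simp
    ultimately show ?thesis
      unfolding C.left_mix_def C.bottom_mix_def Ri P qi by (simp add: field_simps)
  qed
  have q0: "0 < q 0 i" "0 < q 0 (i + 1)" using C.q_pos i by simp_all
  have SP: "0 < S (n - 1) / P n" using S_pos[of "n - 1"] P_pos[of n] n by simp
  have "mat_from_1 n (normalized (gram n q R)) = braid_matrix n i (mat_from_1 n (normalized (gram n q R)))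
     * mat_from_1 n (normalized (gram n q' R)) * (braid_matrix n i (mat_from_1 n (normalized (gram n q R))))\<^sup>T"
  proof (rule normalized_braid[OF i])
    show "pos_triangular n (gram n q R)"
      by (rule gram_pos_triangular) (auto simp: R_def intro: C.q_pos corner_weight_pos[OF pos])
    show "pos_triangular n (gram n q' R)"
      by (rule gram_pos_triangular)
        (auto simp: R_def q'_def intro!: corner_weight_pos[OF pos] column_weight_pos[OF pos'])
    show "0 < S (n - 1) / P n * (q 0 i / q 0 (i + 1))" "0 < q 0 (i + 1) / q 0 i"
      using mult_pos_pos[OF SP divide_pos_pos[OF q0]] divide_pos_pos[OF q0(2,1)] by blast+
    show "C.source_mix k f = (if k = i then S (n - 1) / P n * (q 0 i / q 0 (i + 1)) * f (i + 1)
      else if k = i + 1 then (S (n - 1) / P n + 1) * f (i + 1) - q 0 (i + 1) / q 0 i * f i else f k)" for k f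
      by (rule C.source_mix_def)
    show "gram n q' R k l = C.source_mix k (\<lambda>k'. C.source_mix l (gram n q R k'))"
      if "1 \<le> k" "k \<le> n" "1 \<le> l" "l \<le> n" for k l
      by (rule C.gram_change[OF R that])
  qed
  then show ?thesis
    unfolding A_matrix_eq q_def q'_def R_def corner_weight_change .
qed

end

theorem theorem5p4:
  fixes n i :: nat
    and x x' :: "vertex \<Rightarrow> real"
    and Z Z' :: "face \<Rightarrow> real"
  assumes "3 \<le> n" and "1 \<le> i" and "i \<le> n - 1"
    and "\<forall>v\<in>vertices n. 0 < x v"
    and "x' = line_transformation n i x"
    and "induces n Z x" and "induces n Z' x'"
  shows "A_matrix n Z =
    braid_matrix n i (A_matrix n Z) * A_matrix n Z' * (braid_matrix n i (A_matrix n Z))\<^sup>T"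
proof -
  interpret positive_line n i x
    using assms(1-4) by unfold_locales auto
  have "A_matrix n Z' = A_matrix n (line_change_faces Z)"
    by (rule A_matrix_cong_induces[OF induces_line_change[OF assms(6)] assms(7)[unfolded assms(5)]])
  then show ?thesis
    using braid_line_change[OF assms(6)] by simp
qed

end
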